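(* Let $R$ be a commutative ring in which $2$ is invertible and $Q$ a finite quiver with double $\overline{Q}$. Then the triples $(\mathcal{N}_{\mathrm{gr}},\mathrm{br}^-_{\mathrm{gr}},\delta^-_{\mathrm{gr}})$ and $(\mathcal{N}_{\mathrm{gr}},\mathrm{br}^+_{\mathrm{gr}},\delta^+_{\mathrm{gr}})$ are odd IBL algebras (in $R$-supermodules).
   Context: The double $\overline{Q}$ of $Q=(s,t:Q_1\to Q_0)$ has the same vertices and arrows $Q_1\sqcup\{\overline{a}\mid a\in Q_1\}$, with $s(\overline{a})=t(a)$, $t(\overline{a})=s(a)$. For arrows $a,b$ of $\overline{Q}$, $\langle a,b\rangle_{\mathrm{gr}}=1$ if $a=\overline{b}$ or $b=\overline{a}$, and $0$ otherwise. Paths are words $a_1\cdots a_n$ of arrows with $t(a_k)=s(a_{k+1})$, together with constant paths $e_i$. $(R\overline{Q})_{\mathrm{gr}}$ is the path algebra with $\mathbb{Z}/2$-grading $|a|=0$, $|\overline{a}|=1$ for $a\in Q_1$, $|e_i|=0$. $\mathcal{N}_{\mathrm{gr}}$ is the quotient supermodule of $(R\overline{Q})_{\mathrm{gr}}$ by the span of graded commutators. With cyclic indices (here $a_{i+1}\cdots a_{i-1}$ is the rotation of the word with $a_i$ removed, and $a_{i+1}\cdots a_{j-1}$ the cyclic subword strictly between positions $i$ and $j$), and zero on constant paths, define odd maps by: $\mathrm{br}^-_{\mathrm{gr}}(a_1\cdots a_m\otimes b_1\cdots b_n)=\sum_{i,j}(-1)^{\varepsilon}\langle a_i,b_j\rangle_{\mathrm{gr}}e_{t(a_i)}a_{i+1}\cdots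 a_{i-1}b_{j+1}\cdots b_{j-1}$, $\varepsilon=|a_1\cdots a_{i-1}||a_i\cdots a_m|+|b_1\cdots b_{j-1}||b_j\cdots b_n|+|a_{i+1}\cdots a_{i-1}||b_j|$; $\delta^-_{\mathrm{gr}}(a_1\cdots a_n)=\frac12\sum_{i,j}(-1)^{\varepsilon}\langle a_i,a_j\rangle_{\mathrm{gr}}e_{t(a_i)}a_{i+1}\cdots a_{j-1}\otimes e_{t(a_j)}a_{j+1}\cdots a_{i-1}$, $\varepsilon=|a_1\cdots a_{i-1}||a_i\cdots a_n|+|a_{i+1}\cdots a_{j-1}||a_j|$; $\mathrm{br}^+_{\mathrm{gr}}(a_1\cdots a_m\otimes b_1\cdots b_n)=\sum_{i,j}(-1)^{\varepsilon}\langle a_i,b_j\rangle_{\mathrm{gr}}a_ia_{i+1}\cdots a_{i-1}a_ib_jb_{j+1}\cdots b_{j-1}b_j$, $\varepsilon=|a_1\cdots a_{i-1}||a_i\cdots a_m|+|b_1\cdots b_{j-1}||b_j\cdots b_n|+|a_{i+1}\cdots a_{i-1}|+|b_{j+1}\cdots b_{j-1}||b_j|$; $\delta^+_{\mathrm{gr}}(a_1\cdots a_n)=\frac12\sum_{i,j}(-1)^{\varepsilon}\langle a_i,a_j\rangle_{\mathrm{gr}}a_ia_{i+1}\cdots a_{j-1}a_j\otimes a_ja_{j+1}\cdots a_{i-1}a_i$, $\varepsilon=|a_1\cdots a_{i-1}||a_i\cdots a_n|+|a_{i+1}\cdots a_{j-1}|+|a_{j+1}\cdots a_{i-1}||a_i|+|a_j|$.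 An odd IBL algebra is an $R$-supermodule $A$ with odd maps $\mathrm{br}:A\otimes A\to A$ and $\delta:A\to A\otimes A$ that are symmetric ($\mathrm{br}\circ\sigma=\mathrm{br}$, $\sigma\circ\delta=\delta$, $\sigma$ the Koszul symmetry) and satisfy, with the Koszul sign rule for tensor products of odd maps: $\mathrm{br}\circ(\mathrm{br}\otimes\mathrm{id})\circ\mathfrak{S}_3=0$; $\mathfrak{S}_3\circ(\delta\otimes\mathrm{id})\circ\delta=0$; $\mathrm{br}\circ\delta=0$; and $\delta\circ\mathrm{br}+\mathfrak{S}_2\circ(\mathrm{br}\otimes\mathrm{id})\circ(\mathrm{id}\otimes\sigma)\circ(\delta\otimes\mathrm{id})\circ\mathfrak{S}_2=0$, where $\mathfrak{S}_2=\mathrm{id}+\sigma$ and $\mathfrak{S}_3$ is the sum of the three cyclic permutations of $A^{\otimes3}$. *)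

theory Defs
  imports
    "HOL-Algebra.Module"
    "HOL-Algebra.AbelCoset"
    "HOL-Library.Z2"
    "HOL-Library.FuncSet"
    "Graph_Theory.Arc_Walk"
begin

section \<open>Modules, quotients, supermodules\<close>

text \<open>
  The type \<^typ>\<open>bit\<close> is used as the grading group \<open>\<int>/2\<close>. The fields \<open>mult\<close> and \<open>one\<close> that
  HOL-Algebra modules inherit from rings are irrelevant except in the path algebra.
\<close>

definition sgn_pow :: "('r, 'm) ring_scheme \<Rightarrow> bit \<Rightarrow> 'r" where
  "sgn_pow R e = (if e = 0 then \<one>\<^bsub>R\<^esub> else \<ominus>\<^bsub>R\<^esub> \<one>\<^bsub>R\<^esub>)"

record ('r, 'a) supermodule = "('r, 'a) module" +
  grade :: "bit \<Rightarrow> 'a set"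

definition with_grading ::
    "('r, 'a) module \<Rightarrow> (bit \<Rightarrow> 'a set) \<Rightarrow> ('r, 'a) supermodule" where
  "with_grading M g = module.extend M (supermodule.fields g)"

definition supermodule ::
    "('r, 'm) ring_scheme \<Rightarrow> ('r, 'a) supermodule \<Rightarrow> bool" where
  "supermodule R M \<longleftrightarrow>
     Module.module R M \<and> (\<forall>p. submodule (grade M p) R M) \<and>
     grade M 0 <+>\<^bsub>M\<^esub> grade M 1 = carrier M \<and> grade M 0 \<inter> grade M 1 = {\<zero>\<^bsub>M\<^esub>}"

text \<open>
  Maps are extensional (\<open>undefined\<close> outside the carrier), so that two linear maps are equal as
  HOL functions as soon as they agree on the carrier.
\<close>

definition linear_map ::
    "('r, 'm) ring_scheme \<Rightarrow> ('r, 'a, 'k) module_scheme \<Rightarrow> ('r, 'b, 'l) module_scheme \<Rightarrow>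
     ('a \<Rightarrow> 'b) \<Rightarrow> bool" where
  "linear_map R M N h \<longleftrightarrow>
     h \<in> carrier M \<rightarrow>\<^sub>E carrier N \<and>
     (\<forall>x\<in>carrier M. \<forall>y\<in>carrier M. h (x \<oplus>\<^bsub>M\<^esub> y) = h x \<oplus>\<^bsub>N\<^esub> h y) \<and>
     (\<forall>r\<in>carrier R. \<forall>x\<in>carrier M. h (r \<odot>\<^bsub>M\<^esub> x) = r \<odot>\<^bsub>N\<^esub> h x)"

definition odd_map ::
    "('r, 'm) ring_scheme \<Rightarrow> ('r, 'a) supermodule \<Rightarrow> ('r, 'b) supermodule \<Rightarrow>
     ('a \<Rightarrow> 'b) \<Rightarrow> bool" where
  "odd_map R M N h \<longleftrightarrow> linear_map R M N h \<and> (\<forall>p. h ` grade M p \<subseteq> grade N (p + 1))"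

definition submodule_span ::
    "('r, 'm) ring_scheme \<Rightarrow> ('r, 'a, 'k) module_scheme \<Rightarrow> 'a set \<Rightarrow> 'a set" where
  "submodule_span R M S = \<Inter>{H. submodule H R M \<and> S \<subseteq> H}"

definition quotient_module ::
    "('r, 'a, 'k) module_scheme \<Rightarrow> 'a set \<Rightarrow> ('r, 'a set) module" where
  "quotient_module M H =
     \<lparr>carrier = a_rcosets\<^bsub>M\<^esub> H, mult = undefined, one = undefined,
      zero = H, add = (\<lambda>X Y. X <+>\<^bsub>M\<^esub> Y),
      smult = (\<lambda>r X. H <+>\<^bsub>M\<^esub> ((\<lambda>x. r \<odot>\<^bsub>M\<^esub> x) ` X))\<rparr>"

definition quotient_supermodule ::
    "('r, 'a) supermodule \<Rightarrow> 'a set \<Rightarrow> ('r, 'a set) supermodule" where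
  "quotient_supermodule M H =
     with_grading (quotient_module M H) (\<lambda>p. (\<lambda>x. H +>\<^bsub>M\<^esub> x) ` grade M p)"

definition free_module :: "('r, 'm) ring_scheme \<Rightarrow> 'x set \<Rightarrow> ('r, 'x \<Rightarrow> 'r) module" where
  "free_module R S =
     \<lparr>carrier = {f. (\<forall>x. f x \<in> carrier R) \<and> finite {x. f x \<noteq> \<zero>\<^bsub>R\<^esub>} \<and> {x. f x \<noteq> \<zero>\<^bsub>R\<^esub>} \<subseteq> S},
      mult = undefined, one = undefined,
      zero = (\<lambda>x. \<zero>\<^bsub>R\<^esub>), add = (\<lambda>f g x. f x \<oplus>\<^bsub>R\<^esub> g x),
      smult = (\<lambda>r f x. r \<otimes>\<^bsub>R\<^esub> f x)\<rparr>"

definition single :: "('r, 'm) ring_scheme \<Rightarrow> 'x \<Rightarrow> 'x \<Rightarrow> 'r" where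
  "single R x = (\<lambda>y. if y = x then \<one>\<^bsub>R\<^esub> else \<zero>\<^bsub>R\<^esub>)"


section \<open>Tensor products of supermodules\<close>

definition tensor_relations ::
    "('r, 'm) ring_scheme \<Rightarrow> ('r, 'a) supermodule \<Rightarrow> ('r, 'b) supermodule \<Rightarrow>
     ('a \<times> 'b \<Rightarrow> 'r) set" where
  "tensor_relations R A B =
     (let F = free_module R (carrier A \<times> carrier B); s = single R in
      submodule_span R F
        ({s (x \<oplus>\<^bsub>A\<^esub> x', y) \<ominus>\<^bsub>F\<^esub> (s (x, y) \<oplus>\<^bsub>F\<^esub> s (x', y)) | x x' y.
            x \<in> carrier A \<and> x' \<in> carrier A \<and> y \<in> carrier B} \<union>
         {s (x, y \<oplus>\<^bsub>B\<^esub> y') \<ominus>\<^bsub>F\<^esub> (s (x, y) \<oplus>\<^bsub>F\<^esub> s (x, y')) | x y y'.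
            x \<in> carrier A \<and> y \<in> carrier B \<and> y' \<in> carrier B} \<union>
         {s (r \<odot>\<^bsub>A\<^esub> x, y) \<ominus>\<^bsub>F\<^esub> (r \<odot>\<^bsub>F\<^esub> s (x, y)) | r x y.
            r \<in> carrier R \<and> x \<in> carrier A \<and> y \<in> carrier B} \<union>
         {s (x, r \<odot>\<^bsub>B\<^esub> y) \<ominus>\<^bsub>F\<^esub> (r \<odot>\<^bsub>F\<^esub> s (x, y)) | r x y.
            r \<in> carrier R \<and> x \<in> carrier A \<and> y \<in> carrier B}))"

definition pure_tensor ::
    "('r, 'm) ring_scheme \<Rightarrow> ('r, 'a) supermodule \<Rightarrow> ('r, 'b) supermodule \<Rightarrow>
     'a \<Rightarrow> 'b \<Rightarrow> ('a \<times> 'b \<Rightarrow> 'r) set" where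
  "pure_tensor R A B x y =
     tensor_relations R A B +>\<^bsub>free_module R (carrier A \<times> carrier B)\<^esub> single R (x, y)"

definition tensor ::
    "('r, 'm) ring_scheme \<Rightarrow> ('r, 'a) supermodule \<Rightarrow> ('r, 'b) supermodule \<Rightarrow>
     ('r, ('a \<times> 'b \<Rightarrow> 'r) set) supermodule" where
  "tensor R A B =
     (let T = quotient_module (free_module R (carrier A \<times> carrier B)) (tensor_relations R A B) in
      with_grading T (\<lambda>d. submodule_span R T
        {pure_tensor R A B x y | x y p q. x \<in> grade A p \<and> y \<in> grade B q \<and> p + q = d}))"

text \<open>The linear map \<open>x \<otimes> y \<mapsto> (-1)\<^bsup>|x||y|\<^esup> y \<otimes> x\<close>.\<close>

definition koszul_swap ::
    "('r, 'm) ring_scheme \<Rightarrow> ('r, 'a) supermodule \<Rightarrow> ('r, 'b) supermodule \<Rightarrow>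
     ('a \<times> 'b \<Rightarrow> 'r) set \<Rightarrow> ('b \<times> 'a \<Rightarrow> 'r) set" where
  "koszul_swap R A B =
     (THE h. linear_map R (tensor R A B) (tensor R B A) h \<and>
        (\<forall>p q. \<forall>x\<in>grade A p. \<forall>y\<in>grade B q.
           h (pure_tensor R A B x y) =
             sgn_pow R (p * q) \<odot>\<^bsub>tensor R B A\<^esub> pure_tensor R B A y x))"

text \<open>
  \<open>f \<otimes> id : A \<otimes> C \<rightarrow> B \<otimes> C\<close>. By the Koszul rule,
  \<open>(f \<otimes> g)(x \<otimes> y) = (-1)\<^bsup>|g||x|\<^esup> f x \<otimes> g y\<close>; there is no sign here because \<open>id\<close> is even.
\<close>

definition tensor_id ::
    "('r, 'm) ring_scheme \<Rightarrow> ('r, 'a) supermodule \<Rightarrow> ('r, 'b) supermodule \<Rightarrow>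
     ('r, 'c) supermodule \<Rightarrow> ('a \<Rightarrow> 'b) \<Rightarrow> ('a \<times> 'c \<Rightarrow> 'r) set \<Rightarrow> ('b \<times> 'c \<Rightarrow> 'r) set" where
  "tensor_id R A B C f =
     (THE h. linear_map R (tensor R A C) (tensor R B C) h \<and>
        (\<forall>x\<in>carrier A. \<forall>y\<in>carrier C.
           h (pure_tensor R A C x y) = pure_tensor R B C (f x) y))"

text \<open>Triple tensor powers are bracketed to the left: \<open>A \<otimes> A \<otimes> A = (A \<otimes> A) \<otimes> A\<close>.\<close>

type_synonym ('r, 'a) tensor2 = "('a \<times> 'a \<Rightarrow> 'r) set"
type_synonym ('r, 'a) tensor3 = "(('r, 'a) tensor2 \<times> 'a \<Rightarrow> 'r) set"

definition tensor_sq ::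
    "('r, 'm) ring_scheme \<Rightarrow> ('r, 'a) supermodule \<Rightarrow> ('r, ('r, 'a) tensor2) supermodule" where
  "tensor_sq R A = tensor R A A"

definition tensor_cube ::
    "('r, 'm) ring_scheme \<Rightarrow> ('r, 'a) supermodule \<Rightarrow> ('r, ('r, 'a) tensor3) supermodule" where
  "tensor_cube R A = tensor R (tensor_sq R A) A"

definition pure_tensor3 ::
    "('r, 'm) ring_scheme \<Rightarrow> ('r, 'a) supermodule \<Rightarrow> 'a \<Rightarrow> 'a \<Rightarrow> 'a \<Rightarrow> ('r, 'a) tensor3" where
  "pure_tensor3 R A x y z = pure_tensor R (tensor_sq R A) A (pure_tensor R A A x y) z"

text \<open>The map \<open>id \<otimes> \<sigma>\<close> on \<open>A \<otimes> A \<otimes> A\<close>.\<close>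

definition id_tensor_swap ::
    "('r, 'm) ring_scheme \<Rightarrow> ('r, 'a) supermodule \<Rightarrow> ('r, 'a) tensor3 \<Rightarrow> ('r, 'a) tensor3" where
  "id_tensor_swap R A =
     (THE h. linear_map R (tensor_cube R A) (tensor_cube R A) h \<and>
        (\<forall>p q. \<forall>x\<in>carrier A. \<forall>y\<in>grade A p. \<forall>z\<in>grade A q.
           h (pure_tensor3 R A x y z) =
             sgn_pow R (p * q) \<odot>\<^bsub>tensor_cube R A\<^esub> pure_tensor3 R A x z y))"

text \<open>The cyclic permutation \<open>x \<otimes> y \<otimes> z \<mapsto> (-1)\<^bsup>(|x|+|y|)|z|\<^esup> z \<otimes> x \<otimes> y\<close>.\<close>

definition koszul_rot ::
    "('r, 'm) ring_scheme \<Rightarrow> ('r, 'a) supermodule \<Rightarrow> ('r, 'a) tensor3 \<Rightarrow> ('r, 'a) tensor3" where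
  "koszul_rot R A =
     (THE h. linear_map R (tensor_cube R A) (tensor_cube R A) h \<and>
        (\<forall>p q r. \<forall>x\<in>grade A p. \<forall>y\<in>grade A q. \<forall>z\<in>grade A r.
           h (pure_tensor3 R A x y z) =
             sgn_pow R ((p + q) * r) \<odot>\<^bsub>tensor_cube R A\<^esub> pure_tensor3 R A z x y))"

definition sym2 ::
    "('r, 'm) ring_scheme \<Rightarrow> ('r, 'a) supermodule \<Rightarrow> ('r, 'a) tensor2 \<Rightarrow> ('r, 'a) tensor2" where
  "sym2 R A X = X \<oplus>\<^bsub>tensor_sq R A\<^esub> koszul_swap R A A X"

definition cyc3 ::
    "('r, 'm) ring_scheme \<Rightarrow> ('r, 'a) supermodule \<Rightarrow> ('r, 'a) tensor3 \<Rightarrow> ('r, 'a) tensor3" where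
  "cyc3 R A X =
     X \<oplus>\<^bsub>tensor_cube R A\<^esub> koszul_rot R A X \<oplus>\<^bsub>tensor_cube R A\<^esub> koszul_rot R A (koszul_rot R A X)"


section \<open>Odd IBL algebras\<close>

definition odd_IBL_algebra ::
    "('r, 'm) ring_scheme \<Rightarrow> ('r, 'a) supermodule \<Rightarrow>
     (('r, 'a) tensor2 \<Rightarrow> 'a) \<Rightarrow> ('a \<Rightarrow> ('r, 'a) tensor2) \<Rightarrow> bool" where
  "odd_IBL_algebra R A br \<delta> \<longleftrightarrow>
     (let A2 = tensor_sq R A; A3 = tensor_cube R A;
          br_id = tensor_id R A2 A A br; \<delta>_id = tensor_id R A A2 A \<delta>;
          \<sigma> = koszul_swap R A A
      in supermodule R A \<and> odd_map R A2 A br \<and> odd_map R A A2 \<delta> \<and>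
         (\<forall>X\<in>carrier A2. br (\<sigma> X) = br X) \<and>
         (\<forall>x\<in>carrier A. \<sigma> (\<delta> x) = \<delta> x) \<and>
         (\<forall>X\<in>carrier A3. br (br_id (cyc3 R A X)) = \<zero>\<^bsub>A\<^esub>) \<and>
         (\<forall>x\<in>carrier A. cyc3 R A (\<delta>_id (\<delta> x)) = \<zero>\<^bsub>A3\<^esub>) \<and>
         (\<forall>x\<in>carrier A. br (\<delta> x) = \<zero>\<^bsub>A\<^esub>) \<and>
         (\<forall>X\<in>carrier A2.
            \<delta> (br X) \<oplus>\<^bsub>A2\<^esub> sym2 R A (br_id (id_tensor_swap R A (\<delta>_id (sym2 R A X)))) = \<zero>\<^bsub>A2\<^esub>))"


section \<open>The double quiver and its path superalgebra\<close>

text \<open>In the double, \<open>Inl a\<close> is the original arrow \<open>a\<close> and \<open>Inr a\<close> is its reverse.\<close>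

definition double_quiver :: "('v, 'e) pre_digraph \<Rightarrow> ('v, 'e + 'e) pre_digraph" where
  "double_quiver Q =
     \<lparr>verts = verts Q, arcs = Inl ` arcs Q \<union> Inr ` arcs Q,
      tail = case_sum (tail Q) (head Q), head = case_sum (head Q) (tail Q)\<rparr>"

definition arrow_deg :: "'e + 'e \<Rightarrow> bit" where
  "arrow_deg = case_sum (\<lambda>_. 0) (\<lambda>_. 1)"

definition deg :: "('e + 'e) list \<Rightarrow> bit" where
  "deg w = sum_list (map arrow_deg w)"

text \<open>\<open>paired a b\<close> means \<open>\<langle>a, b\<rangle>\<^sub>g\<^sub>r = 1\<close>; otherwise \<open>\<langle>a, b\<rangle>\<^sub>g\<^sub>r = 0\<close>.\<close>

definition paired :: "'e + 'e \<Rightarrow> 'e + 'e \<Rightarrow> bool" where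
  "paired a b \<longleftrightarrow> (\<exists>c. (a = Inr c \<and> b = Inl c) \<or> (b = Inr c \<and> a = Inl c))"

text \<open>
  A path is a pair of its source and its word of arrows; \<open>(i, [])\<close> is the constant path \<open>e\<^sub>i\<close>.
\<close>

type_synonym ('v, 'e) path = "'v \<times> ('e + 'e) list"

definition paths :: "('v, 'e) pre_digraph \<Rightarrow> ('v, 'e) path set" where
  "paths Q = {(u, w). \<exists>v. pre_digraph.awalk (double_quiver Q) u w v}"

definition closed_paths :: "('v, 'e) pre_digraph \<Rightarrow> ('v, 'e) path set" where
  "closed_paths Q = {(u, w). pre_digraph.awalk (double_quiver Q) u w u}"

definition path_end :: "('v, 'e) pre_digraph \<Rightarrow> ('v, 'e) path \<Rightarrow> 'v" where
  "path_end Q = (\<lambda>(u, w). if w = [] then u else head (double_quiver Q) (last w))"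

text \<open>
  The product of two paths is their concatenation if they are composable and zero otherwise;
  hence a coefficient of \<open>f * g\<close> at a word is the sum over all ways of cutting it in two.
\<close>

definition path_superalgebra ::
    "('r, 'm) ring_scheme \<Rightarrow> ('v, 'e) pre_digraph \<Rightarrow>
     ('r, ('v, 'e) path \<Rightarrow> 'r) supermodule" where
  "path_superalgebra R Q =
     with_grading
       ((free_module R (paths Q))
         \<lparr>mult := (\<lambda>f g (u, w).
            \<Oplus>\<^bsub>R\<^esub>k\<in>{..length w}. f (u, take k w) \<otimes>\<^bsub>R\<^esub> g (path_end Q (u, take k w), drop k w)),
          one := (\<lambda>(u, w). if u \<in> verts Q \<and> w = [] then \<one>\<^bsub>R\<^esub> else \<zero>\<^bsub>R\<^esub>)\<rparr>)
       (\<lambda>p. {f \<in> carrier (free_module R (paths Q)). \<forall>u w. f (u, w) \<noteq> \<zero>\<^bsub>R\<^esub> \<longrightarrow> deg w = p})"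

definition graded_commutators ::
    "('r, 'm) ring_scheme \<Rightarrow> ('r, 'a) supermodule \<Rightarrow> 'a set" where
  "graded_commutators R A =
     submodule_span R A
       {x \<otimes>\<^bsub>A\<^esub> y \<ominus>\<^bsub>A\<^esub> (sgn_pow R (p * q) \<odot>\<^bsub>A\<^esub> (y \<otimes>\<^bsub>A\<^esub> x)) | x y p q.
          x \<in> grade A p \<and> y \<in> grade A q}"

definition N_gr ::
    "('r, 'm) ring_scheme \<Rightarrow> ('v, 'e) pre_digraph \<Rightarrow>
     ('r, (('v, 'e) path \<Rightarrow> 'r) set) supermodule" where
  "N_gr R Q =
     (let P = path_superalgebra R Q in quotient_supermodule P (graded_commutators R P))"

definition path_class ::
    "('r, 'm) ring_scheme \<Rightarrow> ('v, 'e) pre_digraph \<Rightarrow> ('v, 'e) path \<Rightarrow>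
     (('v, 'e) path \<Rightarrow> 'r) set" where
  "path_class R Q p =
     (let P = path_superalgebra R Q in graded_commutators R P +>\<^bsub>P\<^esub> single R p)"


section \<open>The brackets and cobrackets\<close>

text \<open>
  \<open>between w i j\<close> is the cyclic subword strictly between positions \<open>i\<close> and \<open>j\<close> of \<open>w\<close> (counted
  from 0); for \<open>i = j\<close> it is the rotation of \<open>w\<close> with the letter at position \<open>i\<close> removed.
\<close>

definition between :: "'e list \<Rightarrow> nat \<Rightarrow> nat \<Rightarrow> 'e list" where
  "between w i j = take ((length w + j - Suc i) mod length w) (rotate (Suc i) w)"

definition paired_positions :: "('e + 'e) list \<Rightarrow> ('e + 'e) list \<Rightarrow> (nat \<times> nat) set" where
  "paired_positions a b = {(i, j). i < length a \<and> j < length b \<and> paired (a ! i) (b ! j)}"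

definition half :: "('r, 'm) ring_scheme \<Rightarrow> 'r" where
  "half R = inv\<^bsub>R\<^esub> (\<one>\<^bsub>R\<^esub> \<oplus>\<^bsub>R\<^esub> \<one>\<^bsub>R\<^esub>)"

text \<open>
  The values of the four operations on closed words. The sums run over the pairs \<open>(i, j)\<close> with
  \<open>\<langle>a\<^sub>i, b\<^sub>j\<rangle>\<^sub>g\<^sub>r = 1\<close> only: for all other pairs the words written in the summands need not
  be paths. The values are zero on constant paths because the sums are then empty.
\<close>

definition br_minus_word ::
    "('r, 'm) ring_scheme \<Rightarrow> ('v, 'e) pre_digraph \<Rightarrow> ('e + 'e) list \<Rightarrow> ('e + 'e) list \<Rightarrow>
     (('v, 'e) path \<Rightarrow> 'r) set" where
  "br_minus_word R Q a b =
     finsum (N_gr R Q)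
       (\<lambda>(i, j).
          sgn_pow R (deg (take i a) * deg (drop i a) + deg (take j b) * deg (drop j b)
                     + deg (between a i i) * arrow_deg (b ! j))
          \<odot>\<^bsub>N_gr R Q\<^esub>
          path_class R Q (head (double_quiver Q) (a ! i), between a i i @ between b j j))
       (paired_positions a b)"

definition delta_minus_word ::
    "('r, 'm) ring_scheme \<Rightarrow> ('v, 'e) pre_digraph \<Rightarrow> ('e + 'e) list \<Rightarrow>
     ('r, (('v, 'e) path \<Rightarrow> 'r) set) tensor2" where
  "delta_minus_word R Q a =
     half R \<odot>\<^bsub>tensor_sq R (N_gr R Q)\<^esub>
     finsum (tensor_sq R (N_gr R Q))
       (\<lambda>(i, j).
          sgn_pow R (deg (take i a) * deg (drop i a) + deg (between a i j) * arrow_deg (a ! j))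
          \<odot>\<^bsub>tensor_sq R (N_gr R Q)\<^esub>
          pure_tensor R (N_gr R Q) (N_gr R Q)
            (path_class R Q (head (double_quiver Q) (a ! i), between a i j))
            (path_class R Q (head (double_quiver Q) (a ! j), between a j i)))
       (paired_positions a a)"

definition br_plus_word ::
    "('r, 'm) ring_scheme \<Rightarrow> ('v, 'e) pre_digraph \<Rightarrow> ('e + 'e) list \<Rightarrow> ('e + 'e) list \<Rightarrow>
     (('v, 'e) path \<Rightarrow> 'r) set" where
  "br_plus_word R Q a b =
     finsum (N_gr R Q)
       (\<lambda>(i, j).
          sgn_pow R (deg (take i a) * deg (drop i a) + deg (take j b) * deg (drop j b)
                     + deg (between a i i) + deg (between b j j) * arrow_deg (b ! j))
          \<odot>\<^bsub>N_gr R Q\<^esub>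
          path_class R Q (tail (double_quiver Q) (a ! i),
            [a ! i] @ between a i i @ [a ! i, b ! j] @ between b j j @ [b ! j]))
       (paired_positions a b)"

definition delta_plus_word ::
    "('r, 'm) ring_scheme \<Rightarrow> ('v, 'e) pre_digraph \<Rightarrow> ('e + 'e) list \<Rightarrow>
     ('r, (('v, 'e) path \<Rightarrow> 'r) set) tensor2" where
  "delta_plus_word R Q a =
     half R \<odot>\<^bsub>tensor_sq R (N_gr R Q)\<^esub>
     finsum (tensor_sq R (N_gr R Q))
       (\<lambda>(i, j).
          sgn_pow R (deg (take i a) * deg (drop i a) + deg (between a i j)
                     + deg (between a j i) * arrow_deg (a ! i) + arrow_deg (a ! j))
          \<odot>\<^bsub>tensor_sq R (N_gr R Q)\<^esub>
          pure_tensor R (N_gr R Q) (N_gr R Q)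
            (path_class R Q (tail (double_quiver Q) (a ! i), [a ! i] @ between a i j @ [a ! j]))
            (path_class R Q (tail (double_quiver Q) (a ! j), [a ! j] @ between a j i @ [a ! i])))
       (paired_positions a a)"

text \<open>
  The word formulas use cyclic indices and therefore only make sense on closed paths. These suffice
  to determine linear maps: a path \<open>p\<close> from \<open>u\<close> to \<open>v \<noteq> u\<close> is the commutator of \<open>e\<^sub>u\<close> and \<open>p\<close>, so
  it vanishes in the quotient.
\<close>

definition is_bracket ::
    "('r, 'm) ring_scheme \<Rightarrow> ('v, 'e) pre_digraph \<Rightarrow>
     (('e + 'e) list \<Rightarrow> ('e + 'e) list \<Rightarrow> (('v, 'e) path \<Rightarrow> 'r) set) \<Rightarrow>
     (('r, (('v, 'e) path \<Rightarrow> 'r) set) tensor2 \<Rightarrow> (('v, 'e) path \<Rightarrow> 'r) set) \<Rightarrow> bool" where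
  "is_bracket R Q value_on br \<longleftrightarrow>
     linear_map R (tensor_sq R (N_gr R Q)) (N_gr R Q) br \<and>
     (\<forall>(u, a)\<in>closed_paths Q. \<forall>(v, b)\<in>closed_paths Q.
        br (pure_tensor R (N_gr R Q) (N_gr R Q) (path_class R Q (u, a)) (path_class R Q (v, b))) =
          value_on a b)"

definition is_cobracket ::
    "('r, 'm) ring_scheme \<Rightarrow> ('v, 'e) pre_digraph \<Rightarrow>
     (('e + 'e) list \<Rightarrow> ('r, (('v, 'e) path \<Rightarrow> 'r) set) tensor2) \<Rightarrow>
     ((('v, 'e) path \<Rightarrow> 'r) set \<Rightarrow> ('r, (('v, 'e) path \<Rightarrow> 'r) set) tensor2) \<Rightarrow> bool" where
  "is_cobracket R Q value_on \<delta> \<longleftrightarrow>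
     linear_map R (N_gr R Q) (tensor_sq R (N_gr R Q)) \<delta> \<and>
     (\<forall>(u, a)\<in>closed_paths Q. \<delta> (path_class R Q (u, a)) = value_on a)"

definition br_minus ::
    "('r, 'm) ring_scheme \<Rightarrow> ('v, 'e) pre_digraph \<Rightarrow>
     ('r, (('v, 'e) path \<Rightarrow> 'r) set) tensor2 \<Rightarrow> (('v, 'e) path \<Rightarrow> 'r) set" where
  "br_minus R Q = (THE br. is_bracket R Q (br_minus_word R Q) br)"

definition delta_minus ::
    "('r, 'm) ring_scheme \<Rightarrow> ('v, 'e) pre_digraph \<Rightarrow>
     (('v, 'e) path \<Rightarrow> 'r) set \<Rightarrow> ('r, (('v, 'e) path \<Rightarrow> 'r) set) tensor2" where
  "delta_minus R Q = (THE \<delta>. is_cobracket R Q (delta_minus_word R Q) \<delta>)"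

definition br_plus ::
    "('r, 'm) ring_scheme \<Rightarrow> ('v, 'e) pre_digraph \<Rightarrow>
     ('r, (('v, 'e) path \<Rightarrow> 'r) set) tensor2 \<Rightarrow> (('v, 'e) path \<Rightarrow> 'r) set" where
  "br_plus R Q = (THE br. is_bracket R Q (br_plus_word R Q) br)"

definition delta_plus ::
    "('r, 'm) ring_scheme \<Rightarrow> ('v, 'e) pre_digraph \<Rightarrow>
     (('v, 'e) path \<Rightarrow> 'r) set \<Rightarrow> ('r, (('v, 'e) path \<Rightarrow> 'r) set) tensor2" where
  "delta_plus R Q = (THE \<delta>. is_cobracket R Q (delta_plus_word R Q) \<delta>)"

end

theory Submission
  imports Defs
begin

text \<open>
  Both structures come from a single operation on words. A cut of a word at a letter \<open>x\<close> deletes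
  \<open>x\<close> (for the minus operations) or leaves one copy of \<open>x\<close> on either side of the cut (for the plus
  operations), that is, it applies the double derivation \<open>x \<mapsto> 1 \<otimes> 1\<close> or \<open>x \<mapsto> x \<otimes> x\<close>. In both cases
  cutting satisfies the Leibniz rule for concatenations and is coassociative: cutting twice does
  not depend on which of the two pieces is cut again. With the sign of moving an odd letter past
  the words in front of it, the bracket cuts two cyclic words and joins the pieces, and the cobracket
  cuts one cyclic word twice. Leibniz rule and coassociativity imply that the cut points of a
  cyclic word can be rotated; all identities then follow since two cuts at disjoint pairs of
  letters anticommute. They hold for every function on words that is invariant under signed
  rotation, hence for the classes in \<open>\<N>\<^sub>g\<^sub>r\<close> and in its tensor powers.
\<close>

section \<open>Cutting words\<close>

text \<open>A pair of cut letters is a chord joining two places of one or two cyclic words. A letter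
  and its reverse have degrees with sum 1, so surgery along a chord is odd, and this is where the
  minus signs come from: the terms of each identity are indexed by two chords, and exchanging the
  two surgeries matches terms of opposite sign. In the Jacobi identity one word carries an end of
  both chords. In the co-Jacobi identity two chords of one word do not cross. For bracket after
  cobracket they cross, and the exchange maps the single family of terms to itself: it gives S = -S,
  so invertibility of 2 enters here besides the factor 1/2. In the compatibility identity the terms
  where both chords join the two words cancel inside cobracket after bracket. The obstacle is that
  the order of cuts around a cyclic word depends on its base point. Sums over cuts are therefore
  recursive functionals of a continuation; indices modulo the length appear only in the comparison
  with the given formulas. Vertices are carried along, because rotation invariance is available only
  for closed walks.\<close>

declare add_bit_eq_xor [simp del] mult_bit_eq_and [simp del]

text \<open>Since sums and products of \<open>bit\<close> are not rewritten to Boolean operations,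
  sign exponents stay polynomials over the field with two elements. These rules together with
  \<open>bit_simps\<close> normalise them.\<close>

lemma bit_add_self [simp]: "x + x = (0::bit)" "x + (x + y) = (y::bit)"
  by (cases x; cases y; simp)+

lemma bit_mult_self [simp]: "x * x = (x::bit)" "x * (x * y) = x * (y::bit)"
  by (cases x; simp)+

lemmas bit_simps = ring_distribs ac_simps

type_synonym 'e word = "('e + 'e) list"

text \<open>Sign and pairing are kept in one operation, because they always occur as a product:
  under nesting the conditions combine by conjunction and the exponents by addition.\<close>

definition sgn_if :: "('m, 'k) ring_scheme \<Rightarrow> bool \<Rightarrow> bit \<Rightarrow> 'm \<Rightarrow> 'm" where
  "sgn_if M P e m = (if P then if e = 0 then m else \<ominus>\<^bsub>M\<^esub> m else \<zero>\<^bsub>M\<^esub>)"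

definition residue :: "bool \<Rightarrow> 'l \<Rightarrow> 'l list" where
  "residue pm x = (if pm then [x] else [])"

text \<open>
  The parameter \<open>pm\<close> distinguishes the plus operations (\<open>True\<close>) from the minus operations.
\<close>

primrec cuts :: "('m, 'k) ring_scheme \<Rightarrow> bool \<Rightarrow> 'l list \<Rightarrow> ('l list \<Rightarrow> 'l \<Rightarrow> 'l list \<Rightarrow> 'm) \<Rightarrow> 'm" where
  "cuts M pm [] F = \<zero>\<^bsub>M\<^esub>"
| "cuts M pm (x # w) F =
     F (residue pm x) x (residue pm x @ w) \<oplus>\<^bsub>M\<^esub> cuts M pm w (\<lambda>u. F (x # u))"

text \<open>The word \<open>v @ u\<close> is what remains of the cyclic word when it is opened at
  the cut, and the exponent is the Koszul sign of moving \<open>u\<close> past the letter and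
  \<open>v\<close>. In the plus case \<open>u\<close> and \<open>v\<close> already contain their
  copies of the letter.\<close>

definition cyc_cuts :: "('m, 'k) ring_scheme \<Rightarrow> bool \<Rightarrow> 'e word \<Rightarrow>
    (('e + 'e) \<Rightarrow> 'e word \<Rightarrow> 'm) \<Rightarrow> 'm" where
  "cyc_cuts M pm w F =
     cuts M pm w (\<lambda>u x v. sgn_if M True (deg u * (arrow_deg x + deg v)) (F x (v @ u)))"

lemma deg_simps [simp]: "deg [] = 0" "deg (x # w) = arrow_deg x + deg w" "deg (u @ v) = deg u + deg v"
  by (simp_all add: deg_def)

context abelian_group
begin

lemma sgn_if_closed [simp]: "m \<in> carrier G \<Longrightarrow> sgn_if G P e m \<in> carrier G"
  by (simp add: sgn_if_def)

lemma sgn_if_add: "m \<in> carrier G \<Longrightarrow> n \<in> carrier G \<Longrightarrow>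
    sgn_if G P e (m \<oplus> n) = sgn_if G P e m \<oplus> sgn_if G P e n"
  by (simp add: sgn_if_def minus_add)

lemma sgn_if_zero [simp]: "sgn_if G P e \<zero> = \<zero>" "sgn_if G False e m = \<zero>"
  by (simp_all add: sgn_if_def)

lemma sgn_if_True_0 [simp]: "sgn_if G True 0 m = m"
  by (simp add: sgn_if_def)

lemma sgn_if_sgn_if [simp]: "m \<in> carrier G \<Longrightarrow>
    sgn_if G P e (sgn_if G P' e' m) = sgn_if G (P \<and> P') (e + e') m"
  by (cases e; cases e') (simp_all add: sgn_if_def)

lemma cuts_closed [simp]: "(\<And>u x v. F u x v \<in> carrier G) \<Longrightarrow> cuts G pm w F \<in> carrier G"
  by (induction w arbitrary: F) simp_all

lemma cuts_zero [simp]: "cuts G pm w (\<lambda>u x v. \<zero>) = \<zero>"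
  by (induction w) simp_all

lemma cuts_add: "(\<And>u x v. F u x v \<in> carrier G) \<Longrightarrow> (\<And>u x v. H u x v \<in> carrier G) \<Longrightarrow>
    cuts G pm w (\<lambda>u x v. F u x v \<oplus> H u x v) = cuts G pm w F \<oplus> cuts G pm w H"
  by (induction w arbitrary: F H) (simp_all add: a_ac)

lemma sgn_if_cuts: "(\<And>u x v. F u x v \<in> carrier G) \<Longrightarrow>
    sgn_if G P e (cuts G pm w F) = cuts G pm w (\<lambda>u x v. sgn_if G P e (F u x v))"
  by (induction w arbitrary: F) (simp_all add: sgn_if_add)

text \<open>Leibniz rule: the cut lies in one factor, and the other factor is carried along.\<close>

lemma cuts_append: "(\<And>u x v. F u x v \<in> carrier G) \<Longrightarrow>
    cuts G pm (a @ b) F =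
      cuts G pm a (\<lambda>u x v. F u x (v @ b)) \<oplus> cuts G pm b (\<lambda>u x v. F (a @ u) x v)"
  by (induction a arbitrary: F) (simp_all add: a_assoc)

text \<open>In the plus case a retained copy of the letter may be cut again. Doing this in the left
  piece or in the right piece produces the same term, so the two ways of cutting twice still
  agree.\<close>

lemma cuts_coassoc: "(\<And>u x v y w. F u x v y w \<in> carrier G) \<Longrightarrow>
    cuts G pm w (\<lambda>u y v. cuts G pm u (\<lambda>u1 x u2. F u1 x u2 y v)) =
    cuts G pm w (\<lambda>u x v. cuts G pm v (\<lambda>v1 y v2. F u x v1 y v2))"
proof (induction w arbitrary: F)
  case (Cons a w)
  then show ?case
    by (cases pm) (simp_all add: residue_def cuts_add a_ac)
qed simp

lemma cuts_comm: "(\<And>u x v u' x' v'. F u x v u' x' v' \<in> carrier G) \<Longrightarrow>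
    cuts G pm w (\<lambda>u x v. cuts G pm w' (\<lambda>u' x' v'. F u x v u' x' v')) =
    cuts G pm w' (\<lambda>u' x' v'. cuts G pm w (\<lambda>u x v. F u x v u' x' v'))"
  by (induction w arbitrary: F) (simp_all add: cuts_add)

lemma cyc_cuts_closed [simp]: "(\<And>x v. F x v \<in> carrier G) \<Longrightarrow> cyc_cuts G pm w F \<in> carrier G"
  by (simp add: cyc_cuts_def)

lemma cyc_cuts_zero [simp]: "cyc_cuts G pm w (\<lambda>x v. \<zero>) = \<zero>"
  by (simp add: cyc_cuts_def)

lemma cyc_cuts_add: "(\<And>x v. F x v \<in> carrier G) \<Longrightarrow> (\<And>x v. H x v \<in> carrier G) \<Longrightarrow>
    cyc_cuts G pm w (\<lambda>x v. F x v \<oplus> H x v) = cyc_cuts G pm w F \<oplus> cyc_cuts G pm w H"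
  by (simp add: cyc_cuts_def sgn_if_add cuts_add)

lemma sgn_if_cyc_cuts: "(\<And>x v. F x v \<in> carrier G) \<Longrightarrow>
    sgn_if G P e (cyc_cuts G pm w F) = cyc_cuts G pm w (\<lambda>x v. sgn_if G P e (F x v))"
  by (simp add: cyc_cuts_def sgn_if_cuts add.commute)

lemma cyc_cuts_comm: "(\<And>x v x' v'. F x v x' v' \<in> carrier G) \<Longrightarrow>
    cyc_cuts G pm w (\<lambda>x v. cyc_cuts G pm w' (\<lambda>x' v'. F x v x' v')) =
    cyc_cuts G pm w' (\<lambda>x' v'. cyc_cuts G pm w (\<lambda>x v. F x v x' v'))"
  by (simp add: cyc_cuts_def sgn_if_cuts cuts_comm[of _ pm w] add.commute)

lemma cyc_cuts_cuts_comm: "(\<And>x v u' x' v'. F x v u' x' v' \<in> carrier G) \<Longrightarrow>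
    cyc_cuts G pm w (\<lambda>x v. cuts G pm w' (\<lambda>u' x' v'. F x v u' x' v')) =
    cuts G pm w' (\<lambda>u' x' v'. cyc_cuts G pm w (\<lambda>x v. F x v u' x' v'))"
  by (simp add: cyc_cuts_def sgn_if_cuts cuts_comm[of _ pm w])

lemma cyc_cuts_append: "(\<And>x v. F x v \<in> carrier G) \<Longrightarrow>
    cyc_cuts G pm (a @ b) F =
      cuts G pm a (\<lambda>u x v. sgn_if G True (deg u * (arrow_deg x + deg v + deg b)) (F x (v @ b @ u))) \<oplus>
      cuts G pm b (\<lambda>u x v. sgn_if G True ((deg a + deg u) * (arrow_deg x + deg v)) (F x (v @ a @ u)))"
  by (simp add: cyc_cuts_def cuts_append add.assoc)

end

section \<open>Vertices of the pieces, cyclic functions, and the sums for bracket and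
  cobracket\<close>

definition start :: "bool \<Rightarrow> ('v, 'e) pre_digraph \<Rightarrow> 'e + 'e \<Rightarrow> 'v" where
  "start pm Q x = (if pm then tail (double_quiver Q) x else head (double_quiver Q) x)"

definition stop :: "bool \<Rightarrow> ('v, 'e) pre_digraph \<Rightarrow> 'e + 'e \<Rightarrow> 'v" where
  "stop pm Q x = (if pm then head (double_quiver Q) x else tail (double_quiver Q) x)"

abbreviation walk :: "('v, 'e) pre_digraph \<Rightarrow> 'v \<Rightarrow> 'e word \<Rightarrow> 'v \<Rightarrow> bool" where
  "walk Q \<equiv> pre_digraph.awalk (double_quiver Q)"

text \<open>Membership in the carrier is demanded for all arguments, also for those that are not
  closed walks; sums over cuts then need no side conditions.\<close>

definition cyclic_fun :: "('m, 'k) ring_scheme \<Rightarrow> ('v, 'e) pre_digraph \<Rightarrow>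
    ('v \<Rightarrow> 'e word \<Rightarrow> 'm) \<Rightarrow> bool" where
  "cyclic_fun M Q t \<longleftrightarrow> (\<forall>p w. t p w \<in> carrier M) \<and>
     (\<forall>p q u v. walk Q p u q \<longrightarrow> walk Q q v p \<longrightarrow>
        t p (u @ v) = sgn_if M True (deg u * deg v) (t q (v @ u)))"

text \<open>The value \<open>t\<close> of the joined word is left abstract, so that one identity
  serves for the module itself, for its tensor powers, and after composition with linear
  maps.\<close>

definition br_sum :: "('m, 'k) ring_scheme \<Rightarrow> ('v, 'e) pre_digraph \<Rightarrow> bool \<Rightarrow>
    ('v \<Rightarrow> 'e word \<Rightarrow> 'm) \<Rightarrow> 'e word \<Rightarrow> 'e word \<Rightarrow> 'm" where
  "br_sum M Q pm t a b =
     cyc_cuts M pm a (\<lambda>x \<alpha>. cyc_cuts M pm b (\<lambda>y \<beta>.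
       sgn_if M (paired x y) (deg \<alpha> * arrow_deg y) (t (start pm Q x) (\<alpha> @ \<beta>))))"

text \<open>The factor 1/2 of the cobracket is omitted; it is put back when the linear map is
  constructed. The second cut is a plain one, because \<open>\<alpha>\<close> is an open word after
  the first.\<close>

definition cobr_sum :: "('m, 'k) ring_scheme \<Rightarrow> ('v, 'e) pre_digraph \<Rightarrow> bool \<Rightarrow>
    ('v \<Rightarrow> 'e word \<Rightarrow> 'v \<Rightarrow> 'e word \<Rightarrow> 'm) \<Rightarrow> 'e word \<Rightarrow> 'm" where
  "cobr_sum M Q pm s a =
     cyc_cuts M pm a (\<lambda>x \<alpha>. cuts M pm \<alpha> (\<lambda>\<beta> y \<gamma>.
       sgn_if M (paired x y) (deg \<beta> * arrow_deg y) (s (start pm Q x) \<beta> (start pm Q y) \<gamma>)))"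

lemma paired_sym: "paired x y \<longleftrightarrow> paired y x"
  by (auto simp: paired_def)

lemma paired_arrow_deg: "paired x y \<Longrightarrow> arrow_deg y = arrow_deg x + 1"
  by (auto simp: paired_def arrow_deg_def)

lemma paired_stop: "paired x y \<Longrightarrow> stop pm Q x = start pm Q y"
  by (auto simp: paired_def start_def stop_def double_quiver_def)

context fin_digraph
begin

lemma wf_double: "wf_digraph (double_quiver G)"
  by unfold_locales (auto simp: double_quiver_def)

lemmas walk_Cons_iff = wf_digraph.awalk_Cons_iff[OF wf_double]
lemmas walk_Nil_iff = wf_digraph.awalk_Nil_iff[OF wf_double]

lemma walk_append_iff: "walk G p (u @ v) q \<longleftrightarrow> (\<exists>r. walk G p u r \<and> walk G r v q)"
proof (induction u arbitrary: p)
  case Nil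
  then show ?case
    by (auto simp: walk_Nil_iff dest: wf_digraph.awalk_hd_in_verts[OF wf_double])
qed (auto simp: walk_Cons_iff)

lemma walk_append: "walk G p u r \<Longrightarrow> walk G r v q \<Longrightarrow> walk G p (u @ v) q"
  by (auto simp: walk_append_iff)

text \<open>The degree equation is the same for minus and plus, since the plus pieces contain two
  additional copies of \<open>x\<close>. Together with the walk conditions it permits comparing
  signs and rotating words term by term under the sum.\<close>

lemma cuts_cong:
  assumes "walk G p w q"
    and "\<And>u x v. walk G p u (stop pm G x) \<Longrightarrow> walk G (start pm G x) v q \<Longrightarrow>
           deg w = deg u + deg v + arrow_deg x \<Longrightarrow> F u x v = F' u x v"
  shows "cuts M pm w F = cuts M pm w F'"
  using assms
proof (induction w arbitrary: p F F')
  case (Cons a w)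
  have a: "a \<in> arcs (double_quiver G)" "p = tail (double_quiver G) a"
    "walk G (head (double_quiver G) a) w q"
    using Cons.prems(1) by (auto simp: walk_Cons_iff)
  have v: "tail (double_quiver G) a \<in> verts (double_quiver G)"
    "head (double_quiver G) a \<in> verts (double_quiver G)"
    using a(1) wf_double by (auto simp: wf_digraph_def)
  have "F (residue pm a) a (residue pm a @ w) = F' (residue pm a) a (residue pm a @ w)"
    by (rule Cons.prems(2))
      (use a v in \<open>auto simp: residue_def walk_Cons_iff walk_Nil_iff start_def stop_def ac_simps\<close>)
  moreover have "cuts M pm w (\<lambda>u. F (a # u)) = cuts M pm w (\<lambda>u. F' (a # u))"
    by (rule Cons.IH[OF a(3)], rule Cons.prems(2))
      (use a in \<open>auto simp: walk_Cons_iff ac_simps\<close>)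
  ultimately show ?case
    by simp
qed simp

lemma cyc_cuts_cong:
  assumes "walk G p a p"
    and "\<And>x \<alpha>. walk G (start pm G x) \<alpha> (stop pm G x) \<Longrightarrow> deg a = deg \<alpha> + arrow_deg x \<Longrightarrow>
           F x \<alpha> = F' x \<alpha>"
  shows "cyc_cuts M pm a F = cyc_cuts M pm a F'"
  unfolding cyc_cuts_def
  by (rule cuts_cong[OF assms(1)], rule arg_cong[where f = "sgn_if M _ _"], rule assms(2))
    (auto simp: ac_simps intro: walk_append)

end

section \<open>Rotating the cut points of a cyclic word\<close>

context abelian_group
begin

text \<open>By the Leibniz rule both sides split into cuts in \<open>a\<close> and cuts in
  \<open>b\<close> with the same remaining words, so that only the exponents have to be
  compared.\<close>

lemma cyc_cuts_rotate:
  assumes F: "\<And>x \<alpha>. F x \<alpha> \<in> carrier G" and Q: "fin_digraph Q"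
    and "walk Q p a q" "walk Q q b p"
  shows "cyc_cuts G pm (a @ b) F = sgn_if G True (deg a * deg b) (cyc_cuts G pm (b @ a) F)"
proof -
  interpret Q: fin_digraph Q by (rule Q)
  have 1: "cuts G pm a (\<lambda>u x v. sgn_if G True (deg u * (arrow_deg x + deg v + deg b)) (F x (v @ b @ u))) =
    cuts G pm a (\<lambda>u x v. sgn_if G True (deg a * deg b + (deg b + deg u) * (arrow_deg x + deg v)) (F x (v @ b @ u)))"
    by (rule Q.cuts_cong[OF assms(3)]) (simp add: bit_simps)
  have 2: "cuts G pm b (\<lambda>u x v. sgn_if G True ((deg a + deg u) * (arrow_deg x + deg v)) (F x (v @ a @ u))) =
    cuts G pm b (\<lambda>u x v. sgn_if G True (deg a * deg b + deg u * (arrow_deg x + deg v + deg a)) (F x (v @ a @ u)))"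
    by (rule Q.cuts_cong[OF assms(4)]) (simp add: bit_simps)
  show ?thesis
    using F by (simp add: cyc_cuts_append 1 2 sgn_if_add sgn_if_cuts a_comm)
qed

text \<open>Either of two cut letters may be taken as the first one. In the linear word the second
  cut lies after or before the first; coassociativity turns each of these families into the other
  with the letters exchanged. The exponent is that of exchanging the arcs \<open>x A\<close> and
  \<open>y B\<close>.\<close>

lemma cyc_cuts_cuts_rotate:
  fixes Q :: "('v, 'e) pre_digraph"
  assumes H: "\<And>x A y B. H x A y B \<in> carrier G" and Q: "fin_digraph Q" and a: "walk Q p a p"
  shows "cyc_cuts G pm a (\<lambda>x \<alpha>. cuts G pm \<alpha> (\<lambda>A y B. H x A y B)) =
    cyc_cuts G pm a (\<lambda>x \<alpha>. cuts G pm \<alpha> (\<lambda>A y B.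
      sgn_if G True ((arrow_deg x + deg A) * (arrow_deg y + deg B)) (H y B x A)))"
proof -
  interpret Q: fin_digraph Q by (rule Q)
  define S :: "'e word \<Rightarrow> 'e + 'e \<Rightarrow> 'e word \<Rightarrow> 'a \<Rightarrow> 'a"
    where "S = (\<lambda>u x v. sgn_if G True (deg u * (arrow_deg x + deg v)))"
  have expand: "cyc_cuts G pm a (\<lambda>x \<alpha>. cuts G pm \<alpha> (\<lambda>A y B. H x A y B)) =
      cuts G pm a (\<lambda>u x v. cuts G pm v (\<lambda>v1 y v2. S u x v (H x v1 y (v2 @ u)))) \<oplus>
      cuts G pm a (\<lambda>u x v. cuts G pm u (\<lambda>u1 y u2. S u x v (H x (v @ u1) y u2)))"
    if H: "\<And>x A y B. H x A y B \<in> carrier G" for H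
    using H by (simp add: cyc_cuts_def S_def cuts_append sgn_if_add sgn_if_cuts cuts_add)
  have 1: "cuts G pm a (\<lambda>u x v. cuts G pm v (\<lambda>v1 y v2. S u x v (H x v1 y (v2 @ u)))) =
    cuts G pm a (\<lambda>u y v. cuts G pm u (\<lambda>u1 x u2. S u y v (sgn_if G True
      ((arrow_deg y + deg (v @ u1)) * (arrow_deg x + deg u2)) (H x u2 y (v @ u1)))))"
    (is "?l = ?r")
  proof -
    have "?l = cuts G pm a (\<lambda>u x v. cuts G pm v (\<lambda>v1 y v2. sgn_if G True
        (deg u * (arrow_deg x + (deg v1 + deg v2 + arrow_deg y))) (H x v1 y (v2 @ u))))"
      by (rule Q.cuts_cong[OF a], rule Q.cuts_cong, assumption) (simp add: S_def)
    also have "\<dots> = cuts G pm a (\<lambda>u y v. cuts G pm u (\<lambda>u1 x u2. sgn_if G True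
        (deg u1 * (arrow_deg x + (deg u2 + deg v + arrow_deg y))) (H x u2 y (v @ u1))))"
      using H by (subst cuts_coassoc) simp_all
    also have "\<dots> = ?r"
      by (rule Q.cuts_cong[OF a], rule Q.cuts_cong, assumption) (simp add: S_def H bit_simps)
    finally show ?thesis .
  qed
  have 2: "cuts G pm a (\<lambda>u x v. cuts G pm u (\<lambda>u1 y u2. S u x v (H x (v @ u1) y u2))) =
    cuts G pm a (\<lambda>u y v. cuts G pm v (\<lambda>v1 x v2. S u y v (sgn_if G True
      ((arrow_deg y + deg v1) * (arrow_deg x + deg (v2 @ u))) (H x (v2 @ u) y v1))))"
    (is "?l = ?r")
  proof -
    have "?l = cuts G pm a (\<lambda>u x v. cuts G pm u (\<lambda>u1 y u2. sgn_if G True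
        ((deg u1 + deg u2 + arrow_deg y) * (arrow_deg x + deg v)) (H x (v @ u1) y u2)))"
      by (rule Q.cuts_cong[OF a], rule Q.cuts_cong, assumption) (simp add: S_def)
    also have "\<dots> = cuts G pm a (\<lambda>u y v. cuts G pm v (\<lambda>v1 x v2. sgn_if G True
        ((deg u + deg v1 + arrow_deg y) * (arrow_deg x + deg v2)) (H x (v2 @ u) y v1)))"
      using H by (subst cuts_coassoc) simp_all
    also have "\<dots> = ?r"
      by (rule Q.cuts_cong[OF a], rule Q.cuts_cong, assumption) (simp add: S_def H bit_simps)
    finally show ?thesis .
  qed
  have "S u x v m \<in> carrier G" if "m \<in> carrier G" for u x v m
    using that by (simp add: S_def)
  then show ?thesis
    using H by (simp add: expand 1 2 a_comm)
qed

end

definition cyclic_fun2 :: "('m, 'k) ring_scheme \<Rightarrow> ('v, 'e) pre_digraph \<Rightarrow>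
    ('v \<Rightarrow> 'e word \<Rightarrow> 'v \<Rightarrow> 'e word \<Rightarrow> 'm) \<Rightarrow> bool" where
  "cyclic_fun2 M Q s \<longleftrightarrow>
     (\<forall>q v. cyclic_fun M Q (\<lambda>p u. s p u q v)) \<and> (\<forall>p u. cyclic_fun M Q (s p u))"

definition cyclic_fun3 :: "('m, 'k) ring_scheme \<Rightarrow> ('v, 'e) pre_digraph \<Rightarrow>
    ('v \<Rightarrow> 'e word \<Rightarrow> 'v \<Rightarrow> 'e word \<Rightarrow> 'v \<Rightarrow> 'e word \<Rightarrow> 'm) \<Rightarrow> bool" where
  "cyclic_fun3 M Q t \<longleftrightarrow>
     (\<forall>r w. cyclic_fun2 M Q (\<lambda>p u q v. t p u q v r w)) \<and> (\<forall>p u. cyclic_fun2 M Q (t p u))"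

lemma cyclic_fun_closed: "cyclic_fun M Q t \<Longrightarrow> t p w \<in> carrier M"
  unfolding cyclic_fun_def by blast

lemma cyclic_funD: "cyclic_fun M Q t \<Longrightarrow> walk Q p u q \<Longrightarrow> walk Q q v p \<Longrightarrow>
    t p (u @ v) = sgn_if M True (deg u * deg v) (t q (v @ u))"
  unfolding cyclic_fun_def by blast

context abelian_group
begin

text \<open>Comparison of single summands: \<open>d\<close> is the sign exponent of the rotation
  relating the two values, and everything except the pairing conditions has to be compared only for
  paired letters.\<close>

lemma sgn_if_eqI:
  assumes "P = P'" "P \<Longrightarrow> m = sgn_if G True d m'" "P \<Longrightarrow> e + d = e'" "m' \<in> carrier G"
  shows "sgn_if G P e m = sgn_if G P' e' m'"
proof (cases P)
  case True
  then show ?thesis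
    using assms(1) by (simp only: assms(2)[OF True] sgn_if_sgn_if[OF assms(4)] assms(3)[OF True] simp_thms)
next
  case False
  then show ?thesis
    using assms(1) by simp
qed

lemma sgn_if_cancel:
  "m \<in> carrier G \<Longrightarrow> n = sgn_if G True (1 + e) m \<Longrightarrow> n \<oplus> sgn_if G True e m = \<zero>"
  by (cases e) (simp_all add: sgn_if_def r_neg l_neg)

end

section \<open>Symmetry and the Jacobi identity for abstract values\<close>

locale surgery = abelian_group M + Q: fin_digraph Q
  for M :: "('m, 'k) ring_scheme" (structure) and Q :: "('v, 'e) pre_digraph" +
  fixes pm :: bool
begin

abbreviation "sg \<equiv> sgn_if M"
abbreviation "lcut \<equiv> cuts M pm"
abbreviation "cyc \<equiv> cyc_cuts M pm"
abbreviation "st \<equiv> start pm Q"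
abbreviation "br \<equiv> br_sum M Q pm"
abbreviation "cobr \<equiv> cobr_sum M Q pm"
abbreviation "ad \<equiv> arrow_deg"

lemma fin_digraph_Q: "fin_digraph Q"
  by unfold_locales

lemmas cyc_cong = Q.cyc_cuts_cong[where M = M and pm = pm]
lemmas cut_cong = Q.cuts_cong[where M = M and pm = pm]

lemmas push = sgn_if_add sgn_if_cuts sgn_if_cyc_cuts cuts_add cyc_cuts_add

lemma pairedD: "paired x y \<Longrightarrow> ad y = ad x + 1 \<and> stop pm Q x = st y \<and> stop pm Q y = st x"
  using paired_arrow_deg paired_stop paired_sym by blast

lemma br_closed [simp]: "(\<And>p w. t p w \<in> carrier M) \<Longrightarrow> br t a b \<in> carrier M"
  by (simp add: br_sum_def)

lemma cobr_closed [simp]: "(\<And>p u q v. s p u q v \<in> carrier M) \<Longrightarrow> cobr s a \<in> carrier M"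
  by (simp add: cobr_sum_def)

lemma br_rotate:
  assumes "\<And>p w. t p w \<in> carrier M" "walk Q p a1 q" "walk Q q a2 p"
  shows "br t (a1 @ a2) b = sg True (deg a1 * deg a2) (br t (a2 @ a1) b)"
  unfolding br_sum_def using assms by (intro cyc_cuts_rotate) (simp_all add: fin_digraph_Q)

lemma cobr_rotate:
  assumes "\<And>p u q v. s p u q v \<in> carrier M" "walk Q p a1 q" "walk Q q a2 p"
  shows "cobr s (a1 @ a2) = sg True (deg a1 * deg a2) (cobr s (a2 @ a1))"
  unfolding cobr_sum_def using assms by (intro cyc_cuts_rotate) (simp_all add: fin_digraph_Q)

text \<open>The cuts of \<open>a\<close> and \<open>b\<close> are independent. Exchanging them
  replaces \<open>\<alpha> @ \<beta>\<close> by \<open>\<beta> @ \<alpha>\<close>, which is a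
  rotation of the joined closed word.\<close>

lemma br_swap:
  assumes t: "cyclic_fun M Q t" and a: "walk Q p a p" and b: "walk Q q b q"
  shows "br t a b = sg True (deg a * deg b) (br t b a)"
proof -
  note [simp] = cyclic_fun_closed[OF t]
  have "br t a b = cyc b (\<lambda>y \<beta>. cyc a (\<lambda>x \<alpha>.
      sg (paired x y) (deg \<alpha> * ad y) (t (st x) (\<alpha> @ \<beta>))))"
    by (simp add: br_sum_def cyc_cuts_comm[of _ pm a b])
  also have "\<dots> = cyc b (\<lambda>y \<beta>. cyc a (\<lambda>x \<alpha>.
      sg (paired y x) (deg a * deg b + deg \<beta> * ad x) (t (st y) (\<beta> @ \<alpha>))))"
    by (rule cyc_cong[OF b], rule cyc_cong[OF a], rule sgn_if_eqI[OF paired_sym], rule cyclic_funD[OF t])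
      (auto dest!: pairedD simp: bit_simps)
  also have "\<dots> = sg True (deg a * deg b) (br t b a)"
    by (simp add: br_sum_def push)
  finally show ?thesis .
qed

text \<open>Taking the second cut letter as the first one exchanges the two pieces.\<close>

lemma cobr_swap:
  assumes s: "\<And>p u q v. s p u q v \<in> carrier M" and a: "walk Q p a p"
  shows "cobr s a = cobr (\<lambda>p u q v. sg True (deg u * deg v) (s q v p u)) a"
proof -
  have "cobr s a = cyc a (\<lambda>x \<alpha>. lcut \<alpha> (\<lambda>\<beta> y \<gamma>. sg True ((ad x + deg \<beta>) * (ad y + deg \<gamma>))
      (sg (paired y x) (deg \<gamma> * ad x) (s (st y) \<gamma> (st x) \<beta>))))"
    unfolding cobr_sum_def using s by (subst cyc_cuts_cuts_rotate[OF _ fin_digraph_Q a]) simp_all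
  also have "\<dots> = cobr (\<lambda>p u q v. sg True (deg u * deg v) (s q v p u)) a"
    unfolding cobr_sum_def
    by (rule cyc_cong[OF a], rule cut_cong, assumption, simp add: s, rule sgn_if_eqI[where d = 0])
      (auto simp: s paired_sym bit_simps dest!: pairedD)
  finally show ?thesis .
qed

text \<open>The joined word is cut once more, by the Leibniz rule either in the piece that comes
  from \<open>a\<close> or in the piece that comes from \<open>b\<close>. These are the two
  families.\<close>

lemma br_br_expand:
  assumes t [simp]: "\<And>p w. t p w \<in> carrier M"
  shows "br (\<lambda>p w. br t w c) a b =
    cyc a (\<lambda>x \<alpha>. lcut \<alpha> (\<lambda>A z B. cyc b (\<lambda>y \<beta>. cyc c (\<lambda>w \<gamma>.
      sg (paired x y \<and> paired z w)
        (deg \<alpha> * ad y + (deg A * (ad z + deg B + deg \<beta>) + (deg B + deg \<beta> + deg A) * ad w))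
        (t (st z) (B @ \<beta> @ A @ \<gamma>)))))) \<oplus>
    cyc b (\<lambda>y \<beta>. lcut \<beta> (\<lambda>A z B. cyc a (\<lambda>x \<alpha>. cyc c (\<lambda>w \<gamma>.
      sg (paired x y \<and> paired z w)
        (deg \<alpha> * ad y + ((deg \<alpha> + deg A) * (ad z + deg B) + (deg B + deg \<alpha> + deg A) * ad w))
        (t (st z) (B @ \<alpha> @ A @ \<gamma>))))))"
  apply (simp add: br_sum_def cyc_cuts_append push)
  apply (rule arg_cong2[where f = "(\<oplus>)"])
   apply (simp add: cyc_cuts_cuts_comm[of _ pm b] add.assoc)
  apply (subst cyc_cuts_comm, simp)
  apply (simp add: cyc_cuts_cuts_comm[of _ pm a] add.assoc)
  done

text \<open>Both families consist of terms in which \<open>a\<close> is cut twice and joined to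
  \<open>b\<close> and to \<open>c\<close>. They stem from different summands of the Jacobi identity
  and differ only in which join is performed first, so rotating the two cuts of \<open>a\<close>
  identifies them up to sign.\<close>

lemma br_br_cancel:
  assumes t: "cyclic_fun M Q t"
    and a: "walk Q p a p" and b: "walk Q q b q" and c: "walk Q r c r"
  shows "cyc a (\<lambda>x \<alpha>. lcut \<alpha> (\<lambda>A z B. cyc b (\<lambda>y \<beta>. cyc c (\<lambda>w \<gamma>.
      sg (paired x y \<and> paired z w)
        (deg \<alpha> * ad y + (deg A * (ad z + deg B + deg \<beta>) + (deg B + deg \<beta> + deg A) * ad w))
        (t (st z) (B @ \<beta> @ A @ \<gamma>)))))) =
   sg True (1 + (deg a + deg b) * deg c) (cyc a (\<lambda>x \<alpha>. lcut \<alpha> (\<lambda>A z B. cyc c (\<lambda>w \<gamma>. cyc b (\<lambda>y \<beta>.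
      sg (paired w x \<and> paired z y)
        (deg \<gamma> * ad x + ((deg \<gamma> + deg A) * (ad z + deg B) + (deg B + deg \<gamma> + deg A) * ad y))
        (t (st z) (B @ \<gamma> @ A @ \<beta>)))))))"
proof -
  note [simp] = cyclic_fun_closed[OF t]
  show ?thesis
    apply (subst cyc_cuts_cuts_rotate[OF _ fin_digraph_Q a], simp)
    apply (simp add: push cyc_cuts_comm[of _ pm c b])
    apply (rule cyc_cong[OF a], rule cut_cong, assumption, rule cyc_cong[OF b], rule cyc_cong[OF c])
    subgoal for x \<alpha> A z B y \<beta> w \<gamma>
      apply (rule sgn_if_eqI)
         apply (auto simp: paired_sym)[1]
        apply (rule cyclic_funD[OF t, of _ "B @ \<beta>" _ "A @ \<gamma>", simplified])
         apply (auto intro: Q.walk_append dest!: pairedD)[2]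
       apply (auto dest!: pairedD simp: bit_simps)[1]
      apply simp
      done
    done
qed

theorem br_jacobi:
  assumes t: "cyclic_fun M Q t"
    and a: "walk Q p a p" and b: "walk Q q b q" and c: "walk Q r c r"
  shows "br (\<lambda>p w. br t w c) a b \<oplus>
    sg True ((deg a + deg b) * deg c) (br (\<lambda>p w. br t w b) c a) \<oplus>
    sg True (deg a * (deg b + deg c)) (br (\<lambda>p w. br t w a) b c) = \<zero>"
proof -
  note [simp] = cyclic_fun_closed[OF t]
  \<comment> \<open>\<open>m1\<close>, \<open>m2\<close>, \<open>m3\<close> are three of the six
    families, the others being their multiples by signs. The exponents are
    \<open>e1 = (deg a + deg b) * deg c\<close>, \<open>e2 = (deg c + deg a) * deg b\<close> and
    \<open>e3 = deg a * (deg b + deg c)\<close>; modulo 2 the first two add up to the third.\<close>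
  have cancel: "(sg True (1 + e1) m1 \<oplus> m2) \<oplus> sg True e1 (sg True (1 + e2) m3 \<oplus> m1) \<oplus>
      sg True e3 (sg True (1 + e3) m2 \<oplus> m3) = \<zero>"
    if "e1 + e2 = e3" "m1 \<in> carrier M" "m2 \<in> carrier M" "m3 \<in> carrier M" for e1 e2 e3 m1 m2 m3
  proof -
    have "m1 \<oplus> (m2 \<oplus> (m3 \<oplus> (\<ominus> m1 \<oplus> (\<ominus> m2 \<oplus> \<ominus> m3)))) = (m1 \<oplus> m2 \<oplus> m3) \<oplus> \<ominus> (m1 \<oplus> m2 \<oplus> m3)"
      using that by (simp only: minus_add a_ac a_closed a_inv_closed)
    also have "\<dots> = \<zero>"
      using that by (simp add: r_neg)
    finally show ?thesis
      using that by (cases e1; cases e2; cases e3) (simp_all add: sgn_if_def minus_add a_ac)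
  qed
  show ?thesis
    unfolding br_br_expand[OF cyclic_fun_closed[OF t]]
      br_br_cancel[OF t a b c] br_br_cancel[OF t c a b] br_br_cancel[OF t b c a, unfolded mult.commute[of "deg b + deg c"]]
    by (rule cancel) (simp_all add: bit_simps)
qed

end

section \<open>Three and four cuts: co-Jacobi identity, involutivity and compatibility\<close>

context surgery
begin

abbreviation cut3 ::
    "'e word \<Rightarrow> ('e + 'e \<Rightarrow> 'e word \<Rightarrow> 'e + 'e \<Rightarrow> 'e word \<Rightarrow> 'e + 'e \<Rightarrow> 'e word \<Rightarrow> 'm) \<Rightarrow> 'm" where
  "cut3 a F \<equiv> cyc a (\<lambda>x \<alpha>. lcut \<alpha> (\<lambda>P z \<phi>. lcut \<phi> (\<lambda>R w N. F x P z R w N)))"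

text \<open>Read cyclically, the cut word is \<open>x P z R w N y C\<close>: each letter is followed
  by the arc up to the next cut.\<close>

abbreviation cut4 ::
    "'e word \<Rightarrow> ('e + 'e \<Rightarrow> 'e word \<Rightarrow> 'e + 'e \<Rightarrow> 'e word \<Rightarrow> 'e + 'e \<Rightarrow> 'e word \<Rightarrow>
      'e + 'e \<Rightarrow> 'e word \<Rightarrow> 'm) \<Rightarrow> 'm" where
  "cut4 a F \<equiv> cyc a (\<lambda>x \<alpha>. lcut \<alpha> (\<lambda>P z \<phi>. lcut \<phi> (\<lambda>R w \<psi>. lcut \<psi> (\<lambda>N y C. F x P z R w N y C))))"

text \<open>
  The two families of terms of \<open>(\<delta> \<otimes> id) \<circ> \<delta>\<close>, and the four families of terms of \<open>\<delta> \<circ> br\<close>: the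
  letters \<open>z\<close> and \<open>w\<close> cut by \<open>\<delta>\<close> lie in the same word or in different words.
\<close>

abbreviation nested1 :: "('v \<Rightarrow> 'e word \<Rightarrow> 'v \<Rightarrow> 'e word \<Rightarrow> 'v \<Rightarrow> 'e word \<Rightarrow> 'm) \<Rightarrow> 'e word \<Rightarrow> 'm" where
  "nested1 t a \<equiv> cut4 a (\<lambda>x P z R w N y C.
      sg (paired x y \<and> paired z w)
        ((deg P + ad z + deg R + ad w + deg N) * ad y + deg P * (ad z + deg R + ad w + deg N) + deg R * ad w)
        (t (st z) R (st w) (N @ P) (st y) C))"

abbreviation nested2 :: "('v \<Rightarrow> 'e word \<Rightarrow> 'v \<Rightarrow> 'e word \<Rightarrow> 'v \<Rightarrow> 'e word \<Rightarrow> 'm) \<Rightarrow> 'e word \<Rightarrow> 'm" where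
  "nested2 t a \<equiv> cut4 a (\<lambda>x P z R w N y C.
      sg (paired x y \<and> paired w z)
        ((deg P + ad z + deg R + ad w + deg N) * ad y + (deg P + ad z + deg R) * (ad w + deg N) +
           (deg N + deg P) * ad z)
        (t (st w) (N @ P) (st z) R (st y) C))"

abbreviation within1 :: "('v \<Rightarrow> 'e word \<Rightarrow> 'v \<Rightarrow> 'e word \<Rightarrow> 'm) \<Rightarrow> 'e word \<Rightarrow> 'e word \<Rightarrow> 'm" where
  "within1 s a b \<equiv> cut3 a (\<lambda>x P z R w N. cyc b (\<lambda>y \<beta>.
      sg (paired x y \<and> paired z w)
        ((deg P + ad z + deg R + ad w + deg N) * ad y +
          (deg P * (ad z + deg R + ad w + deg N + deg \<beta>) + deg R * ad w))
        (s (st z) R (st w) (N @ \<beta> @ P))))"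

abbreviation within2 :: "('v \<Rightarrow> 'e word \<Rightarrow> 'v \<Rightarrow> 'e word \<Rightarrow> 'm) \<Rightarrow> 'e word \<Rightarrow> 'e word \<Rightarrow> 'm" where
  "within2 s a b \<equiv> cut3 a (\<lambda>x P z R w N. cyc b (\<lambda>y \<beta>.
      sg (paired x y \<and> paired w z)
        ((deg P + ad z + deg R + ad w + deg N) * ad y +
          ((deg P + ad z + deg R) * (ad w + deg N + deg \<beta>) + (deg N + deg \<beta> + deg P) * ad z))
        (s (st w) (N @ \<beta> @ P) (st z) R)))"

abbreviation across1 :: "('v \<Rightarrow> 'e word \<Rightarrow> 'v \<Rightarrow> 'e word \<Rightarrow> 'm) \<Rightarrow> 'e word \<Rightarrow> 'e word \<Rightarrow> 'm" where
  "across1 s a b \<equiv> cyc a (\<lambda>x \<alpha>. lcut \<alpha> (\<lambda>A z B. cyc b (\<lambda>y \<beta>. lcut \<beta> (\<lambda>R w N.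
      sg (paired x y \<and> paired z w)
        ((deg A + deg B + ad z) * ad y + (deg A * (ad z + deg B + deg \<beta>) + (deg B + deg R) * ad w))
        (s (st z) (B @ R) (st w) (N @ A))))))"

abbreviation across2 :: "('v \<Rightarrow> 'e word \<Rightarrow> 'v \<Rightarrow> 'e word \<Rightarrow> 'm) \<Rightarrow> 'e word \<Rightarrow> 'e word \<Rightarrow> 'm" where
  "across2 s a b \<equiv> cyc a (\<lambda>x \<alpha>. lcut \<alpha> (\<lambda>A z B. cyc b (\<lambda>y \<beta>. lcut \<beta> (\<lambda>R w N.
      sg (paired x y \<and> paired w z)
        ((deg A + deg B + ad z) * ad y + ((deg A + deg B + ad z + deg R) * (ad w + deg N) + (deg N + deg A) * ad z))
        (s (st w) (N @ A) (st z) (B @ R))))))"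

text \<open>\<open>cyc_cuts_cuts_rotate\<close> makes the second letter the first one, and the inner
  cut then falls into the arc before the old first letter; coassociativity restores the cyclic order
  of the cuts.\<close>

lemma three_cuts_rotate:
  assumes F [simp]: "\<And>x P z R w N. F x P z R w N \<in> carrier M" and a: "walk Q p a p"
  shows "cut3 a (\<lambda>x P z R w N. F x P z R w N) =
    cut3 a (\<lambda>x P z R w N.
      sg True ((ad w + deg N) * (ad x + deg P + ad z + deg R)) (F w N x P z R))"
  (is "?l = ?r")
proof -
  have "?l = cyc a (\<lambda>x \<alpha>. lcut \<alpha> (\<lambda>A z B. sg True ((ad x + deg A) * (ad z + deg B))
      (lcut A (\<lambda>R w N. F z B x R w N))))"
    by (rule cyc_cuts_cuts_rotate[OF _ fin_digraph_Q a]) simp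
  also have "\<dots> = cyc a (\<lambda>x \<alpha>. lcut \<alpha> (\<lambda>A z B. (lcut A (\<lambda>R w N.
      sg True ((ad z + deg B) * (ad x + deg R + ad w + deg N)) (F z B x R w N)))))"
    by (simp add: push, rule cyc_cong[OF a], rule cut_cong, assumption, rule cut_cong, assumption)
      (simp add: bit_simps)
  also have "\<dots> = ?r"
    by (subst cuts_coassoc) simp_all
  finally show ?thesis .
qed

lemma four_cuts_rotate:
  assumes F [simp]: "\<And>x P z R w N y C. F x P z R w N y C \<in> carrier M" and a: "walk Q p a p"
  shows "cut4 a (\<lambda>x P z R w N y C. F x P z R w N y C) =
    cut4 a (\<lambda>x P z R w N y C.
      sg True ((ad y + deg C) * (ad x + deg P + ad z + deg R + ad w + deg N)) (F y C x P z R w N))"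
  (is "?l = ?r")
proof -
  have "?l = cyc a (\<lambda>x \<alpha>. lcut \<alpha> (\<lambda>A z B. sg True ((ad x + deg A) * (ad z + deg B))
      (lcut A (\<lambda>R w \<psi>. lcut \<psi> (\<lambda>N y C. F z B x R w N y C)))))"
    by (rule cyc_cuts_cuts_rotate[OF _ fin_digraph_Q a]) simp
  also have "\<dots> = cyc a (\<lambda>x \<alpha>. lcut \<alpha> (\<lambda>A z B. lcut A (\<lambda>R w \<psi>. lcut \<psi> (\<lambda>N y C.
      sg True ((ad z + deg B) * (ad x + deg R + ad w + deg N + ad y + deg C)) (F z B x R w N y C)))))"
    by (simp add: push, rule cyc_cong[OF a], rule cut_cong, assumption, rule cut_cong, assumption,
        rule cut_cong, assumption) (simp add: bit_simps)
  also have "\<dots> = ?r"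
    by (subst cuts_coassoc, simp, subst cuts_coassoc) simp_all
  finally show ?thesis .
qed

text \<open>In an iterated cobracket \<open>y\<close> is cut before the letters \<open>z\<close> and
  \<open>w\<close> inside the piece preceding it. Coassociativity brings the cuts into the order
  used by \<open>cut4\<close>.\<close>

lemma four_cuts_reassoc:
  assumes F [simp]: "\<And>P z R w N y C. F P z R w N y C \<in> carrier M"
  shows "lcut \<alpha> (\<lambda>\<beta> y C. lcut \<beta> (\<lambda>P z \<phi>. lcut \<phi> (\<lambda>R w N. F P z R w N y C))) =
    lcut \<alpha> (\<lambda>P z \<phi>. lcut \<phi> (\<lambda>R w \<psi>. lcut \<psi> (\<lambda>N y C. F P z R w N y C)))"
proof -
  have "lcut \<alpha> (\<lambda>\<beta> y C. lcut \<beta> (\<lambda>P z \<phi>. lcut \<phi> (\<lambda>R w N. F P z R w N y C))) =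
      lcut \<alpha> (\<lambda>P z \<phi>. lcut \<phi> (\<lambda>\<theta> y C. lcut \<theta> (\<lambda>R w N. F P z R w N y C)))"
    by (rule cuts_coassoc) simp
  also have "\<dots> = lcut \<alpha> (\<lambda>P z \<phi>. lcut \<phi> (\<lambda>R w \<psi>. lcut \<psi> (\<lambda>N y C. F P z R w N y C)))"
    by (subst cuts_coassoc) simp_all
  finally show ?thesis .
qed

text \<open>The inner cobracket opens the piece between \<open>x\<close> and \<open>y\<close> as a
  cyclic word and then cuts a second letter in it. By the Leibniz rule this letter comes after the
  opening letter (\<open>nested1\<close>) or before it (\<open>nested2\<close>).\<close>

lemma cobr_cobr_expand:
  assumes t [simp]: "\<And>p u q v r w. t p u q v r w \<in> carrier M" and a: "walk Q p a p"
  shows "cobr (\<lambda>_ \<beta> q \<gamma>. cobr (\<lambda>p1 u1 p2 u2. t p1 u1 p2 u2 q \<gamma>) \<beta>) a =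
    nested1 t a \<oplus>
    nested2 t a"
  (is "_ = ?A \<oplus> ?B")
proof -
  have "cobr (\<lambda>_ \<beta> q \<gamma>. cobr (\<lambda>p1 u1 p2 u2. t p1 u1 p2 u2 q \<gamma>) \<beta>) a =
    cyc a (\<lambda>x \<alpha>. lcut \<alpha> (\<lambda>\<beta> y C. lcut \<beta> (\<lambda>P z S. lcut S (\<lambda>R w N.
      sg (paired x y \<and> paired z w) (deg \<beta> * ad y + (deg P * (ad z + deg S) + deg R * ad w))
        (t (st z) R (st w) (N @ P) (st y) C))))) \<oplus>
    cyc a (\<lambda>x \<alpha>. lcut \<alpha> (\<lambda>\<beta> y C. lcut \<beta> (\<lambda>S w N. lcut S (\<lambda>P z R.
      sg (paired x y \<and> paired w z) (deg \<beta> * ad y + (deg S * (ad w + deg N) + (deg N + deg P) * ad z))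
        (t (st w) (N @ P) (st z) R (st y) C)))))"
    (is "_ = ?raw1 \<oplus> ?raw2")
    by (simp add: cobr_sum_def cyc_cuts_def[of _ _ _ "\<lambda>x \<alpha>. cuts M pm \<alpha> (F x)" for F] cuts_append push)
  also have "?raw1 = ?A"
    apply (subst four_cuts_reassoc[symmetric], simp)
    apply (rule cyc_cong[OF a], (rule cut_cong, assumption)+)
    apply (simp add: bit_simps)
    done
  also have "?raw2 =
    cyc a (\<lambda>x \<alpha>. lcut \<alpha> (\<lambda>\<beta> y C. lcut \<beta> (\<lambda>S w N. lcut S (\<lambda>P z R.
      sg (paired x y \<and> paired w z)
        ((deg P + ad z + deg R + ad w + deg N) * ad y + (deg P + ad z + deg R) * (ad w + deg N) +
           (deg N + deg P) * ad z)
        (t (st w) (N @ P) (st z) R (st y) C)))))"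
    by (rule cyc_cong[OF a], (rule cut_cong, assumption)+) (simp add: bit_simps)
  also have "\<dots> = ?B"
    by (subst (2) cuts_coassoc, simp, subst four_cuts_reassoc) simp_all
  finally show ?thesis .
qed

text \<open>The hypothesis \<open>rot\<close> holds for values that are already summed over cyclic
  permutations, so the identity becomes the vanishing of one iterated sum. The chord from
  \<open>x\<close> to \<open>y\<close> encloses the one from \<open>z\<close> to \<open>w\<close>;
  rotating the four cuts by two places exchanges the outer and the inner chord and matches
  \<open>nested1\<close> with \<open>nested2\<close>, with opposite sign.\<close>

theorem cobr_cojacobi:
  assumes t: "cyclic_fun3 M Q t" and a: "walk Q p a p"
    and rot: "\<And>p u q v r w. t p u q v r w = sg True ((deg u + deg v) * deg w) (t r w p u q v)"
  shows "cobr (\<lambda>_ \<beta> q \<gamma>. cobr (\<lambda>p1 u1 p2 u2. t p1 u1 p2 u2 q \<gamma>) \<beta>) a = \<zero>"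
proof -
  have c2: "cyclic_fun M Q (\<lambda>q v. t p u q v r w)" for p u r w
    using t by (simp add: cyclic_fun3_def cyclic_fun2_def)
  have cl [simp]: "t p u q v r w \<in> carrier M" for p u q v r w
    using cyclic_fun_closed[OF c2] .
  have 1: "nested1 t a = sg True 1 (nested2 t a)"
  proof -
    have leaf: "t (st y) C (st x) (P @ N) (st z) R =
        sg True (deg P * deg N + deg R * (deg C + deg P + deg N) + (deg N + deg P) * (deg R + deg C))
          (t (st w) (N @ P) (st z) R (st y) C)"
      if "walk Q (st x) P (stop pm Q z)" "walk Q (st w) N (stop pm Q y)" "paired x y" "paired w z"
      for x P z R w N y C
    proof -
      have "t (st y) C (st x) (P @ N) (st z) R =
          sg True (deg P * deg N) (t (st y) C (st w) (N @ P) (st z) R)"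
        using that by (intro cyclic_funD[OF c2]) (auto dest!: pairedD)
      also have "t (st y) C (st w) (N @ P) (st z) R =
          sg True ((deg C + deg (N @ P)) * deg R) (t (st z) R (st y) C (st w) (N @ P))"
        by (rule rot)
      also have "t (st z) R (st y) C (st w) (N @ P) =
          sg True ((deg R + deg C) * deg (N @ P)) (t (st w) (N @ P) (st z) R (st y) C)"
        by (rule rot)
      finally show ?thesis
        by (simp add: bit_simps)
    qed
    show ?thesis
      apply (subst four_cuts_rotate[OF _ a], simp)
      apply (subst four_cuts_rotate[OF _ a], simp)
      apply (simp add: push)
      apply (rule cyc_cong[OF a], (rule cut_cong, assumption)+)
      apply (rule sgn_if_eqI)
         apply (auto simp: paired_sym)[1]
        apply (rule leaf; auto simp: paired_sym)
       apply (auto dest!: pairedD simp: bit_simps)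
      done
  qed
  show ?thesis
    unfolding cobr_cobr_expand[OF cl a] 1
    by (simp add: sgn_if_def l_neg)
qed

text \<open>In the cyclic order \<open>x\<close>, \<open>z\<close>, \<open>w\<close>,
  \<open>y\<close> the chord from \<open>x\<close> to \<open>w\<close> crosses the chord from
  \<open>z\<close> to \<open>y\<close>. Rotating the cuts by one place exchanges the chords and maps
  the sum to its own negative, which makes its double vanish.\<close>

theorem br_cobr:
  assumes t: "cyclic_fun M Q t" and a: "walk Q p a p"
  shows "cobr (\<lambda>_ \<beta> _ \<gamma>. br t \<beta> \<gamma>) a \<oplus> cobr (\<lambda>_ \<beta> _ \<gamma>. br t \<beta> \<gamma>) a = \<zero>"
proof -
  note [simp] = cyclic_fun_closed[OF t]
  define F where "F = (\<lambda>(x :: 'e + 'e) P z R w N y C. sg (paired x w \<and> paired z y)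
      ((deg P + ad z + deg R) * ad w + deg P * (ad z + deg R) + deg N * (ad y + deg C) +
        (deg R + deg P) * ad y)
      (t (st z) (R @ P @ C @ N)))"
  have F [simp]: "F x P z R w N y C \<in> carrier M" for x P z R w N y C
    by (simp add: F_def)
  have "cobr (\<lambda>_ \<beta> _ \<gamma>. br t \<beta> \<gamma>) a =
    cyc a (\<lambda>x \<alpha>. lcut \<alpha> (\<lambda>\<beta> w \<gamma>. lcut \<beta> (\<lambda>P z R. lcut \<gamma> (\<lambda>N y C.
      sg (paired x w \<and> paired z y) (deg \<beta> * ad w + (deg P * (ad z + deg R) +
        (deg N * (ad y + deg C) + (deg R + deg P) * ad y))) (t (st z) (R @ P @ C @ N))))))"
    by (simp add: cobr_sum_def br_sum_def cyc_cuts_def[of _ _ _ "\<lambda>x \<alpha>. cuts M pm \<beta> (F x \<alpha>)" for F \<beta>]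
       cyc_cuts_def[of _ _ _ "\<lambda>x \<alpha>. sg (P x) (e x \<alpha>) (F x \<alpha>)" for P e F] push)
  also have "\<dots> = cyc a (\<lambda>x \<alpha>. lcut \<alpha> (\<lambda>\<beta> w \<gamma>. lcut \<beta> (\<lambda>P z R. lcut \<gamma> (\<lambda>N y C. F x P z R w N y C))))"
    by (rule cyc_cong[OF a], (rule cut_cong, assumption)+) (simp add: F_def bit_simps)
  also have "\<dots> = cut4 a (\<lambda>x P z R w N y C. F x P z R w N y C)"
    by (subst cuts_coassoc) simp_all
  finally have 1: "cobr (\<lambda>_ \<beta> _ \<gamma>. br t \<beta> \<gamma>) a = \<dots>" .
  also have "\<dots> = sg True 1 \<dots>"
  proof -
    have leaf: "t (st x) (P @ C @ N @ R) = sg True (deg R * (deg P + deg C + deg N)) (t (st z) (R @ P @ C @ N))"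
      if "walk Q (st x) P (stop pm Q z)" "walk Q (st z) R (stop pm Q w)" "walk Q (st w) N (stop pm Q y)"
        "walk Q (st y) C (stop pm Q x)" "paired x w" "paired z y"
      for x P z R w N y C
    proof -
      have "walk Q (st x) (P @ C @ N) (st z)"
        using that by (auto dest!: pairedD intro!: Q.walk_append)
      then show ?thesis
        using that cyclic_funD[OF t, of "st x" "P @ C @ N" "st z" R]
        by (auto dest!: pairedD simp: bit_simps)
    qed
    show ?thesis
      apply (subst four_cuts_rotate[OF _ a], simp)
      apply (simp add: push)
      apply (rule cyc_cong[OF a], (rule cut_cong, assumption)+)
      unfolding F_def
      apply simp
      apply (rule sgn_if_eqI)
         apply (auto simp: paired_sym)[1]
        apply (rule leaf; auto simp: paired_sym)
       apply (auto dest!: pairedD simp: bit_simps)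
      done
  qed
  finally show ?thesis
    using sgn_if_cancel[where e = 0] unfolding 1[symmetric] by (metis add_0_right br_closed
        cobr_closed cyclic_fun_closed[OF t] sgn_if_True_0)
qed


text \<open>Both chords run from \<open>a\<close> to \<open>b\<close>. Rotating the two cuts in each
  of the words exchanges the chord used for joining with the chord used for splitting.\<close>

lemma across_cancel:
  assumes s: "cyclic_fun2 M Q s" and a: "walk Q p a p" and b: "walk Q q b q"
  shows "across1 s a b = sg True 1 (across2 s a b)"
proof -
  have c: "cyclic_fun M Q (\<lambda>p u. s p u q v)" "cyclic_fun M Q (s p u)" for p u q v
    using s by (simp_all add: cyclic_fun2_def)
  have [simp]: "s p u q v \<in> carrier M" for p u q v
    using cyclic_fun_closed[OF c(1)] .
  have leaf: "s (st x) (A @ N) (st y) (R @ B) =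
      sg True (deg A * deg N + deg R * deg B) (s (st w) (N @ A) (st z) (B @ R))"
    if "walk Q (st x) A (stop pm Q z)" "walk Q (st z) B (stop pm Q x)"
      "walk Q (st y) R (stop pm Q w)" "walk Q (st w) N (stop pm Q y)" "paired x y" "paired z w"
    for x A z B y R w N
  proof -
    have "s (st x) (A @ N) (st y) (R @ B) = sg True (deg A * deg N) (s (st w) (N @ A) (st y) (R @ B))"
      using that by (intro cyclic_funD[OF c(1)]) (auto dest!: pairedD)
    also have "s (st w) (N @ A) (st y) (R @ B) = sg True (deg R * deg B) (s (st w) (N @ A) (st z) (B @ R))"
      using that by (intro cyclic_funD[OF c(2)]) (auto dest!: pairedD)
    finally show ?thesis
      by (simp add: bit_simps)
  qed
  show ?thesis
    apply (subst cyc_cuts_cuts_rotate[OF _ fin_digraph_Q a], simp)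
    apply (subst cyc_cuts_cuts_rotate[OF _ fin_digraph_Q b], simp)
    apply (simp add: push)
    apply (rule cyc_cong[OF a], rule cut_cong, assumption, rule cyc_cong[OF b], rule cut_cong, assumption)
    apply (rule sgn_if_eqI)
       apply (auto simp: paired_sym)[1]
      apply (rule leaf; auto simp: paired_sym)
     apply (auto dest!: pairedD simp: bit_simps)
    done
qed

text \<open>Each of the two cuts of the joined word \<open>\<alpha> @ \<beta>\<close> lies in one of
  its pieces. The six families record in which piece the opening letter \<open>z\<close> lies and
  whether \<open>w\<close> comes after it in the same piece, in the other piece, or before it in the
  same piece. Those with both letters in \<open>\<beta>\<close> are the \<open>within\<close>
  families with \<open>a\<close> and \<open>b\<close> exchanged.\<close>

lemma br_cobr_expand:
  assumes s [simp]: "\<And>p u q v. s p u q v \<in> carrier M"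
    and a: "walk Q p a p" and b: "walk Q q b q"
  shows "br (\<lambda>_. cobr s) a b = (within1 s a b \<oplus> across1 s a b \<oplus> within2 s a b) \<oplus>
    (sg True (deg a * deg b) (within1 s b a) \<oplus> across2 s a b \<oplus> sg True (deg a * deg b) (within2 s b a))"
proof -
  have "br (\<lambda>_. cobr s) a b =
    (cyc a (\<lambda>x \<alpha>. cyc b (\<lambda>y \<beta>. lcut \<alpha> (\<lambda>A z B. lcut B (\<lambda>R w N.
        sg (paired x y \<and> paired z w)
          (deg \<alpha> * ad y + (deg A * (ad z + deg B + deg \<beta>) + deg R * ad w))
          (s (st z) R (st w) (N @ \<beta> @ A)))))) \<oplus>
     cyc a (\<lambda>x \<alpha>. cyc b (\<lambda>y \<beta>. lcut \<alpha> (\<lambda>A z B. lcut \<beta> (\<lambda>R w N.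
        sg (paired x y \<and> paired z w)
          (deg \<alpha> * ad y + (deg A * (ad z + deg B + deg \<beta>) + (deg B + deg R) * ad w))
          (s (st z) (B @ R) (st w) (N @ A)))))) \<oplus>
     cyc a (\<lambda>x \<alpha>. cyc b (\<lambda>y \<beta>. lcut \<alpha> (\<lambda>A z B. lcut A (\<lambda>R w N.
        sg (paired x y \<and> paired z w)
          (deg \<alpha> * ad y + (deg A * (ad z + deg B + deg \<beta>) + (deg B + deg \<beta> + deg R) * ad w))
          (s (st z) (B @ \<beta> @ R) (st w) N)))))) \<oplus>
    (cyc a (\<lambda>x \<alpha>. cyc b (\<lambda>y \<beta>. lcut \<beta> (\<lambda>A z B. lcut B (\<lambda>R w N.
        sg (paired x y \<and> paired z w)
          (deg \<alpha> * ad y + ((deg \<alpha> + deg A) * (ad z + deg B) + deg R * ad w))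
          (s (st z) R (st w) (N @ \<alpha> @ A)))))) \<oplus>
     cyc a (\<lambda>x \<alpha>. cyc b (\<lambda>y \<beta>. lcut \<beta> (\<lambda>A z B. lcut \<alpha> (\<lambda>R w N.
        sg (paired x y \<and> paired z w)
          (deg \<alpha> * ad y + ((deg \<alpha> + deg A) * (ad z + deg B) + (deg B + deg R) * ad w))
          (s (st z) (B @ R) (st w) (N @ A)))))) \<oplus>
     cyc a (\<lambda>x \<alpha>. cyc b (\<lambda>y \<beta>. lcut \<beta> (\<lambda>A z B. lcut A (\<lambda>R w N.
        sg (paired x y \<and> paired z w)
          (deg \<alpha> * ad y + ((deg \<alpha> + deg A) * (ad z + deg B) + (deg B + deg \<alpha> + deg R) * ad w))
          (s (st z) (B @ \<alpha> @ R) (st w) N))))))"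
    (is "_ = (?A1 \<oplus> ?A2 \<oplus> ?A3) \<oplus> (?B1 \<oplus> ?B2 \<oplus> ?B3)")
    by (simp add: br_sum_def cobr_sum_def cyc_cuts_append cuts_append push add.assoc a_assoc)
  also have "?A1 = within1 s a b"
    apply (simp add: cyc_cuts_cuts_comm[of _ pm b])
    apply (rule cyc_cong[OF a], (rule cut_cong, assumption)+)
    apply (simp add: bit_simps)
    done
  also have "?A2 = across1 s a b"
    by (simp add: cyc_cuts_cuts_comm[of _ pm b], rule cyc_cong[OF a], rule cut_cong, assumption) simp
  also have "?A3 = within2 s a b"
  proof -
    have "?A3 = cyc a (\<lambda>x \<alpha>. lcut \<alpha> (\<lambda>A w N. lcut A (\<lambda>P z R. cyc b (\<lambda>y \<beta>.
      sg (paired x y \<and> paired w z)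
        ((deg P + ad z + deg R + ad w + deg N) * ad y +
          ((deg P + ad z + deg R) * (ad w + deg N + deg \<beta>) + (deg N + deg \<beta> + deg P) * ad z))
        (s (st w) (N @ \<beta> @ P) (st z) R)))))"
      apply (simp add: cyc_cuts_cuts_comm[of _ pm b])
      apply (rule cyc_cong[OF a], (rule cut_cong, assumption)+)
      apply (simp add: bit_simps)
      done
    also have "\<dots> = within2 s a b"
      by (subst cuts_coassoc) simp_all
    finally show ?thesis .
  qed
  also have "?B1 = sg True (deg a * deg b) (within1 s b a)"
    apply (subst cyc_cuts_comm, simp)
    apply (simp add: cyc_cuts_cuts_comm[of _ pm a] push)
    apply (rule cyc_cong[OF b], (rule cut_cong, assumption)+, rule cyc_cong[OF a])
    apply (rule sgn_if_eqI[where d = 0])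
       apply (auto dest!: pairedD simp: paired_sym bit_simps)
    done
  also have "?B2 = across2 s a b"
    apply (subst cuts_comm, simp)
    apply (simp add: cyc_cuts_cuts_comm[of _ pm b])
    apply (rule cyc_cong[OF a], rule cut_cong, assumption)
    apply simp
    done
  also have "?B3 = sg True (deg a * deg b) (within2 s b a)"
  proof -
    have "?B3 = cyc b (\<lambda>x \<beta>. lcut \<beta> (\<lambda>A w N. lcut A (\<lambda>P z R. cyc a (\<lambda>y \<alpha>.
      sg (paired x y \<and> paired w z) (deg a * deg b +
        ((deg P + ad z + deg R + ad w + deg N) * ad y +
          ((deg P + ad z + deg R) * (ad w + deg N + deg \<alpha>) + (deg N + deg \<alpha> + deg P) * ad z)))
        (s (st w) (N @ \<alpha> @ P) (st z) R)))))"
      apply (subst cyc_cuts_comm, simp)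
      apply (simp add: cyc_cuts_cuts_comm[of _ pm a])
      apply (rule cyc_cong[OF b], (rule cut_cong, assumption)+, rule cyc_cong[OF a])
      apply (rule sgn_if_eqI[where d = 0])
      apply (auto dest!: pairedD simp: paired_sym bit_simps)
      done
    also have "\<dots> = sg True (deg a * deg b) (within2 s b a)"
      by (subst cuts_coassoc) (simp_all add: push)
    finally show ?thesis .
  qed
  finally show ?thesis .
qed


text \<open>This is \<open>(br \<otimes> id) \<circ> (id \<otimes> \<sigma>) \<circ> (\<delta>
  \<otimes> id)\<close> on two words, without the factor 1/2. The exponent
  \<open>deg \<gamma> * deg b\<close> comes from \<open>\<sigma>\<close>, which moves
  \<open>b\<close> next to the piece \<open>\<beta>\<close>.\<close>

definition cobr_br ::
    "('v \<Rightarrow> 'e word \<Rightarrow> 'v \<Rightarrow> 'e word \<Rightarrow> 'm) \<Rightarrow> 'e word \<Rightarrow> 'e word \<Rightarrow> 'm" where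
  "cobr_br s a b =
     cobr (\<lambda>_ \<beta> q \<gamma>. sg True (deg \<gamma> * deg b) (br (\<lambda>r \<zeta>. s r \<zeta> q \<gamma>) \<beta> b)) a"

lemma cobr_br_closed [simp]: "(\<And>p u q v. s p u q v \<in> carrier M) \<Longrightarrow> cobr_br s a b \<in> carrier M"
  by (simp add: cobr_br_def)

lemma cobr_br_expand:
  assumes s [simp]: "\<And>p u q v. s p u q v \<in> carrier M"
    and a: "walk Q p a p" and b: "walk Q q b q"
  shows "cobr_br s a b =
    cut3 a (\<lambda>x P z R w N. cyc b (\<lambda>y \<beta>.
      sg (paired x w \<and> paired z y)
        ((deg P + ad z + deg R) * ad w + deg N * (deg \<beta> + ad y) + deg P * (ad z + deg R) +
          (deg R + deg P) * ad y)
        (s (st z) (R @ P @ \<beta>) (st w) N)))"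
proof -
  have "cobr_br s a b =
    cyc a (\<lambda>x \<alpha>. lcut \<alpha> (\<lambda>A w N. cyc b (\<lambda>y \<beta>. lcut A (\<lambda>P z R.
      sg (paired x w \<and> paired z y)
        (deg P * (ad z + deg R) + (deg A * ad w + (deg N * deg b + (deg R + deg P) * ad y)))
        (s (st z) (R @ P @ \<beta>) (st w) N)))))"
    unfolding cobr_br_def cobr_sum_def br_sum_def
    by (simp add: push cyc_cuts_comm[of _ pm _ b])
      (simp add: cyc_cuts_def[of _ _ _ "\<lambda>x \<alpha>. sg (P x) (e x \<alpha>) (F x \<alpha>)" for P e F] push)
  also have "\<dots> = cyc a (\<lambda>x \<alpha>. lcut \<alpha> (\<lambda>A w N. lcut A (\<lambda>P z R. cyc b (\<lambda>y \<beta>.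
      sg (paired x w \<and> paired z y)
        (deg P * (ad z + deg R) + (deg A * ad w + (deg N * deg b + (deg R + deg P) * ad y)))
        (s (st z) (R @ P @ \<beta>) (st w) N)))))"
    by (simp add: cyc_cuts_cuts_comm[of _ pm b])
  also have "\<dots> = cyc a (\<lambda>x \<alpha>. lcut \<alpha> (\<lambda>A w N. lcut A (\<lambda>P z R. cyc b (\<lambda>y \<beta>.
      sg (paired x w \<and> paired z y)
        ((deg P + ad z + deg R) * ad w + deg N * (deg \<beta> + ad y) + deg P * (ad z + deg R) +
          (deg R + deg P) * ad y)
        (s (st z) (R @ P @ \<beta>) (st w) N)))))"
    by (rule cyc_cong[OF a], (rule cut_cong, assumption)+, rule cyc_cong[OF b]) (simp add: bit_simps)
  finally show ?thesis
    by (subst (asm) cuts_coassoc) simp_all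
qed

text \<open>Passing from \<open>s\<close> to \<open>s'\<close> accounts for the outer
  symmetrisation, exchanging \<open>a\<close> and \<open>b\<close> for the inner one. Terms with one
  chord inside a single word occur in both summands of the identity: joining to the other word
  before or after splitting changes the sign.\<close>

theorem br_cobr_compat:
  assumes s: "cyclic_fun2 M Q s" and a: "walk Q p a p" and b: "walk Q q b q"
  defines "s' \<equiv> \<lambda>p u q v. sg True (deg u * deg v) (s q v p u)"
  shows "br (\<lambda>_. cobr s) a b \<oplus>
    ((cobr_br s a b \<oplus> cobr_br s' a b) \<oplus>
     sg True (deg a * deg b) (cobr_br s b a \<oplus> cobr_br s' b a)) = \<zero>"
proof -
  have c: "cyclic_fun M Q (\<lambda>p u. s p u q v)" "cyclic_fun M Q (s p u)" for p u q v
    using s by (simp_all add: cyclic_fun2_def)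
  have [simp]: "s p u q v \<in> carrier M" for p u q v
    using cyclic_fun_closed[OF c(1)] .
  have [simp]: "s' p u q v \<in> carrier M" for p u q v
    by (simp add: s'_def)
  have within1: "within1 s a b = sg True 1 (cobr_br s' a b)"
    if a: "walk Q p a p" and b: "walk Q q b q" for a b p q
  proof -
    have leaf: "s (st w) N (st x) (P @ \<beta> @ R) = sg True (deg R * (deg P + deg \<beta>)) (s (st w) N (st z) (R @ P @ \<beta>))"
      if "walk Q (st x) P (stop pm Q z)" "walk Q (st z) R (stop pm Q w)"
        "walk Q (st y) \<beta> (stop pm Q y)" "paired x w" "paired z y"
      for x P z R w N y \<beta>
    proof -
      have "walk Q (st x) (P @ \<beta>) (st z)"
        using that by (auto dest!: pairedD intro!: Q.walk_append)
      then show ?thesis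
        using that cyclic_funD[OF c(2), of "st x" "P @ \<beta>" "st z" R]
        by (auto dest!: pairedD simp: bit_simps)
    qed
    show ?thesis
      \<comment> \<open>Two rotations turn the letter joined to \<open>b\<close> into the middle one
        of the three cuts, which is its place in \<open>cobr_br_expand\<close>.\<close>
      apply (subst three_cuts_rotate[OF _ a], simp)
      apply (subst three_cuts_rotate[OF _ a], simp)
      apply (subst cobr_br_expand[OF _ a b], simp)
      apply (simp add: push s'_def)
      apply (rule cyc_cong[OF a], (rule cut_cong, assumption)+, rule cyc_cong[OF b])
      apply (rule sgn_if_eqI)
         apply (auto simp: paired_sym)[1]
        apply (rule leaf; auto simp: paired_sym)
       apply (auto dest!: pairedD simp: bit_simps)
      done
  qed
  have within2: "within2 s a b = sg True 1 (cobr_br s a b)"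
    if a: "walk Q p a p" and b: "walk Q q b q" for a b p q
  proof -
    have leaf: "s (st x) (P @ \<beta> @ R) (st w) N = sg True (deg R * (deg P + deg \<beta>)) (s (st z) (R @ P @ \<beta>) (st w) N)"
      if "walk Q (st x) P (stop pm Q z)" "walk Q (st z) R (stop pm Q w)"
        "walk Q (st y) \<beta> (stop pm Q y)" "paired x w" "paired z y"
      for x P z R w N y \<beta>
    proof -
      have "walk Q (st x) (P @ \<beta>) (st z)"
        using that by (auto dest!: pairedD intro!: Q.walk_append)
      then show ?thesis
        using that cyclic_funD[OF c(1), of "st x" "P @ \<beta>" "st z" R]
        by (auto dest!: pairedD simp: bit_simps)
    qed
    show ?thesis
      apply (subst three_cuts_rotate[OF _ a], simp)
      apply (subst three_cuts_rotate[OF _ a], simp)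
      apply (subst cobr_br_expand[OF _ a b], simp)
      apply (simp add: push)
      apply (rule cyc_cong[OF a], (rule cut_cong, assumption)+, rule cyc_cong[OF b])
      apply (rule sgn_if_eqI)
         apply (auto simp: paired_sym)[1]
        apply (rule leaf; auto simp: paired_sym)
       apply (auto dest!: pairedD simp: bit_simps)
      done
  qed
  have cancel: "(sg True 1 y1' \<oplus> sg True 1 m \<oplus> sg True 1 y1) \<oplus>
      (sg True e (sg True 1 y2') \<oplus> m \<oplus> sg True e (sg True 1 y2)) \<oplus>
      ((y1 \<oplus> y1') \<oplus> sg True e (y2 \<oplus> y2')) = \<zero>"
    if [simp]: "y1 \<in> carrier M" "y1' \<in> carrier M" "y2 \<in> carrier M" "y2' \<in> carrier M" "m \<in> carrier M"
    for y1 y1' y2 y2' m e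
  proof -
    have "(sg True 1 y1' \<oplus> sg True 1 m \<oplus> sg True 1 y1) \<oplus>
      (sg True e (sg True 1 y2') \<oplus> m \<oplus> sg True e (sg True 1 y2)) \<oplus>
      ((y1 \<oplus> y1') \<oplus> sg True e (y2 \<oplus> y2')) =
      (y1 \<oplus> y1' \<oplus> m \<oplus> sg True e y2 \<oplus> sg True e y2') \<oplus> sg True 1 (y1 \<oplus> y1' \<oplus> m \<oplus> sg True e y2 \<oplus> sg True e y2')"
      by (simp add: sgn_if_add a_ac add.commute)
    also have "\<dots> = \<zero>"
      by (subst sgn_if_cancel) (simp_all add: sgn_if_add)
    finally show ?thesis .
  qed
  show ?thesis
    by (subst br_cobr_expand[OF _ a b], simp)
      (simp only: within1[OF a b] within1[OF b a] within2[OF a b] within2[OF b a]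
        across_cancel[OF s a b], rule cancel; simp)
qed

end

section \<open>Modules and their homomorphisms\<close>

text \<open>Unlike \<open>linear_map\<close> this does not ask for extensionality and is therefore
  stable under composition and sums written as lambda terms. It also carries the module axioms of
  source and target.\<close>

definition mod_hom ::
    "('r, 'm) ring_scheme \<Rightarrow> ('r, 'a, 'k) module_scheme \<Rightarrow> ('r, 'b, 'l) module_scheme \<Rightarrow>
     ('a \<Rightarrow> 'b) \<Rightarrow> bool" where
  "mod_hom R M N h \<longleftrightarrow>
     Module.module R M \<and> Module.module R N \<and> h \<in> carrier M \<rightarrow> carrier N \<and>
     (\<forall>x\<in>carrier M. \<forall>y\<in>carrier M. h (x \<oplus>\<^bsub>M\<^esub> y) = h x \<oplus>\<^bsub>N\<^esub> h y) \<and>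
     (\<forall>r\<in>carrier R. \<forall>x\<in>carrier M. h (r \<odot>\<^bsub>M\<^esub> x) = r \<odot>\<^bsub>N\<^esub> h x)"

lemma linear_map_iff_mod_hom:
  "Module.module R M \<Longrightarrow> Module.module R N \<Longrightarrow>
   linear_map R M N h \<longleftrightarrow> mod_hom R M N h \<and> h \<in> extensional (carrier M)"
  by (auto simp: linear_map_def mod_hom_def PiE_def)

lemma mod_homD:
  assumes "mod_hom R M N h"
  shows "Module.module R M" "Module.module R N"
    and "x \<in> carrier M \<Longrightarrow> h x \<in> carrier N"
    and "x \<in> carrier M \<Longrightarrow> y \<in> carrier M \<Longrightarrow> h (x \<oplus>\<^bsub>M\<^esub> y) = h x \<oplus>\<^bsub>N\<^esub> h y"
    and "r \<in> carrier R \<Longrightarrow> x \<in> carrier M \<Longrightarrow> h (r \<odot>\<^bsub>M\<^esub> x) = r \<odot>\<^bsub>N\<^esub> h x"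
  using assms by (auto simp: mod_hom_def)

lemma mod_homI:
  assumes "Module.module R M" "Module.module R N"
    and "\<And>x. x \<in> carrier M \<Longrightarrow> h x \<in> carrier N"
    and "\<And>x y. x \<in> carrier M \<Longrightarrow> y \<in> carrier M \<Longrightarrow> h (x \<oplus>\<^bsub>M\<^esub> y) = h x \<oplus>\<^bsub>N\<^esub> h y"
    and "\<And>r x. r \<in> carrier R \<Longrightarrow> x \<in> carrier M \<Longrightarrow> h (r \<odot>\<^bsub>M\<^esub> x) = r \<odot>\<^bsub>N\<^esub> h x"
  shows "mod_hom R M N h"
  using assms by (auto simp: mod_hom_def)

lemma mod_hom_cong:
  assumes "mod_hom R M N h" "\<And>x. x \<in> carrier M \<Longrightarrow> h x = h' x"
  shows "mod_hom R M N h'"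
proof -
  interpret M: Module.module R M using mod_homD(1)[OF assms(1)] .
  have "h' x = h x" if "x \<in> carrier M" for x
    using assms(2)[OF that] by simp
  then show ?thesis
    using assms(1) by (auto simp: mod_hom_def Pi_iff)
qed

lemma mod_hom_zero:
  assumes "mod_hom R M N h"
  shows "h \<zero>\<^bsub>M\<^esub> = \<zero>\<^bsub>N\<^esub>"
proof -
  interpret M: Module.module R M using mod_homD(1)[OF assms] .
  interpret N: Module.module R N using mod_homD(2)[OF assms] .
  have "h (\<zero>\<^bsub>R\<^esub> \<odot>\<^bsub>M\<^esub> \<zero>\<^bsub>M\<^esub>) = \<zero>\<^bsub>R\<^esub> \<odot>\<^bsub>N\<^esub> h \<zero>\<^bsub>M\<^esub>"
    by (rule mod_homD(5)[OF assms]) simp_all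
  then show ?thesis
    using mod_homD(3)[OF assms] by simp
qed

lemma mod_hom_a_inv:
  assumes "mod_hom R M N h" and x: "x \<in> carrier M"
  shows "h (\<ominus>\<^bsub>M\<^esub> x) = \<ominus>\<^bsub>N\<^esub> h x"
proof -
  interpret M: Module.module R M using mod_homD(1)[OF assms(1)] .
  interpret N: Module.module R N using mod_homD(2)[OF assms(1)] .
  have "h ((\<ominus>\<^bsub>R\<^esub> \<one>\<^bsub>R\<^esub>) \<odot>\<^bsub>M\<^esub> x) = (\<ominus>\<^bsub>R\<^esub> \<one>\<^bsub>R\<^esub>) \<odot>\<^bsub>N\<^esub> h x"
    by (rule mod_homD(5)[OF assms(1)]) (use x in simp_all)
  then show ?thesis
    using mod_homD(3)[OF assms(1) x] x by (simp add: M.smult_l_minus N.smult_l_minus)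
qed

lemma mod_hom_sgn_if:
  assumes "mod_hom R M N h" "x \<in> carrier M"
  shows "h (sgn_if M P e x) = sgn_if N P e (h x)"
  using assms by (simp add: sgn_if_def mod_hom_zero mod_hom_a_inv)

lemma mod_hom_compose:
  "mod_hom R M N f \<Longrightarrow> mod_hom R N K g \<Longrightarrow> mod_hom R M K (\<lambda>x. g (f x))"
  by (auto simp: mod_hom_def Pi_iff)

context Module.module
begin

lemma mod_hom_id: "mod_hom R M M (\<lambda>x. x)"
  by (intro mod_homI module_axioms) simp_all

lemma mod_hom_add:
  assumes f: "mod_hom R K M f" and g: "mod_hom R K M g"
  shows "mod_hom R K M (\<lambda>x. f x \<oplus>\<^bsub>M\<^esub> g x)"
  using mod_homD[OF f] mod_homD[OF g]
  by (intro mod_homI) (simp_all add: M.a_ac smult_r_distr)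

lemma mod_hom_smult:
  assumes f: "mod_hom R K M f" and r: "r \<in> carrier R"
  shows "mod_hom R K M (\<lambda>x. r \<odot>\<^bsub>M\<^esub> f x)"
  using mod_homD[OF f] r
  by (intro mod_homI) (simp_all add: smult_r_distr smult_assoc1[symmetric] R.m_comm)

lemma mod_hom_zero_map: "Module.module R K \<Longrightarrow> mod_hom R K M (\<lambda>x. \<zero>\<^bsub>M\<^esub>)"
  by (intro mod_homI module_axioms) simp_all

lemma sgn_pow_smult: "x \<in> carrier M \<Longrightarrow> sgn_pow R e \<odot>\<^bsub>M\<^esub> x = sgn_if M True e x"
  by (simp add: sgn_pow_def sgn_if_def smult_l_minus)

lemma smult_sgn_if: "r \<in> carrier R \<Longrightarrow> x \<in> carrier M \<Longrightarrow>
    r \<odot>\<^bsub>M\<^esub> sgn_if M P e x = sgn_if M P e (r \<odot>\<^bsub>M\<^esub> x)"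
  by (simp add: sgn_if_def smult_r_minus)

lemma span_submodule: "S \<subseteq> carrier M \<Longrightarrow> submodule (submodule_span R M S) R M"
  using carrier_is_submodule
  by (intro submoduleI) (auto simp: submodule_span_def dest: submoduleE
      intro: submoduleE subgroup.one_closed[where G = "add_monoid M", simplified] submodule.axioms(1))

lemma span_superset: "S \<subseteq> submodule_span R M S"
  by (auto simp: submodule_span_def)

lemma span_least: "submodule H R M \<Longrightarrow> S \<subseteq> H \<Longrightarrow> submodule_span R M S \<subseteq> H"
  by (auto simp: submodule_span_def)

lemma span_subset_carrier: "S \<subseteq> carrier M \<Longrightarrow> submodule_span R M S \<subseteq> carrier M"
  using submoduleE(1)[OF span_submodule] .

lemma submodule_zero: "submodule H R M \<Longrightarrow> \<zero>\<^bsub>M\<^esub> \<in> H"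
  using submodule.axioms(1) subgroup.one_closed[where G = "add_monoid M"] by fastforce

lemma mod_hom_vimage:
  assumes f: "mod_hom R M N f" and H: "submodule H R N"
  shows "submodule {x \<in> carrier M. f x \<in> H} R M"
proof -
  interpret N: Module.module R N using mod_homD(2)[OF f] .
  show ?thesis
    using mod_homD[OF f] mod_hom_zero[OF f] mod_hom_a_inv[OF f]
      N.submodule_zero[OF H] N.submoduleE[OF H]
    by (intro submoduleI) auto
qed

lemma mod_hom_span_into:
  assumes f: "mod_hom R M N f" and H: "submodule H R N"
    and S: "S \<subseteq> carrier M" "\<And>s. s \<in> S \<Longrightarrow> f s \<in> H" and x: "x \<in> submodule_span R M S"
  shows "f x \<in> H"
  using span_least[OF mod_hom_vimage[OF f H], of S] S x by auto

text \<open>The elements on which two homomorphisms agree form a submodule. All identities between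
  maps are reduced to generators in this way.\<close>

lemma mod_hom_eq_on_span:
  assumes f: "mod_hom R M N f" and g: "mod_hom R M N g"
    and S: "S \<subseteq> carrier M" "\<And>s. s \<in> S \<Longrightarrow> f s = g s" and x: "x \<in> submodule_span R M S"
  shows "f x = g x"
proof -
  interpret N: Module.module R N using mod_homD(2)[OF f] .
  have "submodule {x \<in> carrier M. f x = g x} R M"
    using mod_homD[OF f] mod_homD[OF g] mod_hom_zero[OF f] mod_hom_zero[OF g]
      mod_hom_a_inv[OF f] mod_hom_a_inv[OF g]
    by (intro submoduleI) auto
  from span_least[OF this, of S] show ?thesis
    using S x by auto
qed

end

text \<open>The module axioms involve only these four fields, so gradings and the inherited fields
  \<open>mult\<close> and \<open>one\<close> may be changed freely.\<close>

lemma module_transfer: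
  assumes "Module.module R M" "carrier M' = carrier M" "add M' = add M" "zero M' = zero M" "smult M' = smult M"
  shows "Module.module R M'"
proof -
  interpret M: Module.module R M by fact
  have "\<exists>y\<in>carrier M. y \<oplus>\<^bsub>M\<^esub> x = \<zero>\<^bsub>M\<^esub>" if "x \<in> carrier M" for x
    using that M.l_neg by (intro bexI[of _ "\<ominus>\<^bsub>M\<^esub> x"]) auto
  then show ?thesis
    by (intro moduleI abelian_groupI M.cring_axioms)
      (auto simp: assms M.a_ac M.smult_l_distr M.smult_r_distr M.smult_assoc1)
qed

lemma with_grading_simps [simp]:
  "carrier (with_grading M g) = carrier M" "add (with_grading M g) = add M"
  "zero (with_grading M g) = zero M" "smult (with_grading M g) = smult M"
  "mult (with_grading M g) = mult M" "grade (with_grading M g) = g"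
  by (simp_all add: with_grading_def module.defs supermodule.defs)

section \<open>Quotient modules\<close>

context Module.module
begin

lemma quotient_carrier: "carrier (quotient_module M H) = (\<lambda>x. H +>\<^bsub>M\<^esub> x) ` carrier M"
  by (auto simp: quotient_module_def A_RCOSETS_def')

lemma submodule_abelian_subgroup: "submodule H R M \<Longrightarrow> abelian_subgroup H M"
  using submodule.axioms(1) by (intro abelian_subgroupI3 additive_subgroupI M.abelian_group_axioms)

lemma quotient_add:
  assumes H: "submodule H R M" and "x \<in> carrier M" "y \<in> carrier M"
  shows "(H +>\<^bsub>M\<^esub> x) \<oplus>\<^bsub>quotient_module M H\<^esub> (H +>\<^bsub>M\<^esub> y) = H +>\<^bsub>M\<^esub> (x \<oplus>\<^bsub>M\<^esub> y)"
  using abelian_subgroup.a_rcos_sum[OF submodule_abelian_subgroup[OF H]] assms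
  by (simp add: quotient_module_def)

lemma quotient_smult:
  assumes H: "submodule H R M" and r: "r \<in> carrier R" and x: "x \<in> carrier M"
  shows "r \<odot>\<^bsub>quotient_module M H\<^esub> (H +>\<^bsub>M\<^esub> x) = H +>\<^bsub>M\<^esub> (r \<odot>\<^bsub>M\<^esub> x)"
proof -
  note Hc = submoduleE[OF H]
  have "H <+>\<^bsub>M\<^esub> ((\<lambda>x. r \<odot>\<^bsub>M\<^esub> x) ` (H +>\<^bsub>M\<^esub> x)) = H +>\<^bsub>M\<^esub> (r \<odot>\<^bsub>M\<^esub> x)"
  proof (intro equalityI subsetI)
    fix z assume "z \<in> H <+>\<^bsub>M\<^esub> ((\<lambda>x. r \<odot>\<^bsub>M\<^esub> x) ` (H +>\<^bsub>M\<^esub> x))"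
    then obtain h h' where h: "h \<in> H" "h' \<in> H" and z: "z = h \<oplus>\<^bsub>M\<^esub> r \<odot>\<^bsub>M\<^esub> (h' \<oplus>\<^bsub>M\<^esub> x)"
      by (auto simp: set_add_def' a_r_coset_def')
    have c: "h \<in> carrier M" "h' \<in> carrier M"
      using h Hc(1) by auto
    have "z = (h \<oplus>\<^bsub>M\<^esub> r \<odot>\<^bsub>M\<^esub> h') \<oplus>\<^bsub>M\<^esub> r \<odot>\<^bsub>M\<^esub> x"
      using c r x by (simp add: z smult_r_distr M.a_assoc)
    then show "z \<in> H +>\<^bsub>M\<^esub> (r \<odot>\<^bsub>M\<^esub> x)"
      using h Hc(4,5) r by (auto simp: a_r_coset_def')
  next
    fix z assume "z \<in> H +>\<^bsub>M\<^esub> (r \<odot>\<^bsub>M\<^esub> x)"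
    then obtain h where h: "h \<in> H" and z: "z = h \<oplus>\<^bsub>M\<^esub> r \<odot>\<^bsub>M\<^esub> (\<zero>\<^bsub>M\<^esub> \<oplus>\<^bsub>M\<^esub> x)"
      using x by (auto simp: a_r_coset_def')
    then show "z \<in> H <+>\<^bsub>M\<^esub> ((\<lambda>x. r \<odot>\<^bsub>M\<^esub> x) ` (H +>\<^bsub>M\<^esub> x))"
      using submodule_zero[OF H] by (fastforce simp: set_add_def' a_r_coset_def')
  qed
  then show ?thesis
    by (simp add: quotient_module_def)
qed

lemma quotient_zero: "submodule H R M \<Longrightarrow> \<zero>\<^bsub>quotient_module M H\<^esub> = H +>\<^bsub>M\<^esub> \<zero>\<^bsub>M\<^esub>"
  using submoduleE(1) by (simp add: quotient_module_def)

lemma module_quotient: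
  assumes H: "submodule H R M"
  shows "Module.module R (quotient_module M H)"
proof (intro moduleI abelian_groupI R.cring_axioms)
  fix X assume "X \<in> carrier (quotient_module M H)"
  then obtain x where x: "x \<in> carrier M" and X: "X = H +>\<^bsub>M\<^esub> x"
    by (auto simp: quotient_carrier)
  have "(H +>\<^bsub>M\<^esub> (\<ominus>\<^bsub>M\<^esub> x)) \<oplus>\<^bsub>quotient_module M H\<^esub> X = \<zero>\<^bsub>quotient_module M H\<^esub>"
    using x by (simp add: X quotient_add[OF H] quotient_zero[OF H] M.l_neg)
  then show "\<exists>y\<in>carrier (quotient_module M H). y \<oplus>\<^bsub>quotient_module M H\<^esub> X = \<zero>\<^bsub>quotient_module M H\<^esub>"
    using x by (auto simp: quotient_carrier)
qed (auto simp: quotient_carrier quotient_add[OF H] quotient_smult[OF H] quotient_zero[OF H]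
    M.a_ac smult_l_distr smult_r_distr smult_assoc1)

lemma mod_hom_quotient:
  "submodule H R M \<Longrightarrow> mod_hom R M (quotient_module M H) (\<lambda>x. H +>\<^bsub>M\<^esub> x)"
  by (intro mod_homI module_axioms module_quotient)
    (simp_all add: quotient_carrier quotient_add quotient_smult)

lemma quotient_eqI:
  assumes H: "submodule H R M" and x: "x \<in> carrier M" and y: "y \<in> carrier M" and xy: "x \<ominus>\<^bsub>M\<^esub> y \<in> H"
  shows "H +>\<^bsub>M\<^esub> x = H +>\<^bsub>M\<^esub> y"
proof (rule M.a_coset_add_inv1)
  show "H +>\<^bsub>M\<^esub> (x \<oplus>\<^bsub>M\<^esub> \<ominus>\<^bsub>M\<^esub> y) = H"
    using xy x y submodule.axioms(1)[OF H] by (intro M.a_coset_join2) (simp_all add: M.minus_eq)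
qed (use x y submoduleE(1)[OF H] in simp_all)

lemma quotient_universal:
  assumes H: "submodule H R M" and f: "mod_hom R M N f" and fH: "\<And>x. x \<in> H \<Longrightarrow> f x = \<zero>\<^bsub>N\<^esub>"
  obtains g where "mod_hom R (quotient_module M H) N g" "\<And>x. x \<in> carrier M \<Longrightarrow> g (H +>\<^bsub>M\<^esub> x) = f x"
proof
  interpret N: Module.module R N using mod_homD(2)[OF f] .
  \<comment> \<open>Any representative gives the same value, since two of them differ by an element
    of \<open>H\<close>, which \<open>f\<close> kills.\<close>
  define g where "g = (\<lambda>X. f (SOME x. x \<in> carrier M \<and> X = H +>\<^bsub>M\<^esub> x))"
  show g: "g (H +>\<^bsub>M\<^esub> x) = f x" if x: "x \<in> carrier M" for x
    unfolding g_def
  proof (rule someI2)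
    show "x \<in> carrier M \<and> H +>\<^bsub>M\<^esub> x = H +>\<^bsub>M\<^esub> x"
      using x by simp
    fix y assume y: "y \<in> carrier M \<and> H +>\<^bsub>M\<^esub> x = H +>\<^bsub>M\<^esub> y"
    then have "y \<in> H +>\<^bsub>M\<^esub> x"
      using abelian_subgroup.a_rcos_self[OF submodule_abelian_subgroup[OF H]] by auto
    then obtain h where h: "h \<in> H" "y = h \<oplus>\<^bsub>M\<^esub> x"
      by (auto simp: a_r_coset_def')
    then have "h \<in> carrier M"
      using submoduleE(1)[OF H] by auto
    then show "f y = f x"
      using mod_homD(3,4)[OF f] x fH[OF h(1)] by (simp add: h(2))
  qed
  show "mod_hom R (quotient_module M H) N g"
    using mod_homD[OF f]
    by (intro mod_homI module_quotient[OF H] N.module_axioms)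
      (auto simp: quotient_carrier quotient_add[OF H] quotient_smult[OF H] g)
qed

end

section \<open>Free modules\<close>

lemma free_module_simps [simp]:
  "\<zero>\<^bsub>free_module R S\<^esub> = (\<lambda>x. \<zero>\<^bsub>R\<^esub>)"
  "f \<oplus>\<^bsub>free_module R S\<^esub> g = (\<lambda>x. f x \<oplus>\<^bsub>R\<^esub> g x)"
  "r \<odot>\<^bsub>free_module R S\<^esub> f = (\<lambda>x. r \<otimes>\<^bsub>R\<^esub> f x)"
  by (simp_all add: free_module_def)

context cring
begin

lemma free_carrier: "f \<in> carrier (free_module R S) \<longleftrightarrow>
    (\<forall>x. f x \<in> carrier R) \<and> finite {x. f x \<noteq> \<zero>} \<and> {x. f x \<noteq> \<zero>} \<subseteq> S"
  by (simp add: free_module_def)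

lemma module_free: "Module.module R (free_module R S)"
proof (intro moduleI abelian_groupI is_cring)
  fix f g assume f: "f \<in> carrier (free_module R S)" and g: "g \<in> carrier (free_module R S)"
  have "{x. f x \<oplus> g x \<noteq> \<zero>} \<subseteq> {x. f x \<noteq> \<zero>} \<union> {x. g x \<noteq> \<zero>}"
    by auto
  with f g show "f \<oplus>\<^bsub>free_module R S\<^esub> g \<in> carrier (free_module R S)"
    unfolding free_carrier by (auto intro: finite_subset)
next
  fix r f assume r: "r \<in> carrier R" and f: "f \<in> carrier (free_module R S)"
  have "{x. r \<otimes> f x \<noteq> \<zero>} \<subseteq> {x. f x \<noteq> \<zero>}"
    using r by auto
  with r f show "r \<odot>\<^bsub>free_module R S\<^esub> f \<in> carrier (free_module R S)"
    unfolding free_carrier by (auto intro: finite_subset)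
next
  fix f assume f: "f \<in> carrier (free_module R S)"
  then have "\<And>x. f x \<in> carrier R"
    by (simp add: free_carrier)
  then have "(\<lambda>x. \<ominus> f x) \<oplus>\<^bsub>free_module R S\<^esub> f = \<zero>\<^bsub>free_module R S\<^esub>"
    and "{x. \<ominus> f x \<noteq> \<zero>} \<subseteq> {x. f x \<noteq> \<zero>}"
    by (auto simp: l_neg)
  with f show "\<exists>g\<in>carrier (free_module R S). g \<oplus>\<^bsub>free_module R S\<^esub> f = \<zero>\<^bsub>free_module R S\<^esub>"
    by (intro bexI[of _ "\<lambda>x. \<ominus> f x"]) (auto simp: free_carrier intro: finite_subset)
qed (auto simp: free_carrier a_ac l_distr r_distr m_assoc fun_eq_iff)

lemma single_closed: "x \<in> S \<Longrightarrow> single R x \<in> carrier (free_module R S)"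
  by (auto simp: free_carrier single_def)

lemma free_span:
  assumes T: "T \<subseteq> S" and f: "f \<in> carrier (free_module R S)" and fT: "{x. f x \<noteq> \<zero>} \<subseteq> T"
  shows "f \<in> submodule_span R (free_module R S) (single R ` T)"
    (is "_ \<in> ?W")
proof -
  interpret F: Module.module R "free_module R S" by (rule module_free)
  have sub: "submodule ?W R (free_module R S)"
    using T by (intro F.span_submodule) (auto intro: single_closed)
  have "f \<in> ?W" if "finite A" "A \<subseteq> T" "f \<in> carrier (free_module R S)" "{x. f x \<noteq> \<zero>} \<subseteq> A" for A f
    using that
  proof (induction A arbitrary: f)
    case empty
    then have "f = \<zero>\<^bsub>free_module R S\<^esub>"
      by auto
    then show ?case
      using F.submodule_zero[OF sub] by (simp only:)
  next
    case (insert x A)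
    \<comment> \<open>Erasing one coefficient reduces the finite bound on the support from
      \<open>insert x A\<close> to \<open>A\<close>.\<close>
    define g where "g = f(x := \<zero>)"
    have fR: "f y \<in> carrier R" for y
      using insert.prems(2) by (simp add: free_carrier)
    have "{y. g y \<noteq> \<zero>} \<subseteq> {y. f y \<noteq> \<zero>}"
      by (auto simp: g_def)
    then have "g \<in> carrier (free_module R S)"
      using insert.prems(2) unfolding free_carrier g_def by (auto intro: finite_subset)
    moreover have "A \<subseteq> T" "{y. g y \<noteq> \<zero>} \<subseteq> A"
      using insert.prems(1,3) by (auto simp: g_def)
    ultimately have "g \<in> ?W"
      using insert.IH by blast
    moreover have "f x \<odot>\<^bsub>free_module R S\<^esub> single R x \<in> ?W"
      using insert.prems(1) fR F.span_superset[of "single R ` T"] by (intro F.submoduleE(4)[OF sub]) auto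
    moreover have "f = g \<oplus>\<^bsub>free_module R S\<^esub> (f x \<odot>\<^bsub>free_module R S\<^esub> single R x)"
      using fR by (auto simp: g_def single_def)
    ultimately show ?case
      using F.submoduleE(5)[OF sub] by metis
  qed
  moreover have "finite {x. f x \<noteq> \<zero>}"
    using f by (simp add: free_carrier)
  ultimately show ?thesis
    using f fT by blast
qed

lemma free_universal:
  assumes N: "Module.module R N" and t: "\<And>x. x \<in> S \<Longrightarrow> t x \<in> carrier N"
  obtains h where "mod_hom R (free_module R S) N h" "\<And>x. x \<in> S \<Longrightarrow> h (single R x) = t x"
proof
  interpret N: Module.module R N by fact
  interpret F: Module.module R "free_module R S" by (rule module_free)
  define h where "h = (\<lambda>f. finsum N (\<lambda>x. f x \<odot>\<^bsub>N\<^esub> t x) {x. f x \<noteq> \<zero>})"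
  \<comment> \<open>The sum may run over any finite subset of \<open>S\<close> that contains the
    support; elements with different supports are compared on a common set.\<close>
  have h: "h f = finsum N (\<lambda>x. f x \<odot>\<^bsub>N\<^esub> t x) A"
    if "f \<in> carrier (free_module R S)" "finite A" "{x. f x \<noteq> \<zero>} \<subseteq> A" "A \<subseteq> S" for f A
    unfolding h_def using that t
    by (intro N.add.finprod_mono_neutral_cong_left[simplified]) (auto simp: free_carrier)
  show "mod_hom R (free_module R S) N h"
  proof (intro mod_homI module_free N)
    fix f assume f: "f \<in> carrier (free_module R S)"
    then show "h f \<in> carrier N"
      unfolding h_def using t by (intro N.finsum_closed) (auto simp: free_carrier)
    fix g assume g: "g \<in> carrier (free_module R S)"
    define A where "A = {x. f x \<noteq> \<zero>} \<union> {x. g x \<noteq> \<zero>}"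
    have A: "finite A" "A \<subseteq> S" "{x. f x \<noteq> \<zero>} \<subseteq> A" "{x. g x \<noteq> \<zero>} \<subseteq> A"
      "{x. (f \<oplus>\<^bsub>free_module R S\<^esub> g) x \<noteq> \<zero>} \<subseteq> A"
      using f g by (auto simp: A_def free_carrier)
    have "h (f \<oplus>\<^bsub>free_module R S\<^esub> g) = finsum N (\<lambda>x. (f x \<oplus> g x) \<odot>\<^bsub>N\<^esub> t x) A"
      using f g A by (subst h[of _ A]) (auto simp del: free_module_simps(2), simp)
    also have "\<dots> = finsum N (\<lambda>x. f x \<odot>\<^bsub>N\<^esub> t x \<oplus>\<^bsub>N\<^esub> g x \<odot>\<^bsub>N\<^esub> t x) A"
      using f g A t by (intro N.finsum_cong') (auto simp: free_carrier N.smult_l_distr)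
    also have "\<dots> = h f \<oplus>\<^bsub>N\<^esub> h g"
      using f g A t by (subst N.finsum_addf) (auto simp: free_carrier h[of f A] h[of g A])
    finally show "h (f \<oplus>\<^bsub>free_module R S\<^esub> g) = h f \<oplus>\<^bsub>N\<^esub> h g" .
  next
    fix r f assume r: "r \<in> carrier R" and f: "f \<in> carrier (free_module R S)"
    define A where "A = {x. f x \<noteq> \<zero>}"
    have A: "finite A" "A \<subseteq> S" "{x. f x \<noteq> \<zero>} \<subseteq> A" "{x. (r \<odot>\<^bsub>free_module R S\<^esub> f) x \<noteq> \<zero>} \<subseteq> A"
      using f r by (auto simp: A_def free_carrier)
    have "h (r \<odot>\<^bsub>free_module R S\<^esub> f) = finsum N (\<lambda>x. (r \<otimes> f x) \<odot>\<^bsub>N\<^esub> t x) A"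
      using f r A F.smult_closed[OF r f] by (subst h[of _ A]) auto
    also have "\<dots> = finsum N (\<lambda>x. r \<odot>\<^bsub>N\<^esub> (f x \<odot>\<^bsub>N\<^esub> t x)) A"
      using f r A t by (intro N.finsum_cong') (auto simp: free_carrier N.smult_assoc1)
    also have "\<dots> = r \<odot>\<^bsub>N\<^esub> h f"
      using f r A t by (subst N.finsum_smult_ldistr[symmetric]) (auto simp: free_carrier h[of f A])
    finally show "h (r \<odot>\<^bsub>free_module R S\<^esub> f) = r \<odot>\<^bsub>N\<^esub> h f" .
  qed
  fix x assume x: "x \<in> S"
  have "h (single R x) = finsum N (\<lambda>y. single R x y \<odot>\<^bsub>N\<^esub> t y) {x}"
    by (intro h single_closed x) (auto simp: single_def x)
  also have "\<dots> = t x"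
    using x t by (simp add: single_def N.finsum_insert)
  finally show "h (single R x) = t x" .
qed

end

section \<open>Tensor products\<close>

locale tensor_product = A: Module.module R A + B: Module.module R B
  for R :: "('r, 'm) ring_scheme" and A :: "('r, 'a) supermodule" and B :: "('r, 'b) supermodule"
begin

abbreviation "F \<equiv> free_module R (carrier A \<times> carrier B)"
abbreviation "T \<equiv> tensor_relations R A B"
abbreviation "AB \<equiv> tensor R A B"
abbreviation "pure \<equiv> pure_tensor R A B"

definition relators :: "('a \<times> 'b \<Rightarrow> 'r) set" where
  "relators = {single R (x \<oplus>\<^bsub>A\<^esub> x', y) \<ominus>\<^bsub>F\<^esub> (single R (x, y) \<oplus>\<^bsub>F\<^esub> single R (x', y)) | x x' y.
            x \<in> carrier A \<and> x' \<in> carrier A \<and> y \<in> carrier B} \<union>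
         {single R (x, y \<oplus>\<^bsub>B\<^esub> y') \<ominus>\<^bsub>F\<^esub> (single R (x, y) \<oplus>\<^bsub>F\<^esub> single R (x, y')) | x y y'.
            x \<in> carrier A \<and> y \<in> carrier B \<and> y' \<in> carrier B} \<union>
         {single R (r \<odot>\<^bsub>A\<^esub> x, y) \<ominus>\<^bsub>F\<^esub> (r \<odot>\<^bsub>F\<^esub> single R (x, y)) | r x y.
            r \<in> carrier R \<and> x \<in> carrier A \<and> y \<in> carrier B} \<union>
         {single R (x, r \<odot>\<^bsub>B\<^esub> y) \<ominus>\<^bsub>F\<^esub> (r \<odot>\<^bsub>F\<^esub> single R (x, y)) | r x y.
            r \<in> carrier R \<and> x \<in> carrier A \<and> y \<in> carrier B}"

lemma T_eq: "T = submodule_span R F relators"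
  by (simp only: tensor_relations_def Let_def relators_def)

sublocale F: Module.module R F
  by (rule A.R.module_free)

lemma single_closed [simp]: "x \<in> carrier A \<Longrightarrow> y \<in> carrier B \<Longrightarrow> single R (x, y) \<in> carrier F"
  by (rule A.R.single_closed) simp

lemma relators_closed: "relators \<subseteq> carrier F"
  by (auto simp: relators_def simp del: free_module_simps)

lemma T_submodule: "submodule T R F"
  unfolding T_eq by (rule F.span_submodule[OF relators_closed])

lemma tensor_simps:
  "carrier AB = carrier (quotient_module F T)" "add AB = add (quotient_module F T)"
  "zero AB = zero (quotient_module F T)" "smult AB = smult (quotient_module F T)"
  by (simp_all add: tensor_def Let_def)

lemma module_tensor: "Module.module R AB"
  by (rule module_transfer[OF F.module_quotient[OF T_submodule]]) (simp_all add: tensor_simps)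

lemma mod_hom_coset: "mod_hom R F AB (\<lambda>x. T +>\<^bsub>F\<^esub> x)"
  using F.mod_hom_quotient[OF T_submodule] module_tensor by (simp add: mod_hom_def tensor_simps)

lemma coset_eqI: "x \<in> carrier F \<Longrightarrow> y \<in> carrier F \<Longrightarrow> x \<ominus>\<^bsub>F\<^esub> y \<in> relators \<Longrightarrow> T +>\<^bsub>F\<^esub> x = T +>\<^bsub>F\<^esub> y"
  using F.span_superset[of relators] unfolding T_eq
  by (intro F.quotient_eqI F.span_submodule relators_closed) auto

lemma pure_closed [simp]: "x \<in> carrier A \<Longrightarrow> y \<in> carrier B \<Longrightarrow> pure x y \<in> carrier AB"
  unfolding pure_tensor_def by (intro mod_homD(3)[OF mod_hom_coset]) simp

lemma pure_left_hom:
  assumes y: "y \<in> carrier B"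
  shows "mod_hom R A AB (\<lambda>x. pure x y)"
proof (intro mod_homI A.module_axioms module_tensor pure_closed y)
  fix x x' assume x: "x \<in> carrier A" "x' \<in> carrier A"
  have "pure (x \<oplus>\<^bsub>A\<^esub> x') y = T +>\<^bsub>F\<^esub> (single R (x, y) \<oplus>\<^bsub>F\<^esub> single R (x', y))"
    unfolding pure_tensor_def using x y
    by (intro coset_eqI A.a_closed F.a_closed single_closed) (auto simp: relators_def simp del: free_module_simps)
  then show "pure (x \<oplus>\<^bsub>A\<^esub> x') y = pure x y \<oplus>\<^bsub>AB\<^esub> pure x' y"
    using x y by (simp only: mod_homD(4)[OF mod_hom_coset] single_closed pure_tensor_def)
next
  fix r x assume r: "r \<in> carrier R" and x: "x \<in> carrier A"
  have "pure (r \<odot>\<^bsub>A\<^esub> x) y = T +>\<^bsub>F\<^esub> (r \<odot>\<^bsub>F\<^esub> single R (x, y))"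
    unfolding pure_tensor_def using x y r
    by (intro coset_eqI A.smult_closed F.smult_closed single_closed) (auto simp: relators_def simp del: free_module_simps)
  then show "pure (r \<odot>\<^bsub>A\<^esub> x) y = r \<odot>\<^bsub>AB\<^esub> pure x y"
    using r x y by (simp only: mod_homD(5)[OF mod_hom_coset] single_closed pure_tensor_def)
qed

lemma pure_right_hom:
  assumes x: "x \<in> carrier A"
  shows "mod_hom R B AB (\<lambda>y. pure x y)"
proof (intro mod_homI B.module_axioms module_tensor pure_closed x)
  fix y y' assume y: "y \<in> carrier B" "y' \<in> carrier B"
  have "pure x (y \<oplus>\<^bsub>B\<^esub> y') = T +>\<^bsub>F\<^esub> (single R (x, y) \<oplus>\<^bsub>F\<^esub> single R (x, y'))"
    unfolding pure_tensor_def using x y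
    by (intro coset_eqI B.a_closed F.a_closed single_closed) (auto simp: relators_def simp del: free_module_simps)
  then show "pure x (y \<oplus>\<^bsub>B\<^esub> y') = pure x y \<oplus>\<^bsub>AB\<^esub> pure x y'"
    using x y by (simp only: mod_homD(4)[OF mod_hom_coset] single_closed pure_tensor_def)
next
  fix r y assume r: "r \<in> carrier R" and y: "y \<in> carrier B"
  have "pure x (r \<odot>\<^bsub>B\<^esub> y) = T +>\<^bsub>F\<^esub> (r \<odot>\<^bsub>F\<^esub> single R (x, y))"
    unfolding pure_tensor_def using x y r
    by (intro coset_eqI B.smult_closed F.smult_closed single_closed) (auto simp: relators_def simp del: free_module_simps)
  then show "pure x (r \<odot>\<^bsub>B\<^esub> y) = r \<odot>\<^bsub>AB\<^esub> pure x y"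
    using r x y by (simp only: mod_homD(5)[OF mod_hom_coset] single_closed pure_tensor_def)
qed

lemma universal:
  assumes f1: "\<And>y. y \<in> carrier B \<Longrightarrow> mod_hom R A N (\<lambda>x. f x y)"
    and f2: "\<And>x. x \<in> carrier A \<Longrightarrow> mod_hom R B N (\<lambda>y. f x y)"
  obtains h where "mod_hom R AB N h"
    "\<And>x y. x \<in> carrier A \<Longrightarrow> y \<in> carrier B \<Longrightarrow> h (pure x y) = f x y"
proof -
  have N: "Module.module R N"
    using f1[OF B.zero_closed] by (rule mod_homD)
  interpret N: Module.module R N by (rule N)
  have fc: "f x y \<in> carrier N" if "x \<in> carrier A" "y \<in> carrier B" for x y
    by (rule mod_homD(3)[OF f1[OF that(2)] that(1)])
  obtain g where g: "mod_hom R F N g"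
    and g_single: "\<And>xy. xy \<in> carrier A \<times> carrier B \<Longrightarrow> g (single R xy) = f (fst xy) (snd xy)"
    by (rule A.R.free_universal[OF N, of "carrier A \<times> carrier B" "\<lambda>xy. f (fst xy) (snd xy)"])
      (auto simp: fc)
  have g_minus: "g (X \<ominus>\<^bsub>F\<^esub> Y) = g X \<oplus>\<^bsub>N\<^esub> \<ominus>\<^bsub>N\<^esub> g Y" if "X \<in> carrier F" "Y \<in> carrier F" for X Y
    using that by (simp only: F.minus_eq mod_homD(4)[OF g] mod_hom_a_inv[OF g] F.a_inv_closed)
  note add = mod_homD(4)[OF f1] mod_homD(4)[OF f2] mod_homD(5)[OF f1] mod_homD(5)[OF f2]
  have "g s = \<zero>\<^bsub>N\<^esub>" if "s \<in> relators" for s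
    using that unfolding relators_def
    by (auto simp del: free_module_simps simp: g_minus mod_homD(4)[OF g] mod_homD(5)[OF g] g_single add fc N.r_neg)
  then have gT: "g s = \<zero>\<^bsub>N\<^esub>" if "s \<in> T" for s
    using that F.mod_hom_eq_on_span[OF g N.mod_hom_zero_map[OF F.module_axioms] relators_closed]
    unfolding T_eq by simp
  obtain h where h: "mod_hom R (quotient_module F T) N h"
    and hg: "\<And>x. x \<in> carrier F \<Longrightarrow> h (T +>\<^bsub>F\<^esub> x) = g x"
    using F.quotient_universal[OF T_submodule g gT] by blast
  show thesis
  proof (rule that)
    show "mod_hom R AB N h"
      using h module_tensor by (simp add: mod_hom_def tensor_simps)
    show "h (pure x y) = f x y" if "x \<in> carrier A" "y \<in> carrier B" for x y
      using that by (simp add: pure_tensor_def hg g_single)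
  qed
qed

lemma span_pure: "submodule_span R AB {pure x y | x y. x \<in> carrier A \<and> y \<in> carrier B} = carrier AB"
  (is "?S = _")
proof -
  interpret AB: Module.module R AB by (rule module_tensor)
  have c: "{pure x y | x y. x \<in> carrier A \<and> y \<in> carrier B} \<subseteq> carrier AB"
    by auto
  have "X \<in> ?S" if X: "X \<in> carrier AB" for X
  proof -
    obtain f where f: "f \<in> carrier F" "X = T +>\<^bsub>F\<^esub> f"
      using X by (auto simp: tensor_simps F.quotient_carrier)
    have "f \<in> submodule_span R F (single R ` (carrier A \<times> carrier B))"
      using f(1) by (intro A.R.free_span) (auto simp: A.R.free_carrier)
    have 1: "T +>\<^bsub>F\<^esub> s \<in> ?S" if "s \<in> single R ` (carrier A \<times> carrier B)" for s
      using that by (intro subsetD[OF AB.span_superset]) (force simp: pure_tensor_def)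
    have "single R ` (carrier A \<times> carrier B) \<subseteq> carrier F"
      by auto
    then show ?thesis
      unfolding f(2) using 1 \<open>f \<in> submodule_span R F _\<close>
      by (rule F.mod_hom_span_into[OF mod_hom_coset AB.span_submodule[OF c]])
  qed
  then show ?thesis
    using AB.span_subset_carrier[OF c] by auto
qed

text \<open>For a fixed left generator the pure tensor is linear in the right factor, which reaches
  all of \<open>B\<close>; then linearity in the left factor reaches all of
  \<open>A\<close>.\<close>

lemma span_pure_gen:
  assumes S: "S \<subseteq> carrier A" "submodule_span R A S = carrier A"
    and S': "S' \<subseteq> carrier B" "submodule_span R B S' = carrier B"
  shows "submodule_span R AB {pure x y | x y. x \<in> S \<and> y \<in> S'} = carrier AB"
    (is "submodule_span R AB ?G = _")
proof -
  interpret AB: Module.module R AB by (rule module_tensor)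
  have G: "?G \<subseteq> carrier AB"
    using S(1) S'(1) pure_closed by blast
  note sub = AB.span_submodule[OF G]
  have 1: "pure x y \<in> submodule_span R AB ?G" if x: "x \<in> S" and y: "y \<in> carrier B" for x y
  proof (rule B.mod_hom_span_into[OF pure_right_hom sub S'(1)])
    show "pure x s \<in> submodule_span R AB ?G" if "s \<in> S'" for s
      using x that by (intro subsetD[OF AB.span_superset]) auto
  qed (use x y S(1) S'(2) in auto)
  have 2: "pure x y \<in> submodule_span R AB ?G" if x: "x \<in> carrier A" and y: "y \<in> carrier B" for x y
    by (rule A.mod_hom_span_into[OF pure_left_hom[OF y] sub S(1)]) (use 1 x y S(2) in auto)
  have "submodule_span R AB {pure x y | x y. x \<in> carrier A \<and> y \<in> carrier B} \<subseteq> submodule_span R AB ?G"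
    using 2 by (intro AB.span_least[OF sub]) auto
  then show ?thesis
    using span_pure AB.span_subset_carrier[OF G] by auto
qed

end

text \<open>Common tool for the maps defined by \<open>THE\<close>: a homomorphism from a universal
  property becomes extensional by restriction, and uniqueness follows once the specification
  \<open>P\<close> fixes the values on generators.\<close>

lemma linear_map_THE:
  assumes h: "mod_hom R M N h" and P: "P (restrict h (carrier M))"
    and S: "S \<subseteq> carrier M" "submodule_span R M S = carrier M"
    and uniq: "\<And>h h' s. linear_map R M N h \<Longrightarrow> linear_map R M N h' \<Longrightarrow> P h \<Longrightarrow> P h' \<Longrightarrow> s \<in> S \<Longrightarrow> h s = h' s"
  shows "\<exists>!h. linear_map R M N h \<and> P h"
    and "mod_hom R M N (THE h. linear_map R M N h \<and> P h)"
    and "P (THE h. linear_map R M N h \<and> P h)"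
proof -
  interpret M: Module.module R M using mod_homD(1)[OF h] .
  note lin = linear_map_iff_mod_hom[OF mod_homD(1,2)[OF h]]
  show *: "\<exists>!h. linear_map R M N h \<and> P h"
  proof (rule ex1I)
    show "linear_map R M N (restrict h (carrier M)) \<and> P (restrict h (carrier M))"
      unfolding lin using P h by (auto intro: mod_hom_cong[OF h])
    fix g assume g: "linear_map R M N g \<and> P g"
    show "g = restrict h (carrier M)"
    proof (rule extensionalityI)
      show "g \<in> extensional (carrier M)"
        using g lin by blast
      have r: "mod_hom R M N (restrict h (carrier M))" and g': "mod_hom R M N g"
        using g \<open>linear_map R M N (restrict h (carrier M)) \<and> P (restrict h (carrier M))\<close> lin by blast+
      have "g s = restrict h (carrier M) s" if "s \<in> S" for s
        using g P \<open>linear_map R M N (restrict h (carrier M)) \<and> P (restrict h (carrier M))\<close> that uniq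
        by blast
      from M.mod_hom_eq_on_span[OF g' r S(1) this] S(2)
      show "g x = restrict h (carrier M) x" if "x \<in> carrier M" for x
        using that by blast
    qed simp
  qed
  from theI'[OF *] show "mod_hom R M N (THE h. linear_map R M N h \<and> P h)"
    "P (THE h. linear_map R M N h \<and> P h)"
    by (auto simp: lin)
qed

lemma (in Module.module) span_carrier: "submodule_span R M (carrier M) = carrier M"
  using span_superset[of "carrier M"] span_subset_carrier[of "carrier M"] by auto

lemma tensor_id:
  assumes f: "mod_hom R A B f" and C: "Module.module R C"
  shows mod_hom_tensor_id: "mod_hom R (tensor R A C) (tensor R B C) (tensor_id R A B C f)"
    and tensor_id_pure: "x \<in> carrier A \<Longrightarrow> y \<in> carrier C \<Longrightarrow>
      tensor_id R A B C f (pure_tensor R A C x y) = pure_tensor R B C (f x) y"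
proof -
  interpret A: Module.module R A using mod_homD(1)[OF f] .
  interpret B: Module.module R B using mod_homD(2)[OF f] .
  interpret C: Module.module R C by fact
  interpret AC: tensor_product R A C ..
  interpret BC: tensor_product R B C ..
  obtain h where h: "mod_hom R AC.AB BC.AB h"
    "\<And>x y. x \<in> carrier A \<Longrightarrow> y \<in> carrier C \<Longrightarrow> h (AC.pure x y) = BC.pure (f x) y"
  proof (rule AC.universal)
    show "mod_hom R A BC.AB (\<lambda>x. BC.pure (f x) y)" if "y \<in> carrier C" for y
      using mod_hom_compose[OF f BC.pure_left_hom[OF that]] .
    show "mod_hom R C BC.AB (\<lambda>y. BC.pure (f x) y)" if "x \<in> carrier A" for x
      using BC.pure_right_hom[OF mod_homD(3)[OF f that]] .
  qed blast
  have gen: "{AC.pure x y | x y. x \<in> carrier A \<and> y \<in> carrier C} \<subseteq> carrier AC.AB"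
    by auto
  let ?P = "\<lambda>h. \<forall>x\<in>carrier A. \<forall>y\<in>carrier C. h (AC.pure x y) = BC.pure (f x) y"
  have P: "?P (restrict h (carrier AC.AB))"
    using h(2) by simp
  note the = linear_map_THE[of R AC.AB BC.AB h ?P, OF h(1) P gen AC.span_pure]
  show "mod_hom R AC.AB BC.AB (tensor_id R A B C f)"
    unfolding tensor_id_def by (rule the(2)) auto
  have "?P (tensor_id R A B C f)"
    unfolding tensor_id_def by (rule the(3)) auto
  then show "tensor_id R A B C f (AC.pure x y) = BC.pure (f x) y" if "x \<in> carrier A" "y \<in> carrier C"
    using that by blast
qed

text \<open>The projections to the homogeneous components are a parameter, because maps with Koszul
  signs have to be given by formulas that are linear on all elements, not only on homogeneous
  ones.\<close>

locale graded_module = Module.module R A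
  for R :: "('r, 'm) ring_scheme" and A :: "('r, 'a) supermodule" +
  fixes proj :: "bit \<Rightarrow> 'a \<Rightarrow> 'a"
  assumes proj_hom: "mod_hom R A A (proj p)"
    and proj_grade: "x \<in> carrier A \<Longrightarrow> proj p x \<in> grade A p"
    and proj_sum: "x \<in> carrier A \<Longrightarrow> proj 0 x \<oplus>\<^bsub>A\<^esub> proj 1 x = x"
    and proj_eq: "x \<in> grade A p \<Longrightarrow> proj q x = (if q = p then x else \<zero>\<^bsub>A\<^esub>)"
    and grade_submodule: "submodule (grade A p) R A"
begin

lemma grade_closed: "x \<in> grade A p \<Longrightarrow> x \<in> carrier A"
  using submoduleE(1)[OF grade_submodule] by blast

lemma proj_closed [simp]: "x \<in> carrier A \<Longrightarrow> proj p x \<in> carrier A"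
  using grade_closed[OF proj_grade] .

lemma supermodule_A: "supermodule R A"
  unfolding supermodule_def
proof (intro conjI allI module_axioms grade_submodule)
  show "grade A 0 <+>\<^bsub>A\<^esub> grade A 1 = carrier A"
  proof (intro equalityI subsetI)
    fix x assume "x \<in> carrier A"
    then show "x \<in> grade A 0 <+>\<^bsub>A\<^esub> grade A 1"
      using proj_sum[of x, symmetric] proj_grade[of x] unfolding set_add_def' by blast
  next
    fix x assume "x \<in> grade A 0 <+>\<^bsub>A\<^esub> grade A 1"
    then show "x \<in> carrier A"
      by (auto simp: set_add_def' grade_closed)
  qed
  have "x = \<zero>\<^bsub>A\<^esub>" if "x \<in> grade A 0" "x \<in> grade A 1" for x
    using proj_eq[OF that(1), of 0] proj_eq[OF that(2), of 0] by simp
  then show "grade A 0 \<inter> grade A 1 = {\<zero>\<^bsub>A\<^esub>}"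
    using submodule_zero[OF grade_submodule] by auto
qed

definition homogeneous :: "'a set" where
  "homogeneous = grade A 0 \<union> grade A 1"

lemma grade_homogeneous: "x \<in> grade A p \<Longrightarrow> x \<in> homogeneous"
  by (cases p) (auto simp: homogeneous_def)

lemma homogeneousE: "x \<in> homogeneous \<Longrightarrow> (\<And>p. x \<in> grade A p \<Longrightarrow> thesis) \<Longrightarrow> thesis"
  by (auto simp: homogeneous_def)

lemma homogeneous_closed: "homogeneous \<subseteq> carrier A"
  by (auto simp: homogeneous_def grade_closed)

lemma homogeneous_span: "submodule_span R A homogeneous = carrier A"
proof -
  note sub = span_submodule[OF homogeneous_closed]
  have "proj 0 x \<oplus>\<^bsub>A\<^esub> proj 1 x \<in> submodule_span R A homogeneous" if "x \<in> carrier A" for x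
    using that span_superset[of homogeneous] grade_homogeneous[OF proj_grade]
    by (intro submoduleE(5)[OF sub]) auto
  then show ?thesis
    using proj_sum submoduleE(1)[OF sub] by auto
qed

text \<open>The sign of moving a homogeneous element of degree \<open>q\<close> past
  \<open>x\<close>, extended linearly to inhomogeneous \<open>x\<close>.\<close>

definition twist :: "bit \<Rightarrow> 'a \<Rightarrow> 'a" where
  "twist q x = proj 0 x \<oplus>\<^bsub>A\<^esub> sgn_pow R q \<odot>\<^bsub>A\<^esub> proj 1 x"

lemma twist_hom: "mod_hom R A A (twist q)"
  unfolding twist_def by (intro mod_hom_add mod_hom_smult proj_hom) (simp add: sgn_pow_def)

lemma twist_eq: "x \<in> grade A p \<Longrightarrow> twist q x = sgn_if A True (p * q) x"
  by (cases p; cases q) (simp_all add: twist_def proj_eq sgn_pow_smult grade_closed)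

lemma twist_closed [simp]: "x \<in> carrier A \<Longrightarrow> twist q x \<in> carrier A"
  by (rule mod_homD(3)[OF twist_hom])

sublocale T2: tensor_product R A A ..

abbreviation "A2 \<equiv> tensor_sq R A"
abbreviation "A3 \<equiv> tensor_cube R A"
abbreviation "pure2 \<equiv> pure_tensor R A A"
abbreviation "pure3 \<equiv> pure_tensor3 R A"

lemma module_A2: "Module.module R A2"
  unfolding tensor_sq_def by (rule T2.module_tensor)

sublocale A2: Module.module R A2
  by (rule module_A2)

sublocale T3: tensor_product R A2 A ..

lemma module_A3: "Module.module R A3"
  unfolding tensor_cube_def by (rule T3.module_tensor)

sublocale A3: Module.module R A3
  by (rule module_A3)

lemma pure2_closed [simp]: "x \<in> carrier A \<Longrightarrow> y \<in> carrier A \<Longrightarrow> pure2 x y \<in> carrier A2"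
  using T2.pure_closed by (simp add: tensor_sq_def)

lemma pure3_closed [simp]:
  "x \<in> carrier A \<Longrightarrow> y \<in> carrier A \<Longrightarrow> z \<in> carrier A \<Longrightarrow> pure3 x y z \<in> carrier A3"
  using T3.pure_closed by (simp add: tensor_cube_def pure_tensor3_def)

lemma pure2_hom:
  "y \<in> carrier A \<Longrightarrow> mod_hom R A A2 (\<lambda>x. pure2 x y)"
  "x \<in> carrier A \<Longrightarrow> mod_hom R A A2 (\<lambda>y. pure2 x y)"
  using T2.pure_left_hom T2.pure_right_hom by (simp_all add: tensor_sq_def)

lemma pure3_hom:
  "y \<in> carrier A \<Longrightarrow> z \<in> carrier A \<Longrightarrow> mod_hom R A A3 (\<lambda>x. pure3 x y z)"
  "x \<in> carrier A \<Longrightarrow> z \<in> carrier A \<Longrightarrow> mod_hom R A A3 (\<lambda>y. pure3 x y z)"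
  "x \<in> carrier A \<Longrightarrow> y \<in> carrier A \<Longrightarrow> mod_hom R A A3 (\<lambda>z. pure3 x y z)"
  using mod_hom_compose[OF pure2_hom(1) T3.pure_left_hom] mod_hom_compose[OF pure2_hom(2) T3.pure_left_hom]
    T3.pure_right_hom by (simp_all add: tensor_cube_def pure_tensor3_def)

lemma span_pure2:
  assumes "S \<subseteq> carrier A" "submodule_span R A S = carrier A"
  shows "{pure2 x y | x y. x \<in> S \<and> y \<in> S} \<subseteq> carrier A2"
    and "submodule_span R A2 {pure2 x y | x y. x \<in> S \<and> y \<in> S} = carrier A2"
  using T2.span_pure_gen[OF assms assms] assms(1) pure2_closed unfolding tensor_sq_def by blast+

lemma span_pure3:
  assumes S: "S \<subseteq> carrier A" "submodule_span R A S = carrier A"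
  shows "{pure3 x y z | x y z. x \<in> S \<and> y \<in> S \<and> z \<in> S} \<subseteq> carrier A3"
    and "submodule_span R A3 {pure3 x y z | x y z. x \<in> S \<and> y \<in> S \<and> z \<in> S} = carrier A3"
proof -
  show "{pure3 x y z | x y z. x \<in> S \<and> y \<in> S \<and> z \<in> S} \<subseteq> carrier A3"
    using S(1) pure3_closed by blast
  have "{pure3 x y z | x y z. x \<in> S \<and> y \<in> S \<and> z \<in> S} =
      {pure_tensor R A2 A X z | X z. X \<in> {pure2 x y | x y. x \<in> S \<and> y \<in> S} \<and> z \<in> S}"
    unfolding pure_tensor3_def by blast
  then show "submodule_span R A3 {pure3 x y z | x y z. x \<in> S \<and> y \<in> S \<and> z \<in> S} = carrier A3"
    using T3.span_pure_gen[OF span_pure2[OF S] S] by (simp only: tensor_cube_def)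
qed

lemma universal2:
  assumes "\<And>y. y \<in> carrier A \<Longrightarrow> mod_hom R A N (\<lambda>x. f x y)"
    and "\<And>x. x \<in> carrier A \<Longrightarrow> mod_hom R A N (\<lambda>y. f x y)"
  obtains h where "mod_hom R A2 N h" "\<And>x y. x \<in> carrier A \<Longrightarrow> y \<in> carrier A \<Longrightarrow> h (pure2 x y) = f x y"
  using T2.universal[of N f] assms unfolding tensor_sq_def by blast

text \<open>The binary universal property is used twice: for fixed \<open>z\<close> it gives a map
  \<open>H z\<close> on the tensor square. This map depends linearly on \<open>z\<close>, because it
  is determined by its values on pure tensors.\<close>

lemma universal3:
  assumes f1: "\<And>y z. y \<in> carrier A \<Longrightarrow> z \<in> carrier A \<Longrightarrow> mod_hom R A N (\<lambda>x. f x y z)"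
    and f2: "\<And>x z. x \<in> carrier A \<Longrightarrow> z \<in> carrier A \<Longrightarrow> mod_hom R A N (\<lambda>y. f x y z)"
    and f3: "\<And>x y. x \<in> carrier A \<Longrightarrow> y \<in> carrier A \<Longrightarrow> mod_hom R A N (\<lambda>z. f x y z)"
  obtains h where "mod_hom R A3 N h"
    "\<And>x y z. x \<in> carrier A \<Longrightarrow> y \<in> carrier A \<Longrightarrow> z \<in> carrier A \<Longrightarrow> h (pure3 x y z) = f x y z"
proof -
  interpret N: Module.module R N
    using mod_homD(2)[OF f1[OF M.zero_closed M.zero_closed]] .
  have "\<exists>h. mod_hom R A2 N h \<and> (\<forall>x\<in>carrier A. \<forall>y\<in>carrier A. h (pure2 x y) = f x y z)"
    if z: "z \<in> carrier A" for z
    by (rule universal2[OF f1[OF _ z] f2[OF _ z]]) blast+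
  then have "\<exists>H. \<forall>z\<in>carrier A. mod_hom R A2 N (H z) \<and>
      (\<forall>x\<in>carrier A. \<forall>y\<in>carrier A. H z (pure2 x y) = f x y z)"
    by (intro bchoice ballI)
  then obtain H where H': "\<forall>z\<in>carrier A. mod_hom R A2 N (H z) \<and>
      (\<forall>x\<in>carrier A. \<forall>y\<in>carrier A. H z (pure2 x y) = f x y z)" ..
  have H: "mod_hom R A2 N (H z)" if "z \<in> carrier A" for z
    using H' that by blast
  have H_pure: "H z (pure2 x y) = f x y z" if "z \<in> carrier A" "x \<in> carrier A" "y \<in> carrier A" for x y z
    using H' that by blast
  note gen = span_pure2[OF subset_refl span_carrier]
  have H_eqI: "H z X = g X"
    if "z \<in> carrier A" "mod_hom R A2 N g" "X \<in> carrier A2"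
      "\<And>x y. x \<in> carrier A \<Longrightarrow> y \<in> carrier A \<Longrightarrow> f x y z = g (pure2 x y)" for z g X
  proof (rule A2.mod_hom_eq_on_span[OF H[OF that(1)] that(2) gen(1)])
    show "H z s = g s" if "s \<in> {pure2 x y | x y. x \<in> carrier A \<and> y \<in> carrier A}" for s
      using that \<open>z \<in> carrier A\<close> by (auto simp: H_pure \<open>\<And>x y. _ \<Longrightarrow> _ \<Longrightarrow> f x y z = g (pure2 x y)\<close>)
  qed (use that gen(2) in simp)
  have H2: "mod_hom R A N (\<lambda>z. H z X)" if X: "X \<in> carrier A2" for X
  proof (intro mod_homI module_axioms N.module_axioms)
    show "H z X \<in> carrier N" if "z \<in> carrier A" for z
      using mod_homD(3)[OF H[OF that] X] .
    show "H (z \<oplus>\<^bsub>A\<^esub> z') X = H z X \<oplus>\<^bsub>N\<^esub> H z' X" if "z \<in> carrier A" "z' \<in> carrier A" for z z'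
      using that X mod_homD(4)[OF f3] by (intro H_eqI N.mod_hom_add H) (auto simp: H_pure)
    show "H (r \<odot>\<^bsub>A\<^esub> z) X = r \<odot>\<^bsub>N\<^esub> H z X" if "r \<in> carrier R" "z \<in> carrier A" for r z
      using that X mod_homD(5)[OF f3] by (intro H_eqI N.mod_hom_smult H) (auto simp: H_pure)
  qed
  obtain h where "mod_hom R T3.AB N h" "\<And>X z. X \<in> carrier A2 \<Longrightarrow> z \<in> carrier A \<Longrightarrow> h (T3.pure X z) = H z X"
    by (rule T3.universal[OF H H2]) blast+
  then show thesis
    using that[of h] H_pure by (simp add: tensor_cube_def pure_tensor3_def)
qed

lemma koszul_swap:
  shows swap_hom: "mod_hom R A2 A2 (koszul_swap R A A)"
    and swap_pure: "x \<in> grade A p \<Longrightarrow> y \<in> grade A q \<Longrightarrow>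
      koszul_swap R A A (pure2 x y) = sgn_if A2 True (p * q) (pure2 y x)"
proof -
  let ?P = "\<lambda>h. \<forall>p q. \<forall>x\<in>grade A p. \<forall>y\<in>grade A q.
    h (pure2 x y) = sgn_pow R (p * q) \<odot>\<^bsub>A2\<^esub> pure2 y x"
  \<comment> \<open>A bilinear formula for the swap without case distinction on degrees: only the
    odd component of \<open>x\<close> produces a sign, and \<open>twist 1\<close> supplies it from
    the degree of \<open>y\<close>.\<close>
  obtain h where h: "mod_hom R A2 A2 h" "\<And>x y. x \<in> carrier A \<Longrightarrow> y \<in> carrier A \<Longrightarrow>
      h (pure2 x y) = pure2 y (proj 0 x) \<oplus>\<^bsub>A2\<^esub> pure2 (twist 1 y) (proj 1 x)"
  proof (rule universal2)
    show "mod_hom R A A2 (\<lambda>x. pure2 y (proj 0 x) \<oplus>\<^bsub>A2\<^esub> pure2 (twist 1 y) (proj 1 x))" if "y \<in> carrier A" for y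
      using that by (intro A2.mod_hom_add mod_hom_compose[OF proj_hom] pure2_hom twist_closed)
    show "mod_hom R A A2 (\<lambda>y. pure2 y (proj 0 x) \<oplus>\<^bsub>A2\<^esub> pure2 (twist 1 y) (proj 1 x))" if "x \<in> carrier A" for x
      using that by (intro A2.mod_hom_add pure2_hom mod_hom_compose[OF twist_hom pure2_hom(1)] proj_closed)
  qed blast
  have P: "?P (restrict h (carrier A2))"
  proof (intro allI ballI)
    fix p q x y assume xy: "x \<in> grade A p" "y \<in> grade A q"
    then show "restrict h (carrier A2) (pure2 x y) = sgn_pow R (p * q) \<odot>\<^bsub>A2\<^esub> pure2 y x"
      using mod_hom_zero[OF pure2_hom(2)] mod_hom_sgn_if[OF pure2_hom(1)]
      by (cases p) (simp_all add: h(2) grade_closed proj_eq twist_eq A2.sgn_pow_smult)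
  qed
  note gen = span_pure2[OF homogeneous_closed homogeneous_span]
  note the = linear_map_THE[of R A2 A2 h ?P, OF h(1) P gen]
  show "mod_hom R A2 A2 (koszul_swap R A A)"
    unfolding koszul_swap_def tensor_sq_def[symmetric]
    by (rule the(2)) (auto elim!: homogeneousE)
  have "?P (koszul_swap R A A)"
    unfolding koszul_swap_def tensor_sq_def[symmetric]
    by (rule the(3)) (auto elim!: homogeneousE)
  then show "koszul_swap R A A (pure2 x y) = sgn_if A2 True (p * q) (pure2 y x)"
    if "x \<in> grade A p" "y \<in> grade A q"
    using that by (simp add: A2.sgn_pow_smult grade_closed)
qed

lemma id_tensor_swap:
  shows id_swap_hom: "mod_hom R A3 A3 (id_tensor_swap R A)"
    and id_swap_pure: "x \<in> carrier A \<Longrightarrow> y \<in> grade A p \<Longrightarrow> z \<in> grade A q \<Longrightarrow>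
      id_tensor_swap R A (pure3 x y z) = sgn_if A3 True (p * q) (pure3 x z y)"
proof -
  let ?P = "\<lambda>h. \<forall>p q. \<forall>x\<in>carrier A. \<forall>y\<in>grade A p. \<forall>z\<in>grade A q.
    h (pure3 x y z) = sgn_pow R (p * q) \<odot>\<^bsub>A3\<^esub> pure3 x z y"
  obtain h where h: "mod_hom R A3 A3 h"
    "\<And>x y z. x \<in> carrier A \<Longrightarrow> y \<in> carrier A \<Longrightarrow> z \<in> carrier A \<Longrightarrow>
      h (pure3 x y z) = pure3 x z (proj 0 y) \<oplus>\<^bsub>A3\<^esub> pure3 x (twist 1 z) (proj 1 y)"
  proof (rule universal3[where N = A3 and
      f = "\<lambda>x y z. pure3 x z (proj 0 y) \<oplus>\<^bsub>A3\<^esub> pure3 x (twist 1 z) (proj 1 y)"])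
    show "mod_hom R A A3 (\<lambda>x. pure3 x z (proj 0 y) \<oplus>\<^bsub>A3\<^esub> pure3 x (twist 1 z) (proj 1 y))"
      if "y \<in> carrier A" "z \<in> carrier A" for y z
      using that by (intro A3.mod_hom_add pure3_hom twist_closed proj_closed)
    show "mod_hom R A A3 (\<lambda>y. pure3 x z (proj 0 y) \<oplus>\<^bsub>A3\<^esub> pure3 x (twist 1 z) (proj 1 y))"
      if "x \<in> carrier A" "z \<in> carrier A" for x z
      using that by (intro A3.mod_hom_add mod_hom_compose[OF proj_hom] pure3_hom twist_closed)
    show "mod_hom R A A3 (\<lambda>z. pure3 x z (proj 0 y) \<oplus>\<^bsub>A3\<^esub> pure3 x (twist 1 z) (proj 1 y))"
      if "x \<in> carrier A" "y \<in> carrier A" for x y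
      using that by (intro A3.mod_hom_add pure3_hom mod_hom_compose[OF twist_hom pure3_hom(2)] proj_closed)
  qed blast
  have P: "?P (restrict h (carrier A3))"
  proof (intro allI ballI)
    fix p q x y z assume xyz: "x \<in> carrier A" "y \<in> grade A p" "z \<in> grade A q"
    then show "restrict h (carrier A3) (pure3 x y z) = sgn_pow R (p * q) \<odot>\<^bsub>A3\<^esub> pure3 x z y"
      using mod_hom_zero[OF pure3_hom(3)] mod_hom_sgn_if[OF pure3_hom(2)]
      by (cases p) (simp_all add: h(2) grade_closed proj_eq twist_eq A3.sgn_pow_smult)
  qed
  note gen = span_pure3[OF homogeneous_closed homogeneous_span]
  note the = linear_map_THE[of R A3 A3 h ?P, OF h(1) P gen]
  have uniq: "h s = h' s" if "?P h" "?P h'" "s \<in> {pure3 x y z | x y z. x \<in> homogeneous \<and> y \<in> homogeneous \<and> z \<in> homogeneous}" for h h' s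
    using that homogeneous_closed by (auto elim!: homogeneousE simp: grade_closed)
  show "mod_hom R A3 A3 (id_tensor_swap R A)"
    unfolding id_tensor_swap_def by (rule the(2)) (rule uniq)
  have "?P (id_tensor_swap R A)"
    unfolding id_tensor_swap_def by (rule the(3)) (rule uniq)
  then show "id_tensor_swap R A (pure3 x y z) = sgn_if A3 True (p * q) (pure3 x z y)"
    if "x \<in> carrier A" "y \<in> grade A p" "z \<in> grade A q"
    using that by (simp add: A3.sgn_pow_smult grade_closed)
qed

lemma koszul_rot:
  shows rot_hom: "mod_hom R A3 A3 (koszul_rot R A)"
    and rot_pure: "x \<in> grade A p \<Longrightarrow> y \<in> grade A q \<Longrightarrow> z \<in> grade A r \<Longrightarrow>
      koszul_rot R A (pure3 x y z) = sgn_if A3 True ((p + q) * r) (pure3 z x y)"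
proof -
  let ?P = "\<lambda>h. \<forall>p q r. \<forall>x\<in>grade A p. \<forall>y\<in>grade A q. \<forall>z\<in>grade A r.
    h (pure3 x y z) = sgn_pow R ((p + q) * r) \<odot>\<^bsub>A3\<^esub> pure3 z x y"
  obtain h where h: "mod_hom R A3 A3 h"
    "\<And>x y z. x \<in> carrier A \<Longrightarrow> y \<in> carrier A \<Longrightarrow> z \<in> carrier A \<Longrightarrow>
      h (pure3 x y z) = pure3 (proj 0 z) x y \<oplus>\<^bsub>A3\<^esub> pure3 (proj 1 z) (twist 1 x) (twist 1 y)"
  proof (rule universal3[where N = A3 and
      f = "\<lambda>x y z. pure3 (proj 0 z) x y \<oplus>\<^bsub>A3\<^esub> pure3 (proj 1 z) (twist 1 x) (twist 1 y)"])
    show "mod_hom R A A3 (\<lambda>x. pure3 (proj 0 z) x y \<oplus>\<^bsub>A3\<^esub> pure3 (proj 1 z) (twist 1 x) (twist 1 y))"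
      if "y \<in> carrier A" "z \<in> carrier A" for y z
      using that by (intro A3.mod_hom_add pure3_hom mod_hom_compose[OF twist_hom pure3_hom(2)] twist_closed proj_closed)
    show "mod_hom R A A3 (\<lambda>y. pure3 (proj 0 z) x y \<oplus>\<^bsub>A3\<^esub> pure3 (proj 1 z) (twist 1 x) (twist 1 y))"
      if "x \<in> carrier A" "z \<in> carrier A" for x z
      using that by (intro A3.mod_hom_add pure3_hom mod_hom_compose[OF twist_hom pure3_hom(3)] twist_closed proj_closed)
    show "mod_hom R A A3 (\<lambda>z. pure3 (proj 0 z) x y \<oplus>\<^bsub>A3\<^esub> pure3 (proj 1 z) (twist 1 x) (twist 1 y))"
      if "x \<in> carrier A" "y \<in> carrier A" for x y
      using that by (intro A3.mod_hom_add mod_hom_compose[OF proj_hom] pure3_hom twist_closed)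
  qed blast
  have P: "?P (restrict h (carrier A3))"
  proof (intro allI ballI)
    fix p q r x y z assume xyz: "x \<in> grade A p" "y \<in> grade A q" "z \<in> grade A r"
    then show "restrict h (carrier A3) (pure3 x y z) = sgn_pow R ((p + q) * r) \<odot>\<^bsub>A3\<^esub> pure3 z x y"
      using mod_hom_zero[OF pure3_hom(1)] mod_hom_sgn_if[OF pure3_hom(2)] mod_hom_sgn_if[OF pure3_hom(3)]
      by (cases r) (simp_all add: h(2) grade_closed proj_eq twist_eq A3.sgn_pow_smult add.commute)
  qed
  note gen = span_pure3[OF homogeneous_closed homogeneous_span]
  note the = linear_map_THE[of R A3 A3 h ?P, OF h(1) P gen]
  show "mod_hom R A3 A3 (koszul_rot R A)"
    unfolding koszul_rot_def by (rule the(2)) (auto elim!: homogeneousE)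
  have "?P (koszul_rot R A)"
    unfolding koszul_rot_def by (rule the(3)) (auto elim!: homogeneousE)
  then show "koszul_rot R A (pure3 x y z) = sgn_if A3 True ((p + q) * r) (pure3 z x y)"
    if "x \<in> grade A p" "y \<in> grade A q" "z \<in> grade A r"
    using that by (simp add: A3.sgn_pow_smult grade_closed)
qed

lemma sym2_hom: "mod_hom R A2 A2 (sym2 R A)"
  unfolding sym2_def by (intro A2.mod_hom_add A2.mod_hom_id swap_hom)

lemma cyc3_hom: "mod_hom R A3 A3 (cyc3 R A)"
  unfolding cyc3_def
  by (intro A3.mod_hom_add A3.mod_hom_id rot_hom mod_hom_compose[OF rot_hom rot_hom])

lemma cyc3_pure:
  assumes "x \<in> grade A p" "y \<in> grade A q" "z \<in> grade A r"
  shows "cyc3 R A (pure3 x y z) = pure3 x y z \<oplus>\<^bsub>A3\<^esub>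
    sgn_if A3 True ((p + q) * r) (pure3 z x y) \<oplus>\<^bsub>A3\<^esub> sgn_if A3 True (p * (q + r)) (pure3 y z x)"
proof -
  have "koszul_rot R A (koszul_rot R A (pure3 x y z)) = sgn_if A3 True (p * (q + r)) (pure3 y z x)"
    using assms by (simp add: rot_pure mod_hom_sgn_if[OF rot_hom] grade_closed bit_simps)
  then show ?thesis
    using assms by (simp add: cyc3_def rot_pure)
qed

text \<open>A rotation permutes the three summands of the cyclic sum. This provides the hypothesis
  \<open>rot\<close> of \<open>cobr_cojacobi\<close>.\<close>

lemma cyc3_rot:
  assumes "x \<in> grade A p" "y \<in> grade A q" "z \<in> grade A r"
  shows "cyc3 R A (pure3 x y z) = sgn_if A3 True ((p + q) * r) (cyc3 R A (pure3 z x y))"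
  using assms by (simp add: cyc3_pure grade_closed A3.sgn_if_add bit_simps A3.a_ac)

text \<open>In the definition of \<open>tensor\<close> the span is formed in the ungraded quotient.
  That quotient and the graded module share all fields on which the notion of a submodule
  depends.\<close>

lemma grade_A2: "grade A2 d = submodule_span R A2 {pure2 x y | x y p q. x \<in> grade A p \<and> y \<in> grade A q \<and> p + q = d}"
proof -
  have "submodule_span R (quotient_module T2.F T2.T) S = submodule_span R A2 S" for S
  proof -
    have "submodule H R (quotient_module T2.F T2.T) \<longleftrightarrow> submodule H R A2" for H
      by (simp add: submodule_def submodule_axioms_def subgroup_def tensor_sq_def T2.tensor_simps
          m_inv_def)
    then show ?thesis
      by (simp add: submodule_span_def)
  qed
  moreover have "grade A2 d = submodule_span R (quotient_module T2.F T2.T)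
      {pure2 x y | x y p q. x \<in> grade A p \<and> y \<in> grade A q \<and> p + q = d}"
    by (simp only: tensor_sq_def tensor_def Let_def with_grading_simps)
  ultimately show ?thesis
    by (simp only:)
qed

end

section \<open>The module of cyclic paths\<close>

locale path_setting = R: cring R + Q: fin_digraph Q
  for R :: "('r, 'm) ring_scheme" and Q :: "('v, 'e) pre_digraph"
begin

abbreviation "P \<equiv> path_superalgebra R Q"
abbreviation "K \<equiv> graded_commutators R P"
abbreviation "N \<equiv> N_gr R Q"
abbreviation "F \<equiv> free_module R (paths Q)"

lemma P_simps:
  "carrier P = carrier F" "add P = add F" "zero P = zero F" "smult P = smult F"
  "grade P p = {f \<in> carrier F. \<forall>u w. f (u, w) \<noteq> \<zero>\<^bsub>R\<^esub> \<longrightarrow> deg w = p}"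
  by (simp_all add: path_superalgebra_def)

lemma P_mult: "(f \<otimes>\<^bsub>P\<^esub> g) (u, w) =
    (\<Oplus>\<^bsub>R\<^esub>k\<in>{..length w}. f (u, take k w) \<otimes>\<^bsub>R\<^esub> g (path_end Q (u, take k w), drop k w))"
  by (simp add: path_superalgebra_def)

lemma module_P: "Module.module R P"
  by (rule module_transfer[OF R.module_free]) (simp_all only: P_simps)

sublocale P: Module.module R P
  by (rule module_P)

lemma single_closed [simp]: "x \<in> paths Q \<Longrightarrow> single R x \<in> carrier P"
  by (simp add: P_simps R.single_closed)

lemma coeff_closed: "f \<in> carrier P \<Longrightarrow> f x \<in> carrier R"
  unfolding P_simps R.free_carrier by blast

lemma path_end_walk: "walk Q p w q \<Longrightarrow> path_end Q (p, w) = q"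
  by (induction w rule: rev_induct)
    (auto simp: path_end_def Q.walk_append_iff Q.walk_Cons_iff Q.walk_Nil_iff)

lemma paths_iff: "(p, w) \<in> paths Q \<longleftrightarrow> walk Q p w (path_end Q (p, w))"
  using path_end_walk by (auto simp: paths_def)

lemma walk_paths: "walk Q p w q \<Longrightarrow> (p, w) \<in> paths Q"
  by (auto simp: paths_def)

lemma mult_closed [simp]:
  assumes f: "f \<in> carrier P" and g: "g \<in> carrier P"
  shows "f \<otimes>\<^bsub>P\<^esub> g \<in> carrier P"
proof -
  have fR: "f x \<in> carrier R" and gR: "g x \<in> carrier R" for x
    using f g by (simp_all add: coeff_closed)
  \<comment> \<open>Every path in the support of the product is a concatenation of paths in the two
    supports; this makes the support finite and keeps it inside \<open>paths Q\<close>.\<close>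
  let ?S = "(\<lambda>(x, y). (fst x, snd x @ snd y)) `
      {(x, y). f x \<noteq> \<zero>\<^bsub>R\<^esub> \<and> g y \<noteq> \<zero>\<^bsub>R\<^esub> \<and> path_end Q x = fst y}"
  have "(u, w) \<in> ?S" if nz: "(f \<otimes>\<^bsub>P\<^esub> g) (u, w) \<noteq> \<zero>\<^bsub>R\<^esub>" for u w
  proof -
    obtain k where "f (u, take k w) \<otimes>\<^bsub>R\<^esub> g (path_end Q (u, take k w), drop k w) \<noteq> \<zero>\<^bsub>R\<^esub>"
      using nz R.add.finprod_one_eqI[of "{..length w}"
        "\<lambda>k. f (u, take k w) \<otimes>\<^bsub>R\<^esub> g (path_end Q (u, take k w), drop k w)"]
      unfolding P_mult by auto
    then have "f (u, take k w) \<noteq> \<zero>\<^bsub>R\<^esub>" "g (path_end Q (u, take k w), drop k w) \<noteq> \<zero>\<^bsub>R\<^esub>"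
      using fR gR by auto
    then show ?thesis
      by (intro image_eqI[of _ _ "((u, take k w), (path_end Q (u, take k w), drop k w))"]) auto
  qed
  then have S: "{x. (f \<otimes>\<^bsub>P\<^esub> g) x \<noteq> \<zero>\<^bsub>R\<^esub>} \<subseteq> ?S"
    by auto
  have "finite ({x. f x \<noteq> \<zero>\<^bsub>R\<^esub>} \<times> {y. g y \<noteq> \<zero>\<^bsub>R\<^esub>})"
    using f g by (simp add: P_simps R.free_carrier)
  then have "finite ?S"
    by (rule finite_surj[of _ _ "\<lambda>(x, y). (fst x, snd x @ snd y)"]) auto
  moreover have "?S \<subseteq> paths Q"
  proof
    fix z assume "z \<in> ?S"
    then obtain u w1 v w2 where "z = (u, w1 @ w2)" "f (u, w1) \<noteq> \<zero>\<^bsub>R\<^esub>" "g (v, w2) \<noteq> \<zero>\<^bsub>R\<^esub>" "path_end Q (u, w1) = v"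
      by auto
    then have "walk Q u w1 v" "walk Q v w2 (path_end Q (v, w2))" "z = (u, w1 @ w2)"
      using f g paths_iff by (auto simp: P_simps R.free_carrier)
    then show "z \<in> paths Q"
      using Q.walk_append walk_paths by blast
  qed
  moreover have "(f \<otimes>\<^bsub>P\<^esub> g) x \<in> carrier R" for x
    using fR gR by (cases x) (auto simp: P_mult intro!: R.finsum_closed)
  ultimately show ?thesis
    using S finite_subset[OF S] by (auto simp: P_simps R.free_carrier)
qed

lemma mult_left_hom:
  assumes g: "g \<in> carrier P"
  shows "mod_hom R P P (\<lambda>f. f \<otimes>\<^bsub>P\<^esub> g)"
proof (intro mod_homI module_P mult_closed g)
  show "(f \<oplus>\<^bsub>P\<^esub> f') \<otimes>\<^bsub>P\<^esub> g = f \<otimes>\<^bsub>P\<^esub> g \<oplus>\<^bsub>P\<^esub> f' \<otimes>\<^bsub>P\<^esub> g"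
    if "f \<in> carrier P" "f' \<in> carrier P" for f f'
    using that[THEN coeff_closed] coeff_closed[OF g]
    by (simp add: fun_eq_iff P_mult P_simps R.l_distr R.finsum_addf Pi_def)
  show "(r \<odot>\<^bsub>P\<^esub> f) \<otimes>\<^bsub>P\<^esub> g = r \<odot>\<^bsub>P\<^esub> (f \<otimes>\<^bsub>P\<^esub> g)"
    if "r \<in> carrier R" "f \<in> carrier P" for r f
    using that(1) coeff_closed[OF that(2)] coeff_closed[OF g]
    by (simp add: fun_eq_iff P_mult P_simps R.m_assoc R.finsum_rdistr Pi_def)
qed

lemma mult_right_hom:
  assumes f: "f \<in> carrier P"
  shows "mod_hom R P P (\<lambda>g. f \<otimes>\<^bsub>P\<^esub> g)"
proof (intro mod_homI module_P mult_closed f)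
  show "f \<otimes>\<^bsub>P\<^esub> (g \<oplus>\<^bsub>P\<^esub> g') = f \<otimes>\<^bsub>P\<^esub> g \<oplus>\<^bsub>P\<^esub> f \<otimes>\<^bsub>P\<^esub> g'"
    if "g \<in> carrier P" "g' \<in> carrier P" for g g'
    using that[THEN coeff_closed] coeff_closed[OF f]
    by (simp add: fun_eq_iff P_mult P_simps R.r_distr R.finsum_addf Pi_def)
  show "f \<otimes>\<^bsub>P\<^esub> (r \<odot>\<^bsub>P\<^esub> g) = r \<odot>\<^bsub>P\<^esub> (f \<otimes>\<^bsub>P\<^esub> g)"
    if "r \<in> carrier R" "g \<in> carrier P" for r g
    using that(1) coeff_closed[OF that(2)] coeff_closed[OF f]
    by (simp add: fun_eq_iff P_mult P_simps R.m_lcomm R.finsum_rdistr Pi_def)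
qed

lemma single_mult:
  "single R (u, w1) \<otimes>\<^bsub>P\<^esub> single R (v, w2) =
    (if path_end Q (u, w1) = v then single R (u, w1 @ w2) else \<zero>\<^bsub>P\<^esub>)"
proof
  fix x :: "('v, 'e) path"
  obtain u' w where x: "x = (u', w)"
    by (cases x)
  let ?t = "\<lambda>k. single R (u, w1) (u', take k w) \<otimes>\<^bsub>R\<^esub> single R (v, w2) (path_end Q (u', take k w), drop k w)"
  show "(single R (u, w1) \<otimes>\<^bsub>P\<^esub> single R (v, w2)) x =
      (if path_end Q (u, w1) = v then single R (u, w1 @ w2) else \<zero>\<^bsub>P\<^esub>) x"
  proof (cases "path_end Q (u, w1) = v \<and> u' = u \<and> w = w1 @ w2")
    case True
    have "take k (w1 @ w2) = w1 \<longleftrightarrow> length w1 = k" if "k \<le> length w1 + length w2" for k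
      using that by (auto dest: arg_cong[of _ w1 length])
    moreover have td: "take (length w1) (w1 @ w2) = w1" "drop (length w1) (w1 @ w2) = w2"
      by simp_all
    ultimately have "finsum R ?t {..length w} = finsum R (\<lambda>k. if length w1 = k then \<one>\<^bsub>R\<^esub> else \<zero>\<^bsub>R\<^esub>) {..length w}"
      using True by (intro R.finsum_cong') (auto simp: single_def td simp del: take_append drop_append)
    also have "\<dots> = \<one>\<^bsub>R\<^esub>"
      using True by (intro R.finsum_singleton[of _ _ "\<lambda>_. \<one>\<^bsub>R\<^esub>"]) auto
    finally show ?thesis
      using True by (simp add: x P_mult single_def)
  next
    case False
    have "?t k = \<zero>\<^bsub>R\<^esub>" for k
      using False append_take_drop_id[of k w] by (auto simp: single_def)
    then have "finsum R ?t {..length w} = \<zero>\<^bsub>R\<^esub>"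
      by (simp add: R.finsum_zero)
    then show ?thesis
      using False by (auto simp: x P_mult single_def P_simps)
  qed
qed

lemma grade_P_submodule: "submodule (grade P p) R P"
proof (rule P.submoduleI)
  show "grade P p \<subseteq> carrier P" "\<zero>\<^bsub>P\<^esub> \<in> grade P p"
    using P.zero_closed by (auto simp: P_simps)
  show add: "f \<oplus>\<^bsub>P\<^esub> g \<in> grade P p" if "f \<in> grade P p" "g \<in> grade P p" for f g
    using that P.a_closed[of f g] by (auto simp: P_simps) (metis R.l_zero R.zero_closed)
  show smult: "r \<odot>\<^bsub>P\<^esub> f \<in> grade P p" if "r \<in> carrier R" "f \<in> grade P p" for r f
    using that P.smult_closed[of r f] by (auto simp: P_simps) (metis R.r_null)
  show "\<ominus>\<^bsub>P\<^esub> f \<in> grade P p" if "f \<in> grade P p" for f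
  proof -
    have "f \<in> carrier P"
      using that by (simp add: P_simps)
    then have "\<ominus>\<^bsub>P\<^esub> f = (\<ominus>\<^bsub>R\<^esub> \<one>\<^bsub>R\<^esub>) \<odot>\<^bsub>P\<^esub> f"
      by (simp add: P.smult_l_minus)
    then show ?thesis
      using smult[of "\<ominus>\<^bsub>R\<^esub> \<one>\<^bsub>R\<^esub>" f] that by simp
  qed
qed

lemma grade_P_closed: "f \<in> grade P p \<Longrightarrow> f \<in> carrier P"
  by (simp add: P_simps)

lemma submodule_span_P: "submodule_span R P S = submodule_span R F S"
proof -
  have "submodule H R P \<longleftrightarrow> submodule H R F" for H
    by (simp add: submodule_def submodule_axioms_def subgroup_def P_simps m_inv_def)
  then show ?thesis
    by (simp only: submodule_span_def)
qed

lemma grade_P_span: "f \<in> grade P p \<Longrightarrow> f \<in> submodule_span R P (single R ` {(u, w) \<in> paths Q. deg w = p})"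
  unfolding submodule_span_P by (rule R.free_span) (auto simp: P_simps R.free_carrier)

lemma carrier_P_span: "f \<in> carrier P \<Longrightarrow> f \<in> submodule_span R P (single R ` paths Q)"
  unfolding submodule_span_P by (rule R.free_span) (auto simp: P_simps R.free_carrier)

lemma single_grade: "(u, w) \<in> paths Q \<Longrightarrow> single R (u, w) \<in> grade P (deg w)"
  using single_closed[of "(u, w)"] by (auto simp: P_simps) (auto simp: single_def split: if_splits)


definition commutators :: "(('v, 'e) path \<Rightarrow> 'r) set" where
  "commutators = {x \<otimes>\<^bsub>P\<^esub> y \<ominus>\<^bsub>P\<^esub> (sgn_pow R (p * q) \<odot>\<^bsub>P\<^esub> (y \<otimes>\<^bsub>P\<^esub> x)) | x y p q.
          x \<in> grade P p \<and> y \<in> grade P q}"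

lemma K_eq: "K = submodule_span R P commutators"
  by (simp only: graded_commutators_def commutators_def)

lemma sgn_pow_closed [simp]: "sgn_pow R e \<in> carrier R"
  by (simp add: sgn_pow_def)

lemma commutators_closed: "commutators \<subseteq> carrier P"
  unfolding commutators_def
  by (auto intro!: P.minus_closed P.smult_closed mult_closed dest: grade_P_closed)

lemma K_submodule: "submodule K R P"
  unfolding K_eq by (rule P.span_submodule[OF commutators_closed])

lemma N_simps:
  "carrier N = carrier (quotient_module P K)" "add N = add (quotient_module P K)"
  "zero N = zero (quotient_module P K)" "smult N = smult (quotient_module P K)"
  "grade N p = (\<lambda>x. K +>\<^bsub>P\<^esub> x) ` grade P p"
  by (simp_all add: N_gr_def quotient_supermodule_def Let_def)

lemma module_N: "Module.module R N"
  by (rule module_transfer[OF P.module_quotient[OF K_submodule]]) (simp_all only: N_simps)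

sublocale N: Module.module R N
  by (rule module_N)

lemma coset_hom: "mod_hom R P N (\<lambda>x. K +>\<^bsub>P\<^esub> x)"
  using P.mod_hom_quotient[OF K_submodule] module_N by (simp add: mod_hom_def N_simps)

lemma path_class_eq: "path_class R Q x = K +>\<^bsub>P\<^esub> single R x"
  by (simp only: path_class_def Let_def)

lemma path_class_closed [simp]: "x \<in> paths Q \<Longrightarrow> path_class R Q x \<in> carrier N"
  unfolding path_class_eq by (rule mod_homD(3)[OF coset_hom]) simp

lemma coset_commute:
  assumes "x \<in> grade P p" "y \<in> grade P q"
  shows "K +>\<^bsub>P\<^esub> (x \<otimes>\<^bsub>P\<^esub> y) = sgn_if N True (p * q) (K +>\<^bsub>P\<^esub> (y \<otimes>\<^bsub>P\<^esub> x))"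
proof -
  have c: "x \<otimes>\<^bsub>P\<^esub> y \<in> carrier P" "y \<otimes>\<^bsub>P\<^esub> x \<in> carrier P"
    using assms by (simp_all add: grade_P_closed)
  have "x \<otimes>\<^bsub>P\<^esub> y \<ominus>\<^bsub>P\<^esub> (sgn_pow R (p * q) \<odot>\<^bsub>P\<^esub> (y \<otimes>\<^bsub>P\<^esub> x)) \<in> K"
    unfolding K_eq using assms by (intro subsetD[OF P.span_superset]) (auto simp: commutators_def)
  then have "K +>\<^bsub>P\<^esub> (x \<otimes>\<^bsub>P\<^esub> y) = K +>\<^bsub>P\<^esub> (sgn_pow R (p * q) \<odot>\<^bsub>P\<^esub> (y \<otimes>\<^bsub>P\<^esub> x))"
    using c by (intro P.quotient_eqI K_submodule P.smult_closed sgn_pow_closed)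
  also have "\<dots> = sgn_if N True (p * q) (K +>\<^bsub>P\<^esub> (y \<otimes>\<^bsub>P\<^esub> x))"
    using c mod_homD(3)[OF coset_hom c(2)]
    by (simp add: mod_homD(5)[OF coset_hom] N.sgn_pow_smult)
  finally show ?thesis .
qed

text \<open>Zero away from closed walks, so that every argument gives an element of
  \<open>N\<close>, whereas \<open>path_class\<close> of a word that is no path need not lie
  there.\<close>

definition tclass :: "'v \<Rightarrow> 'e word \<Rightarrow> (('v, 'e) path \<Rightarrow> 'r) set" where
  "tclass p w = (if walk Q p w p then path_class R Q (p, w) else \<zero>\<^bsub>N\<^esub>)"

lemma tclass_closed [simp]: "tclass p w \<in> carrier N"
  using walk_paths by (auto simp: tclass_def)

text \<open>For an open path the commutator with the constant path at its source is the path itself,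
  since the product in the other order vanishes.\<close>

lemma path_class_tclass:
  assumes "(p, w) \<in> paths Q"
  shows "path_class R Q (p, w) = tclass p w"
proof (cases "walk Q p w p")
  case False
  obtain q where q: "walk Q p w q"
    using assms by (auto simp: paths_def)
  then have pq: "q \<noteq> p" "path_end Q (p, w) = q"
    using False path_end_walk by auto
  have e: "(p, []) \<in> paths Q"
    using wf_digraph.awalk_hd_in_verts[OF Q.wf_double q] by (auto simp: paths_def Q.walk_Nil_iff)
  note coset_commute[OF single_grade[OF e] single_grade[OF assms]]
  moreover have "path_end Q (p, []) = p"
    by (simp add: path_end_def)
  ultimately show ?thesis
    using pq False mod_hom_zero[OF coset_hom]
    by (simp add: single_mult tclass_def path_class_eq)
qed (simp add: tclass_def)

lemma tclass_cyclic: "cyclic_fun N Q tclass"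
  unfolding cyclic_fun_def
proof (intro conjI allI impI tclass_closed)
  fix p q u v assume uv: "walk Q p u q" "walk Q q v p"
  then have "walk Q p (u @ v) p" "walk Q q (v @ u) q"
    using Q.walk_append by blast+
  moreover have "(p, u) \<in> paths Q" "(q, v) \<in> paths Q" "path_end Q (p, u) = q" "path_end Q (q, v) = p"
    using uv walk_paths path_end_walk by blast+
  ultimately show "tclass p (u @ v) = sgn_if N True (deg u * deg v) (tclass q (v @ u))"
    using coset_commute[OF single_grade single_grade, of p u q v]
    by (simp add: tclass_def path_class_eq single_mult)
qed

definition tclasses :: "(('v, 'e) path \<Rightarrow> 'r) set set" where
  "tclasses = {tclass p w | p w. walk Q p w p}"

lemma tclasses_closed: "tclasses \<subseteq> carrier N"
  by (auto simp: tclasses_def)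

lemma tclass_tclasses: "walk Q p w p \<Longrightarrow> tclass p w \<in> tclasses"
  by (auto simp: tclasses_def)

lemma tclass_span:
  assumes "walk Q p w p \<Longrightarrow> tclass p w \<in> S" "S \<subseteq> carrier N"
  shows "tclass p w \<in> submodule_span R N S"
  using assms N.span_superset[of S] N.submodule_zero[OF N.span_submodule[OF assms(2)]]
  by (cases "walk Q p w p") (auto simp: tclass_def)

lemma tclasses_span: "submodule_span R N tclasses = carrier N"
proof -
  have "X \<in> submodule_span R N tclasses" if X: "X \<in> carrier N" for X
  proof -
    obtain f where f: "f \<in> carrier P" "X = K +>\<^bsub>P\<^esub> f"
      using X by (auto simp: N_simps P.quotient_carrier)
    show ?thesis
      unfolding f(2)
    proof (rule P.mod_hom_span_into[OF coset_hom N.span_submodule[OF tclasses_closed]])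
      show "f \<in> submodule_span R P (single R ` paths Q)"
        by (rule carrier_P_span[OF f(1)])
      show "K +>\<^bsub>P\<^esub> s \<in> submodule_span R N tclasses" if "s \<in> single R ` paths Q" for s
        using that path_class_tclass tclass_span[OF tclass_tclasses tclasses_closed]
        by (auto simp: path_class_eq[symmetric])
    qed auto
  qed
  then show ?thesis
    using N.span_subset_carrier[OF tclasses_closed] by auto
qed

text \<open>The map is defined on the free module by \<open>t\<close> on closed paths and zero on
  open ones. That it kills commutators is a bilinear condition and is checked on pairs of paths:
  either both products are closed and rotations of each other, or both are sent to zero.\<close>

lemma N_universal:
  assumes M: "Module.module R M" and t: "cyclic_fun M Q t"
  obtains h where "mod_hom R N M h" "\<And>p w. walk Q p w p \<Longrightarrow> h (tclass p w) = t p w"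
proof -
  interpret M: Module.module R M by (rule M)
  define t' where "t' = (\<lambda>(p, w). if walk Q p w p then t p w else \<zero>\<^bsub>M\<^esub>)"
  have tc: "t p w \<in> carrier M" for p w
    using cyclic_fun_closed[OF t] .
  obtain g where g0: "mod_hom R F M g" and g_single: "\<And>x. x \<in> paths Q \<Longrightarrow> g (single R x) = t' x"
    by (rule R.free_universal[OF M, of "paths Q" t']) (auto simp: t'_def tc)
  have g: "mod_hom R P M g"
    using g0 module_P by (simp add: mod_hom_def P_simps)
  have g_mult: "g (single R (p, u) \<otimes>\<^bsub>P\<^esub> single R (q, v)) =
      (if path_end Q (p, u) = q \<and> path_end Q (q, v) = p then t p (u @ v) else \<zero>\<^bsub>M\<^esub>)"
    if "(p, u) \<in> paths Q" "(q, v) \<in> paths Q" for p u q v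
  proof (cases "path_end Q (p, u) = q")
    case True
    then have w: "walk Q p (u @ v) (path_end Q (q, v))"
      using that paths_iff Q.walk_append by metis
    then have "walk Q p (u @ v) p \<longleftrightarrow> path_end Q (q, v) = p"
      using path_end_walk by metis
    then show ?thesis
      using True walk_paths[OF w] by (simp add: single_mult g_single t'_def)
  qed (simp add: single_mult mod_hom_zero[OF g])
  have comm_single: "g (single R (p, u) \<otimes>\<^bsub>P\<^esub> single R (q, v)) =
      sgn_if M True (deg u * deg v) (g (single R (q, v) \<otimes>\<^bsub>P\<^esub> single R (p, u)))"
    if "(p, u) \<in> paths Q" "(q, v) \<in> paths Q" for p u q v
    unfolding g_mult[OF that] g_mult[OF that(2,1)]
    using that paths_iff cyclic_funD[OF t, of p u q v] by auto
  have comm1: "g (x \<otimes>\<^bsub>P\<^esub> single R (q, v)) = sgn_pow R (d * deg v) \<odot>\<^bsub>M\<^esub> g (single R (q, v) \<otimes>\<^bsub>P\<^esub> x)"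
    if x: "x \<in> grade P d" and qv: "(q, v) \<in> paths Q" for x d q v
  proof (rule P.mod_hom_eq_on_span[OF _ _ _ _ grade_P_span[OF x]])
    show "mod_hom R P M (\<lambda>x. g (x \<otimes>\<^bsub>P\<^esub> single R (q, v)))"
      using qv by (intro mod_hom_compose[OF mult_left_hom g]) simp
    show "mod_hom R P M (\<lambda>x. sgn_pow R (d * deg v) \<odot>\<^bsub>M\<^esub> g (single R (q, v) \<otimes>\<^bsub>P\<^esub> x))"
      using qv by (intro M.mod_hom_smult mod_hom_compose[OF mult_right_hom g]) simp_all
    show "g (s \<otimes>\<^bsub>P\<^esub> single R (q, v)) = sgn_pow R (d * deg v) \<odot>\<^bsub>M\<^esub> g (single R (q, v) \<otimes>\<^bsub>P\<^esub> s)"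
      if "s \<in> single R ` {(u, w) \<in> paths Q. deg w = d}" for s
      using that comm_single[OF _ qv] mod_homD(3)[OF g] qv by (auto simp: M.sgn_pow_smult)
  qed auto
  have comm2: "g (x \<otimes>\<^bsub>P\<^esub> y) = sgn_pow R (d * e) \<odot>\<^bsub>M\<^esub> g (y \<otimes>\<^bsub>P\<^esub> x)"
    if x: "x \<in> grade P d" and y: "y \<in> grade P e" for x y d e
  proof (rule P.mod_hom_eq_on_span[OF _ _ _ _ grade_P_span[OF y]])
    show "mod_hom R P M (\<lambda>y. g (x \<otimes>\<^bsub>P\<^esub> y))"
      using grade_P_closed[OF x] by (intro mod_hom_compose[OF mult_right_hom g])
    show "mod_hom R P M (\<lambda>y. sgn_pow R (d * e) \<odot>\<^bsub>M\<^esub> g (y \<otimes>\<^bsub>P\<^esub> x))"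
      using grade_P_closed[OF x] by (intro M.mod_hom_smult mod_hom_compose[OF mult_left_hom g]) simp_all
    show "g (x \<otimes>\<^bsub>P\<^esub> s) = sgn_pow R (d * e) \<odot>\<^bsub>M\<^esub> g (s \<otimes>\<^bsub>P\<^esub> x)"
      if "s \<in> single R ` {(u, w) \<in> paths Q. deg w = e}" for s
      using that comm1[OF x] by auto
  qed auto
  have g_minus: "g (X \<ominus>\<^bsub>P\<^esub> Y) = g X \<oplus>\<^bsub>M\<^esub> \<ominus>\<^bsub>M\<^esub> g Y" if "X \<in> carrier P" "Y \<in> carrier P" for X Y
    using that by (simp only: P.minus_eq mod_homD(4)[OF g] mod_hom_a_inv[OF g] P.a_inv_closed)
  have "g s = \<zero>\<^bsub>M\<^esub>" if s_comm: "s \<in> commutators" for s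
  proof -
    obtain x y d e where xy: "x \<in> grade P d" "y \<in> grade P e"
      and s: "s = x \<otimes>\<^bsub>P\<^esub> y \<ominus>\<^bsub>P\<^esub> (sgn_pow R (d * e) \<odot>\<^bsub>P\<^esub> (y \<otimes>\<^bsub>P\<^esub> x))"
      using s_comm unfolding commutators_def by blast
    have c: "x \<otimes>\<^bsub>P\<^esub> y \<in> carrier P" "y \<otimes>\<^bsub>P\<^esub> x \<in> carrier P"
      using xy by (simp_all add: grade_P_closed)
    have "g s = g (x \<otimes>\<^bsub>P\<^esub> y) \<oplus>\<^bsub>M\<^esub> \<ominus>\<^bsub>M\<^esub> (sgn_pow R (d * e) \<odot>\<^bsub>M\<^esub> g (y \<otimes>\<^bsub>P\<^esub> x))"
      unfolding s using c by (simp add: g_minus mod_homD(5)[OF g])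
    then show ?thesis
      using mod_homD(3)[OF g c(1)] unfolding comm2[OF xy, symmetric] by (simp add: M.r_neg)
  qed
  then have gK: "g s = \<zero>\<^bsub>M\<^esub>" if "s \<in> K" for s
    using that P.mod_hom_eq_on_span[OF g M.mod_hom_zero_map[OF P.module_axioms] commutators_closed]
    unfolding K_eq by simp
  obtain h where h: "mod_hom R (quotient_module P K) M h"
    and hg: "\<And>x. x \<in> carrier P \<Longrightarrow> h (K +>\<^bsub>P\<^esub> x) = g x"
    using P.quotient_universal[OF K_submodule g gK] by blast
  show thesis
  proof (rule that)
    show "mod_hom R N M h"
      using h module_N by (simp add: mod_hom_def N_simps)
    show "h (tclass p w) = t p w" if "walk Q p w p" for p w
      using that by (simp add: tclass_def path_class_eq hg walk_paths g_single t'_def)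
  qed
qed

end

section \<open>Linear maps and submodules applied to sums over cuts\<close>

lemma mod_hom_cuts:
  assumes h: "mod_hom R M N h" and F: "\<And>u x v. F u x v \<in> carrier M"
  shows "h (cuts M pm w F) = cuts N pm w (\<lambda>u x v. h (F u x v))"
proof -
  interpret M: Module.module R M using mod_homD(1)[OF h] .
  show ?thesis
    using F by (induction w arbitrary: F) (simp_all add: mod_hom_zero[OF h] mod_homD(4)[OF h])
qed

lemma mod_hom_cyc_cuts:
  assumes h: "mod_hom R M N h" and F: "\<And>x v. F x v \<in> carrier M"
  shows "h (cyc_cuts M pm w F) = cyc_cuts N pm w (\<lambda>x v. h (F x v))"
proof -
  interpret M: Module.module R M using mod_homD(1)[OF h] .
  show ?thesis
    using F by (simp add: cyc_cuts_def mod_hom_cuts[OF h] mod_hom_sgn_if[OF h])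
qed

lemma mod_hom_br_sum:
  assumes h: "mod_hom R M N h" and t: "\<And>p w. t p w \<in> carrier M"
  shows "h (br_sum M Q pm t a b) = br_sum N Q pm (\<lambda>p w. h (t p w)) a b"
proof -
  interpret M: Module.module R M using mod_homD(1)[OF h] .
  show ?thesis
    using t by (simp add: br_sum_def mod_hom_cyc_cuts[OF h] mod_hom_sgn_if[OF h])
qed

lemma mod_hom_cobr_sum:
  assumes h: "mod_hom R M N h" and s: "\<And>p u q v. s p u q v \<in> carrier M"
  shows "h (cobr_sum M Q pm s a) = cobr_sum N Q pm (\<lambda>p u q v. h (s p u q v)) a"
proof -
  interpret M: Module.module R M using mod_homD(1)[OF h] .
  show ?thesis
    using s by (simp add: cobr_sum_def mod_hom_cyc_cuts[OF h] mod_hom_cuts[OF h] mod_hom_sgn_if[OF h])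
qed

lemma (in Module.module) mod_hom_scale: "r \<in> carrier R \<Longrightarrow> mod_hom R M M (\<lambda>x. r \<odot>\<^bsub>M\<^esub> x)"
  by (rule mod_hom_smult[OF mod_hom_id])

lemma not_paired_self [simp]: "\<not> paired x x"
  by (auto simp: paired_def)

lemma sgn_if_cong: "P = P' \<Longrightarrow> (P' \<Longrightarrow> e = e') \<Longrightarrow> (P' \<Longrightarrow> m = m') \<Longrightarrow> sgn_if M P e m = sgn_if M P' e' m'"
  by (auto simp: sgn_if_def)

context surgery
begin

text \<open>Besides closedness the hypothesis records the degree of the joined word: a surgery along
  paired letters removes an odd amount modulo 2. The oddness of the bracket is read off from
  this.\<close>

lemma br_cong:
  assumes a: "walk Q p a p" and b: "walk Q q b q"
    and t: "\<And>p w. walk Q p w p \<Longrightarrow> deg w = deg a + deg b + 1 \<Longrightarrow> t p w = t' p w"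
  shows "br t a b = br t' a b"
  unfolding br_sum_def
  by (rule cyc_cong[OF a], rule cyc_cong[OF b], rule sgn_if_cong[OF refl refl], rule t)
    (auto intro: Q.walk_append dest!: pairedD simp: bit_simps)

lemma cobr_cong:
  assumes a: "walk Q p a p"
    and s: "\<And>p u q v. walk Q p u p \<Longrightarrow> walk Q q v q \<Longrightarrow> deg u + deg v = deg a + 1 \<Longrightarrow> s p u q v = s' p u q v"
  shows "cobr s a = cobr s' a"
  unfolding cobr_sum_def
  by (rule cyc_cong[OF a], rule cut_cong, assumption, rule sgn_if_cong[OF refl refl], rule s)
    (auto dest!: pairedD simp: bit_simps)

end

context Module.module
begin

lemma cuts_submodule:
  "submodule H R M \<Longrightarrow> (\<And>u x v. F u x v \<in> H) \<Longrightarrow> cuts M pm w F \<in> H"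
  by (induction w arbitrary: F) (auto intro: submodule_zero submoduleE(5))

lemma sgn_if_submodule: "submodule H R M \<Longrightarrow> m \<in> H \<Longrightarrow> sgn_if M P e m \<in> H"
  by (auto simp: sgn_if_def intro: submodule_zero submoduleE(3))

lemma br_sum_submodule:
  "submodule H R M \<Longrightarrow> (\<And>p w. t p w \<in> H) \<Longrightarrow> br_sum M Q pm t a b \<in> H"
  unfolding br_sum_def cyc_cuts_def by (intro cuts_submodule sgn_if_submodule)

lemma cobr_sum_submodule:
  "submodule H R M \<Longrightarrow> (\<And>p u q v. s p u q v \<in> H) \<Longrightarrow> cobr_sum M Q pm s a \<in> H"
  unfolding cobr_sum_def cyc_cuts_def by (intro cuts_submodule sgn_if_submodule)

end

section \<open>Sums over cuts as sums over pairs of positions\<close>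

lemma rotate_Suc_drop_take: "i < length w \<Longrightarrow> rotate (Suc i) w = drop (Suc i) w @ take (Suc i) w"
  by (cases "Suc i = length w") (auto simp: rotate_drop_take)

lemma between_same: "i < length w \<Longrightarrow> between w i i = drop (Suc i) w @ take i w"
  by (simp add: between_def rotate_Suc_drop_take del: rotate_Suc)

lemma between_less: "i < j \<Longrightarrow> j < length w \<Longrightarrow> between w i j = take (j - Suc i) (drop (Suc i) w)"
proof -
  assume "i < j" "j < length w"
  then have "(length w + j - Suc i) mod length w = j - Suc i"
    using mod_add_self1[of "length w" "j - Suc i"] by simp
  then show ?thesis
    using \<open>i < j\<close> \<open>j < length w\<close> by (simp add: between_def rotate_Suc_drop_take del: rotate_Suc)
qed

lemma between_greater: "j < i \<Longrightarrow> i < length w \<Longrightarrow> between w i j = drop (Suc i) w @ take j w"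
  by (simp add: between_def rotate_Suc_drop_take min_def del: rotate_Suc)

context abelian_group
begin

lemma sgn_if_finsum:
  assumes "finite A" "\<And>i. i \<in> A \<Longrightarrow> f i \<in> carrier G"
  shows "sgn_if G P e (finsum G f A) = finsum G (\<lambda>i. sgn_if G P e (f i)) A"
  using assms by (induction A) (auto simp: sgn_if_add finsum_insert Pi_def)

lemma finsum_lessThan_Suc:
  assumes "\<And>i. f i \<in> carrier G"
  shows "finsum G f {..<Suc n} = f 0 \<oplus> finsum G (\<lambda>i. f (Suc i)) {..<n}"
proof -
  have "finsum G f {..<Suc n} = f 0 \<oplus> finsum G f (Suc ` {..<n})"
    unfolding lessThan_Suc_eq_insert_0 using assms by (intro finsum_insert) auto
  also have "finsum G f (Suc ` {..<n}) = finsum G (\<lambda>i. f (Suc i)) {..<n}"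
    using assms by (intro finsum_reindex) auto
  finally show ?thesis .
qed

lemma cuts_finsum:
  assumes "\<And>u x v. F u x v \<in> carrier G"
  shows "cuts G pm w F = finsum G (\<lambda>i. F (take i w @ residue pm (w ! i)) (w ! i)
    (residue pm (w ! i) @ drop (Suc i) w)) {..<length w}"
  using assms
proof (induction w arbitrary: F)
  case (Cons x w)
  then show ?case
    by (simp add: finsum_lessThan_Suc)
qed simp

lemma cyc_cuts_finsum:
  assumes "\<And>x v. F x v \<in> carrier G"
  shows "cyc_cuts G pm w F = finsum G (\<lambda>i. sgn_if G True
      ((deg (take i w) + deg (residue pm (w ! i))) *
        (arrow_deg (w ! i) + (deg (residue pm (w ! i)) + deg (drop (Suc i) w))))
      (F (w ! i) (residue pm (w ! i) @ between w i i @ residue pm (w ! i)))) {..<length w}"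
  unfolding cyc_cuts_def using assms
  by (subst cuts_finsum) (auto intro!: finsum_cong' simp: between_same)

lemma finsum_pairs:
  assumes c: "\<And>i j. g i j \<in> carrier G"
  shows "finsum G (\<lambda>i. finsum G (\<lambda>j. sgn_if G (p i j) (e i j) (g i j)) {..<n::nat}) {..<m::nat} =
    finsum G (\<lambda>(i, j). sgn_if G True (e i j) (g i j)) {(i, j). i < m \<and> j < n \<and> p i j}"
proof -
  define h where "h = (\<lambda>(i, j). sgn_if G (p i j) (e i j) (g i j))"
  have hc: "h x \<in> carrier G" for x
    using c by (cases x) (simp add: h_def)
  have "finsum G h (\<Union>i\<in>{..<m}. Pair i ` {..<n}) = finsum G (\<lambda>i. finsum G h (Pair i ` {..<n})) {..<m}"
    using hc by (intro add.finprod_UN_disjoint[simplified]) (auto simp: pairwise_def disjnt_def)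
  also have "\<dots> = finsum G (\<lambda>i. finsum G (\<lambda>j. h (i, j)) {..<n}) {..<m}"
    using hc by (intro finsum_cong' refl finsum_reindex) (auto intro!: finsum_closed simp: inj_on_def)
  finally have "finsum G (\<lambda>i. finsum G (\<lambda>j. h (i, j)) {..<n}) {..<m} =
      finsum G h (\<Union>i\<in>{..<m}. Pair i ` {..<n})" ..
  also have "\<dots> = finsum G (\<lambda>(i, j). sgn_if G True (e i j) (g i j)) {(i, j). i < m \<and> j < n \<and> p i j}"
  proof (rule add.finprod_mono_neutral_cong_right[simplified])
    show "finite (\<Union>i\<in>{..<m}. Pair i ` {..<n})" "h \<in> (\<Union>i\<in>{..<m}. Pair i ` {..<n}) \<rightarrow> carrier G"
      using hc by auto
  qed (auto simp: h_def image_iff sgn_if_def split: if_splits)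
  finally show ?thesis
    by (simp add: h_def)
qed

lemma br_sum_finsum:
  assumes t: "\<And>p w. t p w \<in> carrier G"
  shows "br_sum G Q pm t a b = finsum G (\<lambda>(i, j). sgn_if G True
      ((deg (take i a) + deg (residue pm (a ! i))) *
         (arrow_deg (a ! i) + (deg (residue pm (a ! i)) + deg (drop (Suc i) a))) +
       (deg (take j b) + deg (residue pm (b ! j))) *
         (arrow_deg (b ! j) + (deg (residue pm (b ! j)) + deg (drop (Suc j) b))) +
       deg (between a i i) * arrow_deg (b ! j))
      (t (start pm Q (a ! i)) ((residue pm (a ! i) @ between a i i @ residue pm (a ! i)) @
        (residue pm (b ! j) @ between b j j @ residue pm (b ! j))))) (paired_positions a b)"
  unfolding br_sum_def paired_positions_def
  by (simp add: t cyc_cuts_finsum sgn_if_finsum)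
    (subst finsum_pairs, auto intro!: finsum_cong' simp: t bit_simps)

text \<open>After a cut at \<open>i\<close> the remaining open word meets the positions
  \<open>i + 1\<close>, ..., \<open>length a - 1\<close>, \<open>0\<close>, ...,
  \<open>i - 1\<close>. The retained copies of \<open>a ! i\<close> at its ends contribute nothing
  because no letter is paired with itself, and for the same reason \<open>j = i\<close> may be added
  to the index set.\<close>

lemma cuts_between:
  assumes f: "\<And>u y v. f u y v \<in> carrier G" and i: "i < length a"
  shows "cuts G pm (residue pm (a ! i) @ between a i i @ residue pm (a ! i))
      (\<lambda>u y v. sgn_if G (paired (a ! i) y) (e u y v) (f u y v)) =
    finsum G (\<lambda>j.
      let u = residue pm (a ! i) @ between a i j @ residue pm (a ! j);
          v = residue pm (a ! j) @ between a j i @ residue pm (a ! i)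
      in sgn_if G (paired (a ! i) (a ! j)) (e u (a ! j) v) (f u (a ! j) v)) {..<length a}"
    (is "_ = finsum G ?h _")
proof -
  have res: "cuts G pm (residue pm (a ! i)) (\<lambda>u y v. sgn_if G (paired (a ! i) y) (e' u y v) (f' u y v)) = \<zero>"
    for e' f'
    by (cases pm) (auto simp: residue_def)
  have hc: "?h j \<in> carrier G" for j
    using f by (simp add: Let_def)
  have "cuts G pm (residue pm (a ! i) @ between a i i @ residue pm (a ! i))
      (\<lambda>u y v. sgn_if G (paired (a ! i) y) (e u y v) (f u y v)) =
    finsum G (\<lambda>k. ?h (Suc i + k)) {..<length a - Suc i} \<oplus> finsum G ?h {..<i}"
    using f i
    by (simp add: between_same cuts_append res)
      (auto intro!: arg_cong2[where f = "(\<oplus>)"] finsum_cong'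
        simp: cuts_finsum Let_def between_less between_greater add.commute drop_take)
  also have "finsum G (\<lambda>k. ?h (Suc i + k)) {..<length a - Suc i} = finsum G ?h {Suc i..<length a}"
  proof -
    have "(+) (Suc i) ` {..<length a - Suc i} = {Suc i..<length a}"
      using image_add_atLeastLessThan[of "Suc i" 0 "length a - Suc i"] i
      by (cases a) (simp_all add: lessThan_atLeast0)
    then show ?thesis
      using finsum_reindex[of ?h "(+) (Suc i)" "{..<length a - Suc i}"] hc by simp
  qed
  also have "finsum G ?h {Suc i..<length a} \<oplus> finsum G ?h {..<i} = finsum G ?h ({Suc i..<length a} \<union> {..<i})"
    using hc by (intro finsum_Un_disjoint[symmetric]) auto
  also have "\<dots> = finsum G ?h {..<length a}"
    using hc i
    by (intro add.finprod_mono_neutral_cong_left[simplified]) (auto simp: not_less le_eq_less_or_eq)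
  finally show ?thesis .
qed

lemma cobr_sum_finsum:
  assumes s: "\<And>p u q v. s p u q v \<in> carrier G"
  shows "cobr_sum G Q pm s a = finsum G (\<lambda>(i, j). sgn_if G True
      ((deg (take i a) + deg (residue pm (a ! i))) *
         (arrow_deg (a ! i) + (deg (residue pm (a ! i)) + deg (drop (Suc i) a))) +
       (deg (residue pm (a ! i)) + deg (between a i j) + deg (residue pm (a ! j))) * arrow_deg (a ! j))
      (s (start pm Q (a ! i)) (residue pm (a ! i) @ between a i j @ residue pm (a ! j))
        (start pm Q (a ! j)) (residue pm (a ! j) @ between a j i @ residue pm (a ! i))))
      (paired_positions a a)"
proof -
  have "cobr_sum G Q pm s a = finsum G (\<lambda>i. finsum G (\<lambda>j. sgn_if G (paired (a ! i) (a ! j))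
      ((deg (take i a) + deg (residue pm (a ! i))) *
         (arrow_deg (a ! i) + (deg (residue pm (a ! i)) + deg (drop (Suc i) a))) +
       (deg (residue pm (a ! i)) + deg (between a i j) + deg (residue pm (a ! j))) * arrow_deg (a ! j))
      (s (start pm Q (a ! i)) (residue pm (a ! i) @ between a i j @ residue pm (a ! j))
        (start pm Q (a ! j)) (residue pm (a ! j) @ between a j i @ residue pm (a ! i)))) {..<length a}) {..<length a}"
    unfolding cobr_sum_def
    by (subst cyc_cuts_finsum)
      (auto intro!: finsum_cong' simp: s cuts_between Let_def sgn_if_finsum add.assoc)
  then show ?thesis
    by (simp add: finsum_pairs s paired_positions_def)
qed

end

lemma cyclic_fun_compose:
  assumes h: "mod_hom R M N h" and t: "cyclic_fun M Q t"
  shows "cyclic_fun N Q (\<lambda>p w. h (t p w))"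
  unfolding cyclic_fun_def
proof (intro conjI allI impI)
  show "h (t p w) \<in> carrier N" for p w
    using mod_homD(3)[OF h cyclic_fun_closed[OF t]] .
  show "h (t p (u @ v)) = sgn_if N True (deg u * deg v) (h (t q (v @ u)))"
    if "walk Q p u q" "walk Q q v p" for p q u v
    unfolding cyclic_funD[OF t that] by (rule mod_hom_sgn_if[OF h cyclic_fun_closed[OF t]])
qed

section \<open>The grading of the quotient and classes in its tensor powers\<close>

context path_setting
begin

lemma tclass_grade: "tclass p w \<in> grade N (deg w)"
proof (cases "walk Q p w p")
  case True
  then show ?thesis
    using single_grade[OF walk_paths[OF True]] by (simp add: tclass_def path_class_eq N_simps)
next
  case False
  have "\<zero>\<^bsub>N\<^esub> = K +>\<^bsub>P\<^esub> \<zero>\<^bsub>P\<^esub>"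
    using mod_hom_zero[OF coset_hom] ..
  then show ?thesis
    using False P.submodule_zero[OF grade_P_submodule] by (auto simp: tclass_def N_simps(5))
qed

lemma grade_N_submodule: "submodule (grade N p) R N"
proof (rule N.submoduleI)
  note sub = P.submoduleE[OF grade_P_submodule]
  note hom = mod_homD[OF coset_hom]
  show "grade N p \<subseteq> carrier N"
    using hom(3) grade_P_closed by (auto simp: N_simps(5))
  show "\<zero>\<^bsub>N\<^esub> \<in> grade N p"
    using mod_hom_zero[OF coset_hom, symmetric] P.submodule_zero[OF grade_P_submodule]
    by (auto simp: N_simps(5))
  show "\<ominus>\<^bsub>N\<^esub> X \<in> grade N p" if "X \<in> grade N p" for X
    using that sub(3) mod_hom_a_inv[OF coset_hom, symmetric] grade_P_closed by (auto simp: N_simps(5))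
  show "X \<oplus>\<^bsub>N\<^esub> Y \<in> grade N p" if "X \<in> grade N p" "Y \<in> grade N p" for X Y
    using that sub(5) hom(4)[symmetric] grade_P_closed by (auto simp: N_simps(5))
  show "r \<odot>\<^bsub>N\<^esub> X \<in> grade N p" if "r \<in> carrier R" "X \<in> grade N p" for r X
    using that sub(4) hom(5)[symmetric] grade_P_closed by (auto simp: N_simps(5))
qed

lemma grade_N_span:
  assumes X: "X \<in> grade N d"
  shows "X \<in> submodule_span R N {tclass p w | p w. walk Q p w p \<and> deg w = d}"
    (is "_ \<in> submodule_span R N ?S")
proof -
  obtain f where f: "f \<in> grade P d" "X = K +>\<^bsub>P\<^esub> f"
    using X by (auto simp: N_simps(5))
  have S: "?S \<subseteq> carrier N"
    by auto
  show ?thesis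
    unfolding f(2)
  proof (rule P.mod_hom_span_into[OF coset_hom N.span_submodule[OF S] _ _ grade_P_span[OF f(1)]])
    show "K +>\<^bsub>P\<^esub> s \<in> submodule_span R N ?S" if s: "s \<in> single R ` {(u, w) \<in> paths Q. deg w = d}" for s
    proof -
      obtain p w where pw: "(p, w) \<in> paths Q" "deg w = d" "s = single R (p, w)"
        using s by auto
      have "tclass p w \<in> submodule_span R N ?S"
        using pw(2) by (intro tclass_span[OF _ S]) auto
      then show ?thesis
        using path_class_tclass[OF pw(1)] by (simp add: pw(3) path_class_eq[symmetric])
    qed
  qed auto
qed

text \<open>Rotation preserves the degree. Applied to \<open>tclass\<close>, this yields the
  projections to the homogeneous components.\<close>

lemma cyclic_fun_restrict_deg:
  assumes M: "Module.module R M" and t: "cyclic_fun M Q t"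
  shows "cyclic_fun M Q (\<lambda>p w. if deg w = d then t p w else \<zero>\<^bsub>M\<^esub>)"
proof -
  interpret M: Module.module R M by (rule M)
  show ?thesis
    unfolding cyclic_fun_def
  proof (intro conjI allI impI)
    show "(if deg w = d then t p w else \<zero>\<^bsub>M\<^esub>) \<in> carrier M" for p w
      using cyclic_fun_closed[OF t] by simp
    show "(if deg (u @ v) = d then t p (u @ v) else \<zero>\<^bsub>M\<^esub>) =
        sgn_if M True (deg u * deg v) (if deg (v @ u) = d then t q (v @ u) else \<zero>\<^bsub>M\<^esub>)"
      if "walk Q p u q" "walk Q q v p" for p q u v
      by (subst cyclic_funD[OF t that]) (simp add: add.commute)
  qed
qed

definition proj :: "bit \<Rightarrow> (('v, 'e) path \<Rightarrow> 'r) set \<Rightarrow> (('v, 'e) path \<Rightarrow> 'r) set" where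
  "proj d = (SOME h. mod_hom R N N h \<and>
     (\<forall>p w. walk Q p w p \<longrightarrow> h (tclass p w) = (if deg w = d then tclass p w else \<zero>\<^bsub>N\<^esub>)))"

lemma proj:
  shows proj_hom: "mod_hom R N N (proj d)"
    and proj_tclass: "walk Q p w p \<Longrightarrow> proj d (tclass p w) = (if deg w = d then tclass p w else \<zero>\<^bsub>N\<^esub>)"
proof -
  have "\<exists>h. mod_hom R N N h \<and>
     (\<forall>p w. walk Q p w p \<longrightarrow> h (tclass p w) = (if deg w = d then tclass p w else \<zero>\<^bsub>N\<^esub>))"
    by (rule N_universal[OF module_N cyclic_fun_restrict_deg[OF module_N tclass_cyclic], of d]) blast
  from someI_ex[OF this] show "mod_hom R N N (proj d)"
    "walk Q p w p \<Longrightarrow> proj d (tclass p w) = (if deg w = d then tclass p w else \<zero>\<^bsub>N\<^esub>)"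
    unfolding proj_def by blast+
qed

sublocale G: graded_module R N proj
proof (intro graded_module.intro graded_module_axioms.intro module_N)
  show "mod_hom R N N (proj p)" for p
    by (rule proj_hom)
  show "submodule (grade N p) R N" for p
    by (rule grade_N_submodule)
  show "proj p X \<in> grade N p" if X: "X \<in> carrier N" for X p
  proof (rule N.mod_hom_span_into[OF proj_hom grade_N_submodule tclasses_closed])
    show "proj p s \<in> grade N p" if "s \<in> tclasses" for s
      using that tclass_grade N.submodule_zero[OF grade_N_submodule]
      by (auto simp: tclasses_def proj_tclass)
  qed (simp add: tclasses_span X)
  show "proj 0 X \<oplus>\<^bsub>N\<^esub> proj 1 X = X" if X: "X \<in> carrier N" for X
  proof (rule N.mod_hom_eq_on_span[OF N.mod_hom_add[OF proj_hom proj_hom] N.mod_hom_id tclasses_closed])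
    show "proj 0 s \<oplus>\<^bsub>N\<^esub> proj 1 s = s" if "s \<in> tclasses" for s
    proof -
      obtain p w where "s = tclass p w" "walk Q p w p"
        using \<open>s \<in> tclasses\<close> by (auto simp: tclasses_def)
      then show ?thesis
        by (cases "deg w") (simp_all add: proj_tclass)
    qed
  qed (simp add: tclasses_span X)
  show "proj q X = (if q = p then X else \<zero>\<^bsub>N\<^esub>)" if X: "X \<in> grade N p" for X p q
  proof -
    have "mod_hom R N N (\<lambda>X. if q = p then X else \<zero>\<^bsub>N\<^esub>)"
      using N.mod_hom_id N.mod_hom_zero_map[OF module_N] by (cases "q = p") simp_all
    then show ?thesis
      by (rule N.mod_hom_eq_on_span[OF proj_hom _ _ _ grade_N_span[OF X]]) (auto simp: proj_tclass)
  qed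
qed

abbreviation "A2 \<equiv> tensor_sq R N"
abbreviation "A3 \<equiv> tensor_cube R N"
abbreviation "pure2 \<equiv> pure_tensor R N N"
abbreviation "pure3 \<equiv> pure_tensor3 R N"

definition tclass2 :: "'v \<Rightarrow> 'e word \<Rightarrow> 'v \<Rightarrow> 'e word \<Rightarrow> ('r, (('v, 'e) path \<Rightarrow> 'r) set) tensor2" where
  "tclass2 p u q v = pure2 (tclass p u) (tclass q v)"

lemma tclass2_closed [simp]: "tclass2 p u q v \<in> carrier A2"
  by (simp add: tclass2_def)

lemma tclass2_cyclic: "cyclic_fun2 A2 Q tclass2"
  unfolding cyclic_fun2_def tclass2_def
  using cyclic_fun_compose[OF G.pure2_hom(1) tclass_cyclic] cyclic_fun_compose[OF G.pure2_hom(2) tclass_cyclic]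
  by simp

text \<open>The cyclic symmetrisation is part of the value, so that the co-Jacobi identity takes the
  form of \<open>cobr_cojacobi\<close>.\<close>

definition tclass3 :: "'v \<Rightarrow> 'e word \<Rightarrow> 'v \<Rightarrow> 'e word \<Rightarrow> 'v \<Rightarrow> 'e word \<Rightarrow>
    ('r, (('v, 'e) path \<Rightarrow> 'r) set) tensor3" where
  "tclass3 p u q v r w = cyc3 R N (pure3 (tclass p u) (tclass q v) (tclass r w))"

lemma tclass3_cyclic: "cyclic_fun3 A3 Q tclass3"
  unfolding cyclic_fun3_def cyclic_fun2_def tclass3_def
  using cyclic_fun_compose[OF mod_hom_compose[OF G.pure3_hom(1) G.cyc3_hom] tclass_cyclic]
    cyclic_fun_compose[OF mod_hom_compose[OF G.pure3_hom(2) G.cyc3_hom] tclass_cyclic]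
    cyclic_fun_compose[OF mod_hom_compose[OF G.pure3_hom(3) G.cyc3_hom] tclass_cyclic]
  by simp

lemma span2: "submodule_span R A2 {pure2 x y | x y. x \<in> tclasses \<and> y \<in> tclasses} = carrier A2"
  and span2_closed: "{pure2 x y | x y. x \<in> tclasses \<and> y \<in> tclasses} \<subseteq> carrier A2"
  using G.span_pure2[OF tclasses_closed tclasses_span] by auto

lemma hom_eq_N:
  assumes "mod_hom R N M f" "mod_hom R N M g" "\<And>p w. walk Q p w p \<Longrightarrow> f (tclass p w) = g (tclass p w)"
    and "X \<in> carrier N"
  shows "f X = g X"
proof (rule N.mod_hom_eq_on_span[OF assms(1,2) tclasses_closed])
  show "f s = g s" if "s \<in> tclasses" for s
    using that assms(3) by (auto simp: tclasses_def)
qed (simp add: tclasses_span assms(4))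

lemma hom_eq_A2:
  assumes "mod_hom R A2 M f" "mod_hom R A2 M g"
    and "\<And>p u q v. walk Q p u p \<Longrightarrow> walk Q q v q \<Longrightarrow> f (tclass2 p u q v) = g (tclass2 p u q v)"
    and "X \<in> carrier A2"
  shows "f X = g X"
proof (rule G.A2.mod_hom_eq_on_span[OF assms(1,2) span2_closed])
  show "f s = g s" if "s \<in> {pure2 x y | x y. x \<in> tclasses \<and> y \<in> tclasses}" for s
    using that assms(3) by (auto simp: tclasses_def tclass2_def)
qed (simp add: span2 assms(4))

lemma hom_eq_A3:
  assumes "mod_hom R A3 M f" "mod_hom R A3 M g"
    and "\<And>p u q v r w. walk Q p u p \<Longrightarrow> walk Q q v q \<Longrightarrow> walk Q r w r \<Longrightarrow>
      f (pure3 (tclass p u) (tclass q v) (tclass r w)) = g (pure3 (tclass p u) (tclass q v) (tclass r w))"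
    and "X \<in> carrier A3"
  shows "f X = g X"
proof (rule G.A3.mod_hom_eq_on_span[OF assms(1,2) G.span_pure3(1)[OF tclasses_closed tclasses_span]])
  show "f s = g s" if "s \<in> {pure3 x y z | x y z. x \<in> tclasses \<and> y \<in> tclasses \<and> z \<in> tclasses}" for s
    using that assms(3) by (auto simp: tclasses_def)
qed (simp add: G.span_pure3(2)[OF tclasses_closed tclasses_span] assms(4))

end

section \<open>Bracket and cobracket as linear maps\<close>

locale cut_operations = path_setting + fixes pm :: bool
begin

sublocale S1: surgery N Q pm ..
sublocale S2: surgery A2 Q pm ..
sublocale S3: surgery A3 Q pm ..

text \<open>One argument is extended at a time. For a fixed word \<open>b\<close> the sum is cyclic
  in \<open>a\<close> and gives a map \<open>H b\<close>; for a fixed element \<open>X\<close> the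
  values \<open>H b X\<close> are cyclic in \<open>b\<close> and give a map
  \<open>g X\<close>.\<close>

lemma br_hom_exists:
  obtains h where "mod_hom R A2 N h"
    "\<And>p a q b. walk Q p a p \<Longrightarrow> walk Q q b q \<Longrightarrow> h (tclass2 p a q b) = S1.br tclass a b"
proof -
  have "\<exists>h. mod_hom R N N h \<and> (\<forall>p a. walk Q p a p \<longrightarrow> h (tclass p a) = S1.br tclass a b)" for b
  proof (rule N_universal[OF module_N, of "\<lambda>p a. S1.br tclass a b"])
    show "cyclic_fun N Q (\<lambda>p a. S1.br tclass a b)"
      unfolding cyclic_fun_def
    proof (intro conjI allI impI)
      show "S1.br tclass (u @ v) b = sgn_if N True (deg u * deg v) (S1.br tclass (v @ u) b)"
        if "walk Q p u q" "walk Q q v p" for p q u v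
        by (rule S1.br_rotate[OF _ that]) simp
    qed simp
  qed blast
  then obtain H where H: "\<And>b. mod_hom R N N (H b)"
    and H_tclass: "\<And>b p a. walk Q p a p \<Longrightarrow> H b (tclass p a) = S1.br tclass a b"
    by metis
  \<comment> \<open>Both sides are linear in \<open>X\<close>, so generators suffice; there
    \<open>br_swap\<close> moves the rotation to the first argument, where \<open>br_rotate\<close>
    applies.\<close>
  have rot: "H (u @ v) X = sgn_if N True (deg u * deg v) (H (v @ u) X)"
    if X: "X \<in> carrier N" and uv: "walk Q p u q" "walk Q q v p" for X p q u v
  proof -
    have "H (u @ v) X = sgn_pow R (deg u * deg v) \<odot>\<^bsub>N\<^esub> H (v @ u) X"
    proof (rule hom_eq_N[OF H N.mod_hom_smult[OF H] _ X])
      fix r a assume a: "walk Q r a r"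
      have w: "walk Q p (u @ v) p" "walk Q q (v @ u) q"
        using uv Q.walk_append by blast+
      have "S1.br tclass a (u @ v) = sgn_if N True (deg u * deg v) (S1.br tclass a (v @ u))"
        unfolding S1.br_swap[OF tclass_cyclic a w(1)] S1.br_swap[OF tclass_cyclic a w(2)]
        by (subst S1.br_rotate[OF _ uv]) (simp_all add: bit_simps)
      then show "H (u @ v) (tclass r a) = sgn_pow R (deg u * deg v) \<odot>\<^bsub>N\<^esub> H (v @ u) (tclass r a)"
        using a by (simp add: H_tclass N.sgn_pow_smult)
    qed simp
    then show ?thesis
      using mod_homD(3)[OF H X] by (simp add: N.sgn_pow_smult)
  qed
  have "\<exists>g. X \<in> carrier N \<longrightarrow> mod_hom R N N g \<and> (\<forall>q b. walk Q q b q \<longrightarrow> g (tclass q b) = H b X)" for X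
  proof (cases "X \<in> carrier N")
    case X: True
    have "cyclic_fun N Q (\<lambda>q b. H b X)"
      unfolding cyclic_fun_def using mod_homD(3)[OF H X] rot[OF X] by blast
    from N_universal[OF module_N this] show ?thesis
      by metis
  qed simp
  then obtain g where g: "\<And>X. X \<in> carrier N \<Longrightarrow> mod_hom R N N (g X)"
    and g_tclass: "\<And>X q b. X \<in> carrier N \<Longrightarrow> walk Q q b q \<Longrightarrow> g X (tclass q b) = H b X"
    by metis
  have g': "mod_hom R N N (\<lambda>X. g X Y)" if Y: "Y \<in> carrier N" for Y
  proof (intro mod_homI module_N)
    show "g X Y \<in> carrier N" if "X \<in> carrier N" for X
      using mod_homD(3)[OF g[OF that] Y] .
    show "g (X \<oplus>\<^bsub>N\<^esub> X') Y = g X Y \<oplus>\<^bsub>N\<^esub> g X' Y" if "X \<in> carrier N" "X' \<in> carrier N" for X X'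
      using that by (intro hom_eq_N[OF g N.mod_hom_add[OF g g] _ Y]) (simp_all add: g_tclass mod_homD(4)[OF H])
    show "g (r \<odot>\<^bsub>N\<^esub> X) Y = r \<odot>\<^bsub>N\<^esub> g X Y" if "r \<in> carrier R" "X \<in> carrier N" for r X
      using that by (intro hom_eq_N[OF g N.mod_hom_smult[OF g] _ Y]) (simp_all add: g_tclass mod_homD(5)[OF H])
  qed
  obtain h where "mod_hom R A2 N h" "\<And>X Y. X \<in> carrier N \<Longrightarrow> Y \<in> carrier N \<Longrightarrow> h (pure2 X Y) = g X Y"
    by (rule G.universal2[OF g' g]) blast+
  then show thesis
    using that[of h] by (simp add: tclass2_def g_tclass H_tclass)
qed

text \<open>The scalar \<open>r\<close> is instantiated by 1/2.\<close>

lemma cobr_hom_exists: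
  assumes r: "r \<in> carrier R"
  obtains h where "mod_hom R N A2 h"
    "\<And>p a. walk Q p a p \<Longrightarrow> h (tclass p a) = r \<odot>\<^bsub>A2\<^esub> S2.cobr tclass2 a"
proof (rule N_universal[OF G.module_A2, of "\<lambda>p a. r \<odot>\<^bsub>A2\<^esub> S2.cobr tclass2 a"])
  show "cyclic_fun A2 Q (\<lambda>p a. r \<odot>\<^bsub>A2\<^esub> S2.cobr tclass2 a)"
    unfolding cyclic_fun_def
  proof (intro conjI allI impI)
    show "r \<odot>\<^bsub>A2\<^esub> S2.cobr tclass2 a \<in> carrier A2" for a
      using r by simp
    show "r \<odot>\<^bsub>A2\<^esub> S2.cobr tclass2 (u @ v) = sgn_if A2 True (deg u * deg v) (r \<odot>\<^bsub>A2\<^esub> S2.cobr tclass2 (v @ u))"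
      if "walk Q p u q" "walk Q q v p" for p q u v
      unfolding S2.cobr_rotate[OF tclass2_closed that] using r by (simp add: G.A2.smult_sgn_if)
  qed
qed (use that in blast)

end

section \<open>The odd IBL structure\<close>

lemma mod_hom_cobr_br:
  assumes h: "mod_hom R M N h" and s: "\<And>p u q v. s p u q v \<in> carrier M" and Q: "fin_digraph Q"
  shows "h (surgery.cobr_br M Q pm s a b) = surgery.cobr_br N Q pm (\<lambda>p u q v. h (s p u q v)) a b"
proof -
  interpret Q: fin_digraph Q by (rule Q)
  interpret M: Module.module R M using mod_homD(1)[OF h] .
  interpret N: Module.module R N using mod_homD(2)[OF h] .
  interpret M: surgery M Q pm ..
  interpret N: surgery N Q pm ..
  show ?thesis
    using s by (simp add: M.cobr_br_def N.cobr_br_def mod_hom_cobr_sum[OF h] mod_hom_sgn_if[OF h]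
        mod_hom_br_sum[OF h])
qed

locale ibl_operations = cut_operations R Q pm
  for R :: "('r, 'm) ring_scheme" and Q :: "('v, 'e) pre_digraph" and pm :: bool +
  fixes brk :: "('r, (('v, 'e) path \<Rightarrow> 'r) set) tensor2 \<Rightarrow> (('v, 'e) path \<Rightarrow> 'r) set"
    and dlt :: "(('v, 'e) path \<Rightarrow> 'r) set \<Rightarrow> ('r, (('v, 'e) path \<Rightarrow> 'r) set) tensor2"
  assumes two: "\<one>\<^bsub>R\<^esub> \<oplus>\<^bsub>R\<^esub> \<one>\<^bsub>R\<^esub> \<in> Units R"
    and brk_linear: "linear_map R A2 N brk"
    and brk_tclass: "walk Q p a p \<Longrightarrow> walk Q q b q \<Longrightarrow> brk (tclass2 p a q b) = S1.br tclass a b"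
    and dlt_linear: "linear_map R N A2 dlt"
    and dlt_tclass: "walk Q p a p \<Longrightarrow> dlt (tclass p a) = half R \<odot>\<^bsub>A2\<^esub> S2.cobr tclass2 a"
begin

lemma brk_hom: "mod_hom R A2 N brk"
  using brk_linear linear_map_iff_mod_hom[OF G.module_A2 module_N] by blast

lemma dlt_hom: "mod_hom R N A2 dlt"
  using dlt_linear linear_map_iff_mod_hom[OF module_N G.module_A2] by blast

lemma half_closed [simp]: "half R \<in> carrier R"
  unfolding half_def using two by (rule R.Units_inv_closed)

text \<open>Removes the factor 2 from the conclusion of \<open>br_cobr\<close>.\<close>

lemma double_eq_zero:
  assumes "X \<in> carrier N" "X \<oplus>\<^bsub>N\<^esub> X = \<zero>\<^bsub>N\<^esub>"
  shows "X = \<zero>\<^bsub>N\<^esub>"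
proof -
  have "X = (half R \<otimes>\<^bsub>R\<^esub> (\<one>\<^bsub>R\<^esub> \<oplus>\<^bsub>R\<^esub> \<one>\<^bsub>R\<^esub>)) \<odot>\<^bsub>N\<^esub> X"
    using assms(1) two by (simp add: half_def)
  also have "\<dots> = half R \<odot>\<^bsub>N\<^esub> (X \<oplus>\<^bsub>N\<^esub> X)"
    using assms(1) by (simp add: N.smult_assoc1 N.smult_l_distr)
  finally show ?thesis
    using assms(2) by simp
qed

abbreviation "brk_id \<equiv> tensor_id R A2 N N brk"
abbreviation "dlt_id \<equiv> tensor_id R N A2 N dlt"
abbreviation "swap \<equiv> koszul_swap R N N"
abbreviation "pureX \<equiv> pure_tensor R A2 N"

lemma brk_id_hom: "mod_hom R A3 A2 brk_id"
  using mod_hom_tensor_id[OF brk_hom module_N] unfolding tensor_cube_def tensor_sq_def .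

lemma dlt_id_hom: "mod_hom R A2 A3 dlt_id"
  using mod_hom_tensor_id[OF dlt_hom module_N] unfolding tensor_cube_def by (simp only: tensor_sq_def)

lemma brk_id_pure3: "x \<in> carrier N \<Longrightarrow> y \<in> carrier N \<Longrightarrow> z \<in> carrier N \<Longrightarrow>
    brk_id (pure3 x y z) = pure2 (brk (pure2 x y)) z"
  unfolding pure_tensor3_def by (rule tensor_id_pure[OF brk_hom module_N]) simp_all

lemma dlt_id_pure2: "x \<in> carrier N \<Longrightarrow> y \<in> carrier N \<Longrightarrow> dlt_id (pure2 x y) = pureX (dlt x) y"
  by (rule tensor_id_pure[OF dlt_hom module_N])

lemma pureX_hom: "z \<in> carrier N \<Longrightarrow> mod_hom R A2 A3 (\<lambda>X. pureX X z)"
  unfolding tensor_cube_def by (rule G.T3.pure_left_hom)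

lemma pureX_tclass2: "pureX (tclass2 p u q v) (tclass r w) = pure3 (tclass p u) (tclass q v) (tclass r w)"
  by (simp add: tclass2_def pure_tensor3_def)

lemma swap_tclass2: "swap (tclass2 p u q v) = sgn_if A2 True (deg u * deg v) (tclass2 q v p u)"
  unfolding tclass2_def by (rule G.swap_pure[OF tclass_grade tclass_grade])

lemma brk_swap: "X \<in> carrier A2 \<Longrightarrow> brk (swap X) = brk X"
proof (rule hom_eq_A2[OF mod_hom_compose[OF G.swap_hom brk_hom] brk_hom])
  fix p u q v assume "walk Q p u p" "walk Q q v q"
  then show "brk (swap (tclass2 p u q v)) = brk (tclass2 p u q v)"
    using S1.br_swap[OF tclass_cyclic, of p u q v]
    by (simp add: swap_tclass2 mod_hom_sgn_if[OF brk_hom] brk_tclass)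
qed

lemma swap_dlt: "X \<in> carrier N \<Longrightarrow> swap (dlt X) = dlt X"
proof (rule hom_eq_N[OF mod_hom_compose[OF dlt_hom G.swap_hom] dlt_hom])
  fix p a assume a: "walk Q p a p"
  have "swap (S2.cobr tclass2 a) = S2.cobr tclass2 a"
    unfolding mod_hom_cobr_sum[OF G.swap_hom tclass2_closed] swap_tclass2
    by (rule S2.cobr_swap[OF tclass2_closed a, symmetric])
  then show "swap (dlt (tclass p a)) = dlt (tclass p a)"
    by (simp add: dlt_tclass[OF a] mod_homD(5)[OF G.swap_hom])
qed

text \<open>Bracketing with a fixed class is linear and so passes through the sum that defines the
  inner bracket; the outer bracket becomes the value at the joined word.\<close>

lemma brk_brk_id:
  assumes u: "walk Q p u p" and v: "walk Q q v q" and w: "walk Q r w r"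
  shows "brk (brk_id (pure3 (tclass p u) (tclass q v) (tclass r w))) =
    S1.br (\<lambda>_ z. S1.br tclass z w) u v"
proof -
  have "brk (brk_id (pure3 (tclass p u) (tclass q v) (tclass r w))) =
      brk (pure2 (S1.br tclass u v) (tclass r w))"
    using brk_tclass[OF u v] by (simp add: brk_id_pure3 tclass2_def)
  also have "\<dots> = S1.br (\<lambda>s z. brk (tclass2 s z r w)) u v"
    unfolding tclass2_def
    by (rule mod_hom_br_sum[OF mod_hom_compose[OF G.pure2_hom(1) brk_hom]]) simp_all
  also have "\<dots> = S1.br (\<lambda>_ z. S1.br tclass z w) u v"
    by (rule S1.br_cong[OF u v]) (rule brk_tclass[OF _ w])
  finally show ?thesis .
qed

lemma jacobi:
  assumes X: "X \<in> carrier A3"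
  shows "brk (brk_id (cyc3 R N X)) = \<zero>\<^bsub>N\<^esub>"
proof (rule hom_eq_A3[OF _ N.mod_hom_zero_map[OF G.module_A3] _ X])
  note hom = mod_hom_compose[OF brk_id_hom brk_hom]
  show "mod_hom R A3 N (\<lambda>X. brk (brk_id (cyc3 R N X)))"
    by (rule mod_hom_compose[OF G.cyc3_hom hom])
  fix p u q v r w assume "walk Q p u p" "walk Q q v q" "walk Q r w r"
  then show "brk (brk_id (cyc3 R N (pure3 (tclass p u) (tclass q v) (tclass r w)))) = \<zero>\<^bsub>N\<^esub>"
    using S1.br_jacobi[OF tclass_cyclic, of p u q v r w]
    by (simp add: G.cyc3_pure[OF tclass_grade tclass_grade tclass_grade] mod_homD(4)[OF hom]
        mod_hom_sgn_if[OF hom] brk_brk_id)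
qed

lemma cojacobi:
  assumes X: "X \<in> carrier N"
  shows "cyc3 R N (dlt_id (dlt X)) = \<zero>\<^bsub>A3\<^esub>"
proof (rule hom_eq_N[OF _ G.A3.mod_hom_zero_map[OF module_N] _ X])
  note hom = mod_hom_compose[OF dlt_id_hom G.cyc3_hom]
  show "mod_hom R N A3 (\<lambda>X. cyc3 R N (dlt_id (dlt X)))"
    by (rule mod_hom_compose[OF dlt_hom hom])
  fix p a assume a: "walk Q p a p"
  \<comment> \<open>The symmetrisation is applied together with the second cobracket, so that the
    factor 1/2 can be taken out and the values become \<open>tclass3\<close>.\<close>
  have inner: "cyc3 R N (dlt_id (tclass2 p u q v)) =
      half R \<odot>\<^bsub>A3\<^esub> S3.cobr (\<lambda>p1 u1 p2 u2. tclass3 p1 u1 p2 u2 q v) u"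
    if u: "walk Q p u p" for p u q v
  proof -
    note hom' = mod_hom_compose[OF pureX_hom G.cyc3_hom, OF tclass_closed]
    have "cyc3 R N (dlt_id (tclass2 p u q v)) = cyc3 R N (pureX (half R \<odot>\<^bsub>A2\<^esub> S2.cobr tclass2 u) (tclass q v))"
      by (simp add: tclass2_def[of p u] dlt_id_pure2 dlt_tclass[OF u])
    also have "\<dots> = half R \<odot>\<^bsub>A3\<^esub> cyc3 R N (pureX (S2.cobr tclass2 u) (tclass q v))"
      by (rule mod_homD(5)[OF hom']) simp_all
    also have "cyc3 R N (pureX (S2.cobr tclass2 u) (tclass q v)) =
        S3.cobr (\<lambda>p1 u1 p2 u2. cyc3 R N (pureX (tclass2 p1 u1 p2 u2) (tclass q v))) u"
      by (rule mod_hom_cobr_sum[OF hom']) simp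
    finally show ?thesis
      by (simp add: pureX_tclass2 tclass3_def)
  qed
  have t3 [simp]: "tclass3 p1 u1 p2 u2 q v \<in> carrier A3" for p1 u1 p2 u2 q v
    unfolding tclass3_def by (rule mod_homD(3)[OF G.cyc3_hom]) simp
  have "cyc3 R N (dlt_id (dlt (tclass p a))) = half R \<odot>\<^bsub>A3\<^esub> cyc3 R N (dlt_id (S2.cobr tclass2 a))"
    unfolding dlt_tclass[OF a] by (rule mod_homD(5)[OF hom]) simp_all
  also have "cyc3 R N (dlt_id (S2.cobr tclass2 a)) =
      S3.cobr (\<lambda>p u q v. cyc3 R N (dlt_id (tclass2 p u q v))) a"
    by (rule mod_hom_cobr_sum[OF hom]) simp
  also have "\<dots> = S3.cobr (\<lambda>_ u q v. half R \<odot>\<^bsub>A3\<^esub> S3.cobr (\<lambda>p1 u1 p2 u2. tclass3 p1 u1 p2 u2 q v) u) a"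
    by (rule S3.cobr_cong[OF a]) (rule inner)
  also have "\<dots> = half R \<odot>\<^bsub>A3\<^esub> S3.cobr (\<lambda>_ u q v. S3.cobr (\<lambda>p1 u1 p2 u2. tclass3 p1 u1 p2 u2 q v) u) a"
    by (rule mod_hom_cobr_sum[OF G.A3.mod_hom_scale, symmetric]) simp_all
  also have "S3.cobr (\<lambda>_ u q v. S3.cobr (\<lambda>p1 u1 p2 u2. tclass3 p1 u1 p2 u2 q v) u) a = \<zero>\<^bsub>A3\<^esub>"
    by (rule S3.cobr_cojacobi[OF tclass3_cyclic a])
      (unfold tclass3_def, rule G.cyc3_rot[OF tclass_grade tclass_grade tclass_grade])
  finally show "cyc3 R N (dlt_id (dlt (tclass p a))) = \<zero>\<^bsub>A3\<^esub>"
    by simp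
qed

lemma involutive:
  assumes X: "X \<in> carrier N"
  shows "brk (dlt X) = \<zero>\<^bsub>N\<^esub>"
proof (rule hom_eq_N[OF mod_hom_compose[OF dlt_hom brk_hom] N.mod_hom_zero_map[OF module_N] _ X])
  fix p a assume a: "walk Q p a p"
  have "brk (dlt (tclass p a)) = half R \<odot>\<^bsub>N\<^esub> brk (S2.cobr tclass2 a)"
    unfolding dlt_tclass[OF a] by (rule mod_homD(5)[OF brk_hom]) simp_all
  also have "brk (S2.cobr tclass2 a) = S1.cobr (\<lambda>p u q v. brk (tclass2 p u q v)) a"
    by (rule mod_hom_cobr_sum[OF brk_hom]) simp
  also have "\<dots> = S1.cobr (\<lambda>_ u _ v. S1.br tclass u v) a"
    by (rule S1.cobr_cong[OF a]) (rule brk_tclass)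
  also have "\<dots> = \<zero>\<^bsub>N\<^esub>"
    by (rule double_eq_zero[OF _ S1.br_cobr[OF tclass_cyclic a]]) simp
  finally show "brk (dlt (tclass p a)) = \<zero>\<^bsub>N\<^esub>"
    by simp
qed

lemma dlt_brk:
  assumes a: "walk Q p a p" and b: "walk Q q b q"
  shows "dlt (brk (tclass2 p a q b)) = half R \<odot>\<^bsub>A2\<^esub> S2.br (\<lambda>_. S2.cobr tclass2) a b"
proof -
  have "dlt (brk (tclass2 p a q b)) = S2.br (\<lambda>p w. dlt (tclass p w)) a b"
    unfolding brk_tclass[OF a b] by (rule mod_hom_br_sum[OF dlt_hom]) simp
  also have "\<dots> = S2.br (\<lambda>_ w. half R \<odot>\<^bsub>A2\<^esub> S2.cobr tclass2 w) a b"
    by (rule S2.br_cong[OF a b]) (rule dlt_tclass)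
  also have "\<dots> = half R \<odot>\<^bsub>A2\<^esub> S2.br (\<lambda>_. S2.cobr tclass2) a b"
    by (rule mod_hom_br_sum[OF G.A2.mod_hom_scale, symmetric]) simp_all
  finally show ?thesis .
qed

lemma brk_id_swap_dlt_id:
  assumes a: "walk Q p a p" and b: "walk Q q b q"
  shows "brk_id (id_tensor_swap R N (dlt_id (tclass2 p a q b))) = half R \<odot>\<^bsub>A2\<^esub> S2.cobr_br tclass2 a b"
proof -
  note hom0 = mod_hom_compose[OF G.id_swap_hom brk_id_hom]
  note hom = mod_hom_compose[OF pureX_hom hom0, OF tclass_closed]
  have inner: "brk_id (id_tensor_swap R N (pureX (tclass2 p u r v) (tclass q b))) =
      sgn_if A2 True (deg v * deg b) (S2.br (\<lambda>s z. tclass2 s z r v) u b)"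
    if u: "walk Q p u p" for p u r v
  proof -
    have "brk_id (id_tensor_swap R N (pureX (tclass2 p u r v) (tclass q b))) =
        sgn_if A2 True (deg v * deg b) (pure2 (brk (tclass2 p u q b)) (tclass r v))"
      unfolding pureX_tclass2
      by (simp add: G.id_swap_pure[OF _ tclass_grade tclass_grade]
          mod_hom_sgn_if[OF brk_id_hom] brk_id_pure3 tclass2_def)
    also have "pure2 (brk (tclass2 p u q b)) (tclass r v) = S2.br (\<lambda>s z. tclass2 s z r v) u b"
      unfolding brk_tclass[OF u b] unfolding tclass2_def by (rule mod_hom_br_sum[OF G.pure2_hom(1)]) simp_all
    finally show ?thesis .
  qed
  have "brk_id (id_tensor_swap R N (dlt_id (tclass2 p a q b))) =
      brk_id (id_tensor_swap R N (pureX (half R \<odot>\<^bsub>A2\<^esub> S2.cobr tclass2 a) (tclass q b)))"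
    by (simp add: tclass2_def[of p a] dlt_id_pure2 dlt_tclass[OF a])
  also have "\<dots> = half R \<odot>\<^bsub>A2\<^esub> brk_id (id_tensor_swap R N (pureX (S2.cobr tclass2 a) (tclass q b)))"
    by (rule mod_homD(5)[OF hom]) simp_all
  also have "brk_id (id_tensor_swap R N (pureX (S2.cobr tclass2 a) (tclass q b))) =
      S2.cobr (\<lambda>p u r v. brk_id (id_tensor_swap R N (pureX (tclass2 p u r v) (tclass q b)))) a"
    by (rule mod_hom_cobr_sum[OF hom]) simp
  also have "\<dots> = S2.cobr_br tclass2 a b"
    unfolding S2.cobr_br_def by (rule S2.cobr_cong[OF a]) (rule inner)
  finally show ?thesis .
qed

lemma compatible:
  assumes X: "X \<in> carrier A2"
  shows "dlt (brk X) \<oplus>\<^bsub>A2\<^esub> sym2 R N (brk_id (id_tensor_swap R N (dlt_id (sym2 R N X)))) = \<zero>\<^bsub>A2\<^esub>"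
proof (rule hom_eq_A2[OF _ G.A2.mod_hom_zero_map[OF G.module_A2] _ X])
  define f where "f = (\<lambda>X. sym2 R N (brk_id (id_tensor_swap R N (dlt_id X))))"
  have f: "mod_hom R A2 A2 f"
    unfolding f_def
    by (rule mod_hom_compose[OF mod_hom_compose[OF mod_hom_compose[OF dlt_id_hom G.id_swap_hom] brk_id_hom] G.sym2_hom])
  show "mod_hom R A2 A2 (\<lambda>X. dlt (brk X) \<oplus>\<^bsub>A2\<^esub> sym2 R N (brk_id (id_tensor_swap R N (dlt_id (sym2 R N X)))))"
    using G.A2.mod_hom_add[OF mod_hom_compose[OF brk_hom dlt_hom] mod_hom_compose[OF G.sym2_hom f]]
    unfolding f_def .
  fix p a q b assume a: "walk Q p a p" and b: "walk Q q b q"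
  \<comment> \<open>These are the images of \<open>tclass2\<close> under the swap. By linearity the
    outer symmetrisation thus only changes the values inside \<open>cobr_br\<close>.\<close>
  define s' where "s' = (\<lambda>p u q v. sgn_if A2 True (deg u * deg v) (tclass2 q v p u))"
  have [simp]: "s' p u q v \<in> carrier A2" for p u q v
    by (simp add: s'_def)
  have f_eq: "f (tclass2 p a q b) = half R \<odot>\<^bsub>A2\<^esub> (S2.cobr_br tclass2 a b \<oplus>\<^bsub>A2\<^esub> S2.cobr_br s' a b)"
    if a: "walk Q p a p" and b: "walk Q q b q" for p a q b
  proof -
    have "swap (S2.cobr_br tclass2 a b) = S2.cobr_br s' a b"
      unfolding mod_hom_cobr_br[OF G.swap_hom tclass2_closed S2.fin_digraph_Q] swap_tclass2 s'_def ..
    then show ?thesis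
      unfolding f_def brk_id_swap_dlt_id[OF a b]
      by (simp add: sym2_def mod_homD(5)[OF G.swap_hom] G.A2.smult_r_distr)
  qed
  have "sym2 R N (tclass2 p a q b) = tclass2 p a q b \<oplus>\<^bsub>A2\<^esub> sgn_if A2 True (deg a * deg b) (tclass2 q b p a)"
    by (simp add: sym2_def swap_tclass2)
  then have "f (sym2 R N (tclass2 p a q b)) = half R \<odot>\<^bsub>A2\<^esub>
      ((S2.cobr_br tclass2 a b \<oplus>\<^bsub>A2\<^esub> S2.cobr_br s' a b) \<oplus>\<^bsub>A2\<^esub>
        sgn_if A2 True (deg a * deg b) (S2.cobr_br tclass2 b a \<oplus>\<^bsub>A2\<^esub> S2.cobr_br s' b a))"
    by (simp add: mod_homD(4)[OF f] mod_hom_sgn_if[OF f] f_eq[OF a b] f_eq[OF b a] G.A2.smult_sgn_if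
        G.A2.smult_r_distr)
  then have "dlt (brk (tclass2 p a q b)) \<oplus>\<^bsub>A2\<^esub> f (sym2 R N (tclass2 p a q b)) =
      half R \<odot>\<^bsub>A2\<^esub> (S2.br (\<lambda>_. S2.cobr tclass2) a b \<oplus>\<^bsub>A2\<^esub>
      ((S2.cobr_br tclass2 a b \<oplus>\<^bsub>A2\<^esub> S2.cobr_br s' a b) \<oplus>\<^bsub>A2\<^esub>
        sgn_if A2 True (deg a * deg b) (S2.cobr_br tclass2 b a \<oplus>\<^bsub>A2\<^esub> S2.cobr_br s' b a)))"
    by (simp add: dlt_brk[OF a b] G.A2.smult_r_distr)
  also have "\<dots> = \<zero>\<^bsub>A2\<^esub>"
    unfolding s'_def S2.br_cobr_compat[OF tclass2_cyclic a b] by simp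
  finally show "dlt (brk (tclass2 p a q b)) \<oplus>\<^bsub>A2\<^esub>
      sym2 R N (brk_id (id_tensor_swap R N (dlt_id (sym2 R N (tclass2 p a q b))))) = \<zero>\<^bsub>A2\<^esub>"
    unfolding f_def .
qed

text \<open>By \<open>br_cong\<close> values of the wrong degree may be replaced by zero without
  changing the sum; afterwards every summand lies in the submodule
  \<open>grade N (deg a + deg b + 1)\<close>.\<close>

lemma br_grade:
  assumes a: "walk Q p a p" and b: "walk Q q b q"
  shows "S1.br tclass a b \<in> grade N (deg a + deg b + 1)"
proof -
  have "S1.br tclass a b = S1.br (\<lambda>r w. if deg w = deg a + deg b + 1 then tclass r w else \<zero>\<^bsub>N\<^esub>) a b"
    by (rule S1.br_cong[OF a b]) simp
  also have "\<dots> \<in> grade N (deg a + deg b + 1)"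
    using tclass_grade N.submodule_zero[OF grade_N_submodule]
    by (intro N.br_sum_submodule[OF grade_N_submodule]) (metis (full_types))
  finally show ?thesis .
qed

lemma grade_A2_submodule: "submodule (grade A2 d) R A2"
  unfolding G.grade_A2 by (rule G.A2.span_submodule) (auto simp: G.grade_closed)

lemma cobr_grade:
  assumes a: "walk Q p a p"
  shows "S2.cobr tclass2 a \<in> grade A2 (deg a + 1)"
proof -
  have t: "tclass2 p u q v \<in> grade A2 (deg u + deg v)" for p u q v
    unfolding G.grade_A2 tclass2_def
    by (rule subsetD[OF G.A2.span_superset]) (use tclass_grade in blast)
  have "S2.cobr tclass2 a = S2.cobr (\<lambda>p u q v. if deg u + deg v = deg a + 1 then tclass2 p u q v else \<zero>\<^bsub>A2\<^esub>) a"
    by (rule S2.cobr_cong[OF a]) simp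
  also have "\<dots> \<in> grade A2 (deg a + 1)"
    using t G.A2.submodule_zero[OF grade_A2_submodule]
    by (intro G.A2.cobr_sum_submodule[OF grade_A2_submodule]) (metis (full_types))
  finally show ?thesis .
qed

lemma brk_odd: "odd_map R A2 N brk"
  unfolding odd_map_def
proof (intro conjI allI brk_linear image_subsetI)
  fix d X assume X: "X \<in> grade A2 d"
  show "brk X \<in> grade N (d + 1)"
  proof (rule G.A2.mod_hom_span_into[OF brk_hom grade_N_submodule _ _ X[unfolded G.grade_A2]])
    fix s assume "s \<in> {pure2 x y | x y p q. x \<in> grade N p \<and> y \<in> grade N q \<and> p + q = d}"
    then obtain x y d1 d2 where s: "s = pure2 x y" and x: "x \<in> grade N d1" and y: "y \<in> grade N d2"
      and d: "d1 + d2 = d"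
      by blast
    \<comment> \<open>Each homogeneous component is spanned by classes of closed words of its
      degree, so the two arguments are reduced to such classes one after the other.\<close>
    have 1: "brk (pure2 (tclass p a) y) \<in> grade N (deg a + d2 + 1)" if a: "walk Q p a p" for p a
      by (rule N.mod_hom_span_into[OF mod_hom_compose[OF G.pure2_hom(2) brk_hom] grade_N_submodule _ _ grade_N_span[OF y]])
        (use br_grade[OF a] brk_tclass[OF a] in \<open>auto simp: tclass2_def\<close>)
    have "brk (pure2 x y) \<in> grade N (d1 + d2 + 1)"
      by (rule N.mod_hom_span_into[OF mod_hom_compose[OF G.pure2_hom(1) brk_hom] grade_N_submodule _ _ grade_N_span[OF x]])
        (use 1 G.grade_closed[OF y] in auto)
    then show "brk s \<in> grade N (d + 1)"
      by (simp add: s d)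
  qed (auto simp: G.grade_closed)
qed

lemma dlt_odd: "odd_map R N A2 dlt"
  unfolding odd_map_def
proof (intro conjI allI dlt_linear image_subsetI)
  fix d X assume X: "X \<in> grade N d"
  show "dlt X \<in> grade A2 (d + 1)"
    by (rule N.mod_hom_span_into[OF dlt_hom grade_A2_submodule _ _ grade_N_span[OF X]])
      (auto simp: dlt_tclass intro!: G.A2.submoduleE(4)[OF grade_A2_submodule] cobr_grade)
qed

theorem odd_IBL: "odd_IBL_algebra R N brk dlt"
  unfolding odd_IBL_algebra_def Let_def
  by (intro conjI ballI G.supermodule_A brk_odd dlt_odd brk_swap swap_dlt jacobi cojacobi
      involutive compatible)

end

section \<open>Comparison with the defining formulas on words\<close>

context fin_digraph
begin

lemma walk_nth:
  assumes "walk G p a q" "i < length a"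
  shows "walk G p (take i a) (tail (double_quiver G) (a ! i))" "a ! i \<in> arcs (double_quiver G)"
    "walk G (head (double_quiver G) (a ! i)) (drop (Suc i) a) q"
  using assms(1) unfolding id_take_nth_drop[OF assms(2), THEN arg_cong, of "\<lambda>a. walk G p a q"]
  by (auto simp: walk_append_iff walk_Cons_iff)

lemma walk_between_same:
  "walk G p a p \<Longrightarrow> i < length a \<Longrightarrow>
    walk G (head (double_quiver G) (a ! i)) (between a i i) (tail (double_quiver G) (a ! i))"
  using walk_nth[of p a p i] by (auto simp: between_same intro: walk_append)

lemma walk_between:
  assumes a: "walk G p a p" and ij: "i < length a" "j < length a" "i \<noteq> j"
  shows "walk G (head (double_quiver G) (a ! i)) (between a i j) (tail (double_quiver G) (a ! j))"
proof (cases "i < j")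
  case True
  then show ?thesis
    using walk_nth(1)[OF walk_nth(3)[OF a ij(1)], of "j - Suc i"] ij by (simp add: between_less)
next
  case False
  then show ?thesis
    using walk_nth(3)[OF a ij(1)] walk_nth(1)[OF a ij(2)] ij
    by (auto simp: between_greater intro: walk_append)
qed

end

lemma deg_drop: "i < length a \<Longrightarrow> deg (drop i a) = arrow_deg (a ! i) + deg (drop (Suc i) a)"
  by (simp add: Cons_nth_drop_Suc[symmetric])

text \<open>Both sides are the degree of the cyclic word without its letter at \<open>i\<close>; on
  the right it is split at \<open>j\<close>.\<close>

lemma deg_between_same:
  assumes "i < length a" "j < length a" "i \<noteq> j"
  shows "deg (drop (Suc i) a) + deg (take i a) = deg (between a i j) + arrow_deg (a ! j) + deg (between a j i)"
proof -
  have "deg (drop (Suc i) a) = deg (take (j - Suc i) (drop (Suc i) a)) + arrow_deg (a ! j) + deg (drop (Suc j) a)"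
    if "i < j" "j < length a" for i j
    using that id_take_nth_drop[of "j - Suc i" "drop (Suc i) a", THEN arg_cong, of deg]
    by (simp add: add.assoc)
  moreover have "deg (take j a) = deg (take i a) + arrow_deg (a ! i) + deg (take (j - Suc i) (drop (Suc i) a))"
    if "i < j" "j < length a" for i j
    using that id_take_nth_drop[of i "take j a", THEN arg_cong, of deg]
    by (simp add: add.assoc drop_take)
  ultimately show ?thesis
    using assms by (cases "i < j") (simp_all add: between_less between_greater ac_simps)
qed

context path_setting
begin

lemma br_minus_word_eq:
  assumes a: "walk Q p a p" and b: "walk Q q b q"
  shows "br_minus_word R Q a b = br_sum N Q False tclass a b"
  unfolding br_minus_word_def N.br_sum_finsum[OF tclass_closed]
proof (intro N.finsum_cong' refl, goal_cases)
  case (2 x)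
  obtain i j where ij: "x = (i, j)" "i < length a" "j < length b" "paired (a ! i) (b ! j)"
    using 2 by (auto simp: paired_positions_def)
  have "walk Q (start False Q (a ! i)) (between a i i @ between b j j) (start False Q (a ! i))"
    using Q.walk_between_same[OF a ij(2)] Q.walk_between_same[OF b ij(3)] paired_stop[OF ij(4), of False Q]
      paired_stop[OF ij(4)[THEN paired_sym[THEN iffD1]], of False Q]
    by (auto simp: start_def stop_def intro: Q.walk_append)
  from path_class_tclass[OF walk_paths[OF this]]
  show ?case
    using ij by (simp add: start_def residue_def N.sgn_pow_smult deg_drop)
qed auto

text \<open>The two exponents differ by \<open>deg (between a i i) * (arrow_deg (a ! i) + arrow_deg
  (b ! j) + 1)\<close>, which is zero for paired letters.\<close>

lemma br_plus_word_eq: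
  assumes a: "walk Q p a p" and b: "walk Q q b q"
  shows "br_plus_word R Q a b = br_sum N Q True tclass a b"
  unfolding br_plus_word_def N.br_sum_finsum[OF tclass_closed]
proof (intro N.finsum_cong' refl, goal_cases)
  case (2 x)
  obtain i j where ij: "x = (i, j)" "i < length a" "j < length b" "paired (a ! i) (b ! j)"
    using 2 by (auto simp: paired_positions_def)
  have "walk Q (start True Q (a ! i)) ([a ! i] @ between a i i @ [a ! i, b ! j] @ between b j j @ [b ! j])
      (start True Q (a ! i))"
    using Q.walk_between_same[OF a ij(2)] Q.walk_between_same[OF b ij(3)] paired_stop[OF ij(4), of True Q]
      paired_stop[OF ij(4)[THEN paired_sym[THEN iffD1]], of True Q] Q.walk_nth(2)[OF a ij(2)] Q.walk_nth(2)[OF b ij(3)]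
    by (auto simp: start_def stop_def Q.walk_Cons_iff Q.walk_append_iff Q.walk_Nil_iff
      intro: wf_digraph.tail_in_verts[OF Q.wf_double] wf_digraph.head_in_verts[OF Q.wf_double])
  from path_class_tclass[OF walk_paths[OF this]]
  show ?case
    using ij by (simp add: start_def residue_def N.sgn_pow_smult deg_drop between_same
        paired_arrow_deg[OF ij(4)] bit_simps)
qed auto

lemma delta_minus_word_eq:
  assumes a: "walk Q p a p"
  shows "delta_minus_word R Q a = half R \<odot>\<^bsub>A2\<^esub> cobr_sum A2 Q False tclass2 a"
  unfolding delta_minus_word_def G.A2.cobr_sum_finsum[OF tclass2_closed]
proof (intro arg_cong[where f = "\<lambda>X. half R \<odot>\<^bsub>A2\<^esub> X"] G.A2.finsum_cong' refl, goal_cases)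
  case (2 x)
  obtain i j where ij: "x = (i, j)" "i < length a" "j < length a" "paired (a ! i) (a ! j)"
    using 2 by (auto simp: paired_positions_def)
  then have neq: "i \<noteq> j"
    by auto
  have "walk Q (start False Q (a ! i)) (between a i j) (start False Q (a ! i))"
    "walk Q (start False Q (a ! j)) (between a j i) (start False Q (a ! j))"
    using Q.walk_between[OF a ij(2,3) neq] Q.walk_between[OF a ij(3,2) neq[symmetric]] paired_stop[OF ij(4), of False Q]
      paired_stop[OF ij(4)[THEN paired_sym[THEN iffD1]], of False Q]
    by (auto simp: start_def stop_def)
  note path_class_tclass[OF walk_paths[OF this(1)]] path_class_tclass[OF walk_paths[OF this(2)]]
  then show ?case
    using ij by (simp add: start_def residue_def tclass2_def G.A2.sgn_pow_smult deg_drop)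
qed auto

lemma delta_plus_word_eq:
  assumes a: "walk Q p a p"
  shows "delta_plus_word R Q a = half R \<odot>\<^bsub>A2\<^esub> cobr_sum A2 Q True tclass2 a"
  unfolding delta_plus_word_def G.A2.cobr_sum_finsum[OF tclass2_closed]
proof (intro arg_cong[where f = "\<lambda>X. half R \<odot>\<^bsub>A2\<^esub> X"] G.A2.finsum_cong' refl, goal_cases)
  case (2 x)
  obtain i j where ij: "x = (i, j)" "i < length a" "j < length a" "paired (a ! i) (a ! j)"
    using 2 by (auto simp: paired_positions_def)
  then have neq: "i \<noteq> j"
    by auto
  have w: "walk Q (start True Q (a ! i)) ([a ! i] @ between a i j @ [a ! j]) (start True Q (a ! i))"
    "walk Q (start True Q (a ! j)) ([a ! j] @ between a j i @ [a ! i]) (start True Q (a ! j))"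
    using Q.walk_between[OF a ij(2,3) neq] Q.walk_between[OF a ij(3,2) neq[symmetric]] paired_stop[OF ij(4), of True Q]
      paired_stop[OF ij(4)[THEN paired_sym[THEN iffD1]], of True Q] Q.walk_nth(2)[OF a ij(2)] Q.walk_nth(2)[OF a ij(3)]
    by (auto simp: start_def stop_def Q.walk_Cons_iff Q.walk_append_iff Q.walk_Nil_iff
      intro: wf_digraph.tail_in_verts[OF Q.wf_double] wf_digraph.head_in_verts[OF Q.wf_double])
  \<comment> \<open>Once the degree of the tail is expressed by \<open>deg_between_same\<close>, the
    difference is \<open>deg (between a i j) * (arrow_deg (a ! i) + arrow_deg (a ! j) + 1)\<close>,
    which is zero for paired letters.\<close>
  have sign: "deg (take i a) * deg (drop i a) + deg (between a i j) + deg (between a j i) * arrow_deg (a ! i)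
        + arrow_deg (a ! j) =
      (deg (take i a) + arrow_deg (a ! i)) * deg (drop (Suc i) a) +
      (arrow_deg (a ! i) + deg (between a i j) + arrow_deg (a ! j)) * arrow_deg (a ! j)"
  proof -
    have "deg (drop (Suc i) a) = deg (take i a) + (deg (between a i j) + arrow_deg (a ! j) + deg (between a j i))"
      unfolding deg_between_same[OF ij(2,3) neq, symmetric] by (simp add: bit_simps)
    then show ?thesis
      using ij(2) by (simp add: deg_drop paired_arrow_deg[OF ij(4)] bit_simps)
  qed
  note path_class_tclass[OF walk_paths[OF w(1)]] path_class_tclass[OF walk_paths[OF w(2)]]
  then show ?case
    using ij(1) by (simp add: start_def residue_def tclass2_def G.A2.sgn_pow_smult sign)
qed auto

lemma path_class_closed_path: "walk Q p a p \<Longrightarrow> path_class R Q (p, a) = tclass p a"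
  by (simp add: tclass_def)

end

context cut_operations
begin

lemma is_bracket_iff:
  assumes "\<And>p a q b. walk Q p a p \<Longrightarrow> walk Q q b q \<Longrightarrow> val a b = S1.br tclass a b"
  shows "is_bracket R Q val h \<longleftrightarrow> linear_map R A2 N h \<and>
    (\<forall>p a q b. walk Q p a p \<longrightarrow> walk Q q b q \<longrightarrow> h (tclass2 p a q b) = S1.br tclass a b)"
  using assms by (auto simp: is_bracket_def closed_paths_def tclass2_def path_class_closed_path)

lemma is_cobracket_iff:
  assumes "\<And>p a. walk Q p a p \<Longrightarrow> val a = half R \<odot>\<^bsub>A2\<^esub> S2.cobr tclass2 a"
  shows "is_cobracket R Q val h \<longleftrightarrow> linear_map R N A2 h \<and>
    (\<forall>p a. walk Q p a p \<longrightarrow> h (tclass p a) = half R \<odot>\<^bsub>A2\<^esub> S2.cobr tclass2 a)"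
  using assms by (auto simp: is_cobracket_def closed_paths_def path_class_closed_path)

text \<open>The maps chosen by \<open>THE\<close> satisfy their specifications only after unique
  existence has been shown: existence comes from the universal properties, uniqueness from the
  generation by classes of closed words.\<close>

theorem odd_IBL_THE:
  assumes two: "\<one>\<^bsub>R\<^esub> \<oplus>\<^bsub>R\<^esub> \<one>\<^bsub>R\<^esub> \<in> Units R"
    and br: "\<And>p a q b. walk Q p a p \<Longrightarrow> walk Q q b q \<Longrightarrow> br_val a b = S1.br tclass a b"
    and cobr: "\<And>p a. walk Q p a p \<Longrightarrow> cobr_val a = half R \<odot>\<^bsub>A2\<^esub> S2.cobr tclass2 a"
  shows "(\<exists>!br. is_bracket R Q br_val br) \<and> (\<exists>!\<delta>. is_cobracket R Q cobr_val \<delta>) \<and>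
    odd_IBL_algebra R N (THE br. is_bracket R Q br_val br) (THE \<delta>. is_cobracket R Q cobr_val \<delta>)"
proof -
  have half: "half R \<in> carrier R"
    unfolding half_def using two by (rule R.Units_inv_closed)
  have br_iff: "is_bracket R Q br_val h \<longleftrightarrow> linear_map R A2 N h \<and>
      (\<forall>p a q b. walk Q p a p \<longrightarrow> walk Q q b q \<longrightarrow> h (tclass2 p a q b) = S1.br tclass a b)" for h
    by (rule is_bracket_iff) (rule br)
  have cobr_iff: "is_cobracket R Q cobr_val h \<longleftrightarrow> linear_map R N A2 h \<and>
      (\<forall>p a. walk Q p a p \<longrightarrow> h (tclass p a) = half R \<odot>\<^bsub>A2\<^esub> S2.cobr tclass2 a)" for h
    by (rule is_cobracket_iff) (rule cobr)
  obtain h where h: "mod_hom R A2 N h"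
    "\<And>p a q b. walk Q p a p \<Longrightarrow> walk Q q b q \<Longrightarrow> h (tclass2 p a q b) = S1.br tclass a b"
    using br_hom_exists by blast
  have br_unique: "\<exists>!br. is_bracket R Q br_val br"
    unfolding br_iff
    by (rule linear_map_THE(1)[OF h(1) _ span2_closed span2])
      (use h(2) in \<open>auto simp: tclasses_def tclass2_def\<close>)
  obtain k where k: "mod_hom R N A2 k"
    "\<And>p a. walk Q p a p \<Longrightarrow> k (tclass p a) = half R \<odot>\<^bsub>A2\<^esub> S2.cobr tclass2 a"
    using cobr_hom_exists[OF half] by blast
  have cobr_unique: "\<exists>!\<delta>. is_cobracket R Q cobr_val \<delta>"
    unfolding cobr_iff
    by (rule linear_map_THE(1)[OF k(1) _ tclasses_closed tclasses_span])
      (use k(2) in \<open>auto simp: tclasses_def\<close>)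
  have "is_bracket R Q br_val (THE br. is_bracket R Q br_val br)"
    "is_cobracket R Q cobr_val (THE \<delta>. is_cobracket R Q cobr_val \<delta>)"
    using theI'[OF br_unique] theI'[OF cobr_unique] .
  then have "ibl_operations R Q pm (THE br. is_bracket R Q br_val br) (THE \<delta>. is_cobracket R Q cobr_val \<delta>)"
    unfolding br_iff cobr_iff
    by unfold_locales (use two in blast)+
  then show ?thesis
    using br_unique cobr_unique ibl_operations.odd_IBL by blast
qed

end

theorem corollary5p8:
  fixes R :: "('r, 'm) ring_scheme" and Q :: "('v, 'e) pre_digraph"
  assumes "cring R"
    and "\<one>\<^bsub>R\<^esub> \<oplus>\<^bsub>R\<^esub> \<one>\<^bsub>R\<^esub> \<in> Units R"
    and "fin_digraph Q"
  shows "((\<exists>!br. is_bracket R Q (br_minus_word R Q) br) \<and>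
          (\<exists>!\<delta>. is_cobracket R Q (delta_minus_word R Q) \<delta>) \<and>
          odd_IBL_algebra R (N_gr R Q) (br_minus R Q) (delta_minus R Q)) \<and>
         ((\<exists>!br. is_bracket R Q (br_plus_word R Q) br) \<and>
          (\<exists>!\<delta>. is_cobracket R Q (delta_plus_word R Q) \<delta>) \<and>
          odd_IBL_algebra R (N_gr R Q) (br_plus R Q) (delta_plus R Q))"
proof -
  interpret R: cring R by fact
  interpret Q: fin_digraph Q by fact
  interpret path_setting R Q ..
  interpret minus: cut_operations R Q False ..
  interpret plus: cut_operations R Q True ..
  show ?thesis
    unfolding br_minus_def delta_minus_def br_plus_def delta_plus_def
    by (intro conjI[OF minus.odd_IBL_THE plus.odd_IBL_THE] assms(2) br_minus_word_eq br_plus_word_eq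
        delta_minus_word_eq delta_plus_word_eq)
qed

end
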